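(* Let $d\ge2$, let $h$ be the log-correlated Gaussian field on $\mathbb R^d$, and let $f\in C_c^\infty(\mathbb R^d)$ be a smooth compactly supported function. Then the law of $h+f$ is absolutely continuous with respect to the law of $h$, where both are viewed as random generalized functions modulo additive constant.
   Context: Log-correlated Gaussian field: the centered Gaussian random generalized function $h$ on $\mathbb R^d$ such that for smooth compactly supported $g$ with $\int_{\mathbb R^d}g=0$, $\int gh$ is centered Gaussian with variance $\iint g(z)g(w)\log\frac1{|z-w|}\,dz\,dw$, with additive constant fixed so that the average of $h$ over the unit sphere is zero. Viewed modulo additive constant, it is determined by its pairings with such mean-zero $g$. *)

theory Defs
  imports "HOL-Probability.Probability"
begin

text \<open>Test functions. The directions in the list are standard basis vectors; if all iterated
  partial derivatives exist and are Frechet differentiable everywhere, they are all continuous,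
  so the function is infinitely differentiable in the usual sense.\<close>

primrec iter_partial :: "'a list \<Rightarrow> ('a::euclidean_space \<Rightarrow> real) \<Rightarrow> 'a \<Rightarrow> real" where
  "iter_partial [] f = f"
| "iter_partial (b # bs) f = (\<lambda>x. frechet_derivative (iter_partial bs f) (at x) b)"

definition smooth :: "('a::euclidean_space \<Rightarrow> real) \<Rightarrow> bool" where
  "smooth f \<longleftrightarrow> (\<forall>bs. set bs \<subseteq> Basis \<longrightarrow> (\<forall>x. iter_partial bs f differentiable at x))"

definition supp :: "('a::euclidean_space \<Rightarrow> real) \<Rightarrow> 'a set" where
  "supp f = closure {x. f x \<noteq> 0}"

definition test_functions :: "('a::euclidean_space \<Rightarrow> real) set" where
  "test_functions = {g. smooth g \<and> compact (supp g)}"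

definition mean_zero_test_functions :: "('a::euclidean_space \<Rightarrow> real) set" where
  "mean_zero_test_functions = {g \<in> test_functions. (LINT x|lborel. g x) = 0}"

text \<open>Generalized functions (Schwartz distributions): linear functionals on the test functions which,
  on test functions supported in any given compact set, are bounded by some C-k norm. They are
  represented as functions with value \<open>undefined\<close> off the test functions.\<close>

definition Ck_norm :: "nat \<Rightarrow> ('a::euclidean_space \<Rightarrow> real) \<Rightarrow> real" where
  "Ck_norm k g = (\<Sum>bs | set bs \<subseteq> Basis \<and> length bs \<le> k. SUP x. \<bar>iter_partial bs g x\<bar>)"

definition generalized_functions :: "(('a::euclidean_space \<Rightarrow> real) \<Rightarrow> real) set" where
  "generalized_functions = {T \<in> extensional test_functions.
     (\<forall>g\<in>test_functions. \<forall>g'\<in>test_functions. T (\<lambda>x. g x + g' x) = T g + T g') \<and>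
     (\<forall>c. \<forall>g\<in>test_functions. T (\<lambda>x. c * g x) = c * T g) \<and>
     (\<forall>K. compact K \<longrightarrow> (\<exists>C k. \<forall>g\<in>test_functions. supp g \<subseteq> K \<longrightarrow> \<bar>T g\<bar> \<le> C * Ck_norm k g))}"

definition add_function ::
  "(('a::euclidean_space \<Rightarrow> real) \<Rightarrow> real) \<Rightarrow> ('a \<Rightarrow> real) \<Rightarrow> (('a \<Rightarrow> real) \<Rightarrow> real)" where
  "add_function T f = (\<lambda>g\<in>test_functions. T g + (LINT x|lborel. f x * g x))"

text \<open>The class of a generalized function modulo additive constants is represented by its
  restriction to the mean-zero test functions; see \<open>mod_const_eq_iff\<close> below.\<close>

definition mod_const ::
  "(('a::euclidean_space \<Rightarrow> real) \<Rightarrow> real) \<Rightarrow> (('a \<Rightarrow> real) \<Rightarrow> real)" where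
  "mod_const T = restrict T mean_zero_test_functions"

text \<open>Both spaces carry the sigma-algebra generated by the pairings with (mean-zero) test
  functions, i.e. the trace of the product sigma-algebra.\<close>

definition gf_space :: "(('a::euclidean_space \<Rightarrow> real) \<Rightarrow> real) measure" where
  "gf_space = restrict_space (PiM test_functions (\<lambda>_. borel)) generalized_functions"

definition gf_mod_const_space :: "(('a::euclidean_space \<Rightarrow> real) \<Rightarrow> real) measure" where
  "gf_mod_const_space =
     restrict_space (PiM mean_zero_test_functions (\<lambda>_. borel)) (mod_const ` generalized_functions)"

definition law_mod_const ::
  "'w measure \<Rightarrow> ('w \<Rightarrow> ('a::euclidean_space \<Rightarrow> real) \<Rightarrow> real) \<Rightarrow> (('a \<Rightarrow> real) \<Rightarrow> real) measure" where
  "law_mod_const M h = distr M gf_mod_const_space (\<lambda>\<omega>. mod_const (h \<omega>))"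

text \<open>The case of variance zero is the point mass at zero.\<close>

definition centered_gaussian :: "'w measure \<Rightarrow> ('w \<Rightarrow> real) \<Rightarrow> real \<Rightarrow> bool" where
  "centered_gaussian M X v \<longleftrightarrow> X \<in> borel_measurable M \<and> 0 \<le> v \<and>
     distr M borel X =
       (if v = 0 then return borel 0 else density lborel (normal_density 0 (sqrt v)))"

definition log_variance :: "('a::euclidean_space \<Rightarrow> real) \<Rightarrow> real" where
  "log_variance g = (LINT z|lborel. LINT w|lborel. g z * g w * ln (1 / norm (z - w)))"

text \<open>The uniform probability measure on the unit sphere is the image of the uniform measure on the
  unit ball under the radial projection \<open>sgn\<close>. A generalized function cannot be paired with it
  directly, so the average over the sphere is the limit (in probability) of the pairings with its
  mollifications.\<close>

definition uniform_sphere :: "'a::euclidean_space measure" where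
  "uniform_sphere = distr (uniform_measure lborel (ball 0 1)) borel sgn"

definition mollified_sphere :: "('a::euclidean_space \<Rightarrow> real) \<Rightarrow> real \<Rightarrow> 'a \<Rightarrow> real" where
  "mollified_sphere \<phi> \<epsilon> =
     (\<lambda>z. LINT y|uniform_sphere. \<phi> ((1 / \<epsilon>) *\<^sub>R (z - y)) / \<epsilon> ^ DIM('a))"

definition sphere_average_zero ::
  "'w measure \<Rightarrow> ('w \<Rightarrow> ('a::euclidean_space \<Rightarrow> real) \<Rightarrow> real) \<Rightarrow> bool" where
  "sphere_average_zero M h \<longleftrightarrow>
     (\<forall>\<phi>\<in>test_functions. (LINT x|lborel. \<phi> x) = 1 \<longrightarrow>
       (\<forall>\<delta>>0. ((\<lambda>\<epsilon>. measure M {\<omega> \<in> space M. \<bar>h \<omega> (mollified_sphere \<phi> \<epsilon>)\<bar> > \<delta>}) \<longlongrightarrow> 0) (at_right 0)))"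

definition log_correlated_gaussian_field ::
  "'w measure \<Rightarrow> ('w \<Rightarrow> ('a::euclidean_space \<Rightarrow> real) \<Rightarrow> real) \<Rightarrow> bool" where
  "log_correlated_gaussian_field M h \<longleftrightarrow>
     prob_space M \<and> h \<in> M \<rightarrow>\<^sub>M gf_space \<and>
     (\<forall>g\<in>mean_zero_test_functions. centered_gaussian M (\<lambda>\<omega>. h \<omega> g) (log_variance g)) \<and>
     sphere_average_zero M h"


text \<open>Sanity checks: the representation modulo constants identifies exactly the generalized
  functions that differ by a constant, and the maps whose laws are taken are measurable.\<close>

lemma smooth_continuous: "smooth g \<Longrightarrow> continuous_on UNIV g"
  unfolding smooth_def
  by (metis (no_types, lifting) continuous_at_imp_continuous_on differentiable_imp_continuous_within
      empty_subsetI iter_partial.simps(1) list.set(1))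

lemma integrable_continuous_compact_support:
  fixes g :: "'a::euclidean_space \<Rightarrow> real"
  assumes "continuous_on UNIV g" "compact (supp g)"
  shows "integrable lborel g"
proof -
  have "integrable lborel (\<lambda>x. indicator (supp g) x *\<^sub>R g x)"
    using assms by (intro borel_integrable_compact) (auto intro: continuous_on_subset)
  moreover have "(\<lambda>x. indicator (supp g) x *\<^sub>R g x) = g"
    by (auto simp: fun_eq_iff indicator_def supp_def intro: closure_subset[THEN subsetD])
  ultimately show ?thesis by simp
qed

lemma test_function_integrable: "g \<in> test_functions \<Longrightarrow> integrable lborel g"
  by (auto simp: test_functions_def intro: integrable_continuous_compact_support smooth_continuous)

lemma supp_add: "supp (\<lambda>x. f x + g x) \<subseteq> supp f \<union> supp g"
  unfolding supp_def closure_Un[symmetric] by (rule closure_mono) auto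

lemma supp_mult: "supp (\<lambda>x. c x * g x) \<subseteq> supp g"
  unfolding supp_def by (rule closure_mono) auto

lemma compact_supp_subset: "compact K \<Longrightarrow> supp f \<subseteq> K \<Longrightarrow> compact (supp f)"
  by (metis closed_closure compact_Int_closed inf.absorb_iff2 supp_def)

lemma iter_partial_combine:
  assumes "smooth f" "smooth g" "set bs \<subseteq> Basis"
  shows "iter_partial bs (\<lambda>x. a * f x + c * g x) = (\<lambda>x. a * iter_partial bs f x + c * iter_partial bs g x)"
  using assms(3)
proof (induction bs)
  case Nil
  then show ?case by simp
next
  case (Cons b bs)
  show ?case
  proof
    fix x
    have "(iter_partial bs f has_derivative frechet_derivative (iter_partial bs f) (at x)) (at x)"
         "(iter_partial bs g has_derivative frechet_derivative (iter_partial bs g) (at x)) (at x)"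
      using assms(1,2) Cons.prems by (auto simp: smooth_def frechet_derivative_works[symmetric])
    then have "((\<lambda>x. a * iter_partial bs f x + c * iter_partial bs g x) has_derivative
       (\<lambda>b. a * frechet_derivative (iter_partial bs f) (at x) b
          + c * frechet_derivative (iter_partial bs g) (at x) b)) (at x)"
      by (auto intro!: derivative_eq_intros)
    from frechet_derivative_at[OF this]
    show "iter_partial (b # bs) (\<lambda>x. a * f x + c * g x) x
        = a * iter_partial (b # bs) f x + c * iter_partial (b # bs) g x"
      using Cons by simp metis
  qed
qed

lemma smooth_combine:
  assumes "smooth f" "smooth g"
  shows "smooth (\<lambda>x. a * f x + c * g x)"
  unfolding smooth_def
proof (intro allI impI)
  fix bs :: "'a list" and x
  assume bs: "set bs \<subseteq> Basis"
  then have "iter_partial bs f differentiable at x" "iter_partial bs g differentiable at x"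
    using assms by (auto simp: smooth_def)
  then show "iter_partial bs (\<lambda>x. a * f x + c * g x) differentiable at x"
    by (simp add: iter_partial_combine[OF assms bs])
qed

lemma test_functions_combine:
  assumes "f \<in> test_functions" "g \<in> test_functions"
  shows "(\<lambda>x. a * f x + c * g x) \<in> test_functions"
proof -
  have "supp (\<lambda>x. a * f x + c * g x) \<subseteq> supp f \<union> supp g"
    using supp_add[of "\<lambda>x. a * f x" "\<lambda>x. c * g x"] supp_mult[of "\<lambda>_. a" f] supp_mult[of "\<lambda>_. c" g]
    by blast
  then show ?thesis
    using assms by (auto simp: test_functions_def smooth_combine intro: compact_supp_subset)
qed

lemma test_functions_scale: "g \<in> test_functions \<Longrightarrow> (\<lambda>x. c * g x) \<in> test_functions"
  using test_functions_combine[of g g c 0] by simp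

lemma gf_combine:
  assumes "T \<in> generalized_functions" "f \<in> test_functions" "g \<in> test_functions"
  shows "T (\<lambda>x. a * f x + c * g x) = a * T f + c * T g"
  using assms test_functions_scale[OF assms(2), of a] test_functions_scale[OF assms(3), of c]
  by (simp add: generalized_functions_def)

theorem mod_const_eq_iff:
  fixes S T :: "('a::euclidean_space \<Rightarrow> real) \<Rightarrow> real"
  assumes S: "S \<in> generalized_functions" and T: "T \<in> generalized_functions"
  shows "mod_const S = mod_const T \<longleftrightarrow> (\<exists>c. S = add_function T (\<lambda>_. c))"
proof
  assume eq: "mod_const S = mod_const T"
  have eq': "S g = T g" if "g \<in> mean_zero_test_functions" for g
    using that fun_cong[OF eq, of g] by (simp add: mod_const_def)
  have ext: "S = add_function T (\<lambda>_. c)"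
    if "\<And>g. g \<in> test_functions \<Longrightarrow> S g = T g + c * (LINT x|lborel. g x)" for c
    using S that by (intro extensionalityI[of _ test_functions])
      (auto simp: generalized_functions_def add_function_def)
  show "\<exists>c. S = add_function T (\<lambda>_. c)"
  proof (cases "\<exists>g0\<in>test_functions. (LINT (x::'a)|lborel. g0 x) \<noteq> (0::real)")
    case False
    then have "S g = T g" if "g \<in> test_functions" for g
      using that by (intro eq') (auto simp: mean_zero_test_functions_def)
    then show ?thesis by (intro exI[of _ 0] ext) simp
  next
    case True
    then obtain g0 :: "'a \<Rightarrow> real" where g0: "g0 \<in> test_functions" "(LINT x|lborel. g0 x) \<noteq> 0"
      by blast
    define I0 where "I0 = (LINT x|lborel. g0 x)"
    show ?thesis
    proof (intro exI ext)
      fix g :: "'a \<Rightarrow> real"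
      assume g: "g \<in> test_functions"
      define I where "I = (LINT x|lborel. g x)"
      have "(\<lambda>x. I0 * g x + (- I) * g0 x) \<in> mean_zero_test_functions"
        using test_functions_combine[OF g g0(1), of I0 "- I"]
          test_function_integrable[OF g] test_function_integrable[OF g0(1)]
        by (simp add: mean_zero_test_functions_def I_def I0_def)
      from eq'[OF this] have "I0 * S g + (- I) * S g0 = I0 * T g + (- I) * T g0"
        using gf_combine[OF S g g0(1), of I0 "-I"] gf_combine[OF T g g0(1), of I0 "-I"] by simp
      then show "S g = T g + ((S g0 - T g0) / I0) * (LINT x|lborel. g x)"
        using g0(2) by (simp add: I0_def I_def field_simps)
    qed
  qed
next
  assume "\<exists>c. S = add_function T (\<lambda>_. c)"
  then show "mod_const S = mod_const T"
    by (auto simp: mod_const_def add_function_def mean_zero_test_functions_def restrict_def fun_eq_iff)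
qed

lemma mod_const_measurable: "mod_const \<in> gf_space \<rightarrow>\<^sub>M gf_mod_const_space"
  unfolding gf_space_def gf_mod_const_space_def
proof (rule measurable_restrict_space2)
  have "(\<lambda>T. restrict T mean_zero_test_functions)
     \<in> PiM test_functions (\<lambda>_. borel) \<rightarrow>\<^sub>M PiM mean_zero_test_functions (\<lambda>_. borel :: real measure)"
    by (rule measurable_restrict_subset) (auto simp: mean_zero_test_functions_def)
  then show "mod_const \<in> restrict_space (PiM test_functions (\<lambda>_. borel)) generalized_functions
      \<rightarrow>\<^sub>M PiM mean_zero_test_functions (\<lambda>_. borel :: real measure)"
    unfolding mod_const_def[abs_def] by (rule measurable_restrict_space1)
qed (auto simp: space_restrict_space)

lemma iter_partial_outside_supp:
  assumes "x \<notin> supp g"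
  shows "iter_partial bs g x = 0"
  using assms
proof (induction bs arbitrary: x)
  case Nil
  then show ?case using closure_subset[of "{x. g x \<noteq> 0}"] by (auto simp: supp_def)
next
  case (Cons b bs)
  have "open (- supp g)" unfolding supp_def by (intro open_Compl closed_closure)
  then have "(iter_partial bs g has_derivative (\<lambda>_. 0)) (at x)"
    by (rule has_derivative_transform_within_open[OF has_derivative_const[of 0]]) (use Cons in auto)
  from frechet_derivative_at[OF this] show ?case by (simp add: fun_eq_iff)
qed

lemma iter_partial_bounded:
  assumes g: "g \<in> test_functions" and bs: "set bs \<subseteq> Basis"
  shows "bdd_above (range (\<lambda>x. \<bar>iter_partial bs g x\<bar>))"
proof -
  have "continuous_on (supp g) (iter_partial bs g)"
    using g bs
    by (intro continuous_at_imp_continuous_on ballI differentiable_imp_continuous_within)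
       (auto simp: test_functions_def smooth_def)
  then have "compact (iter_partial bs g ` supp g)"
    using g by (intro compact_continuous_image) (auto simp: test_functions_def)
  then obtain B where B: "\<forall>y\<in>iter_partial bs g ` supp g. norm y \<le> B"
    using compact_imp_bounded bounded_iff by metis
  have "\<bar>iter_partial bs g x\<bar> \<le> max B 0" for x
    using B iter_partial_outside_supp[of x g bs] by (cases "x \<in> supp g") force+
  then show ?thesis by (auto simp: bdd_above_def)
qed

lemma Ck_norm_bounds:
  fixes g :: "'a::euclidean_space \<Rightarrow> real"
  assumes g: "g \<in> test_functions"
  shows "\<bar>g x\<bar> \<le> Ck_norm k g"
proof -
  define L where "L = {bs :: 'a list. set bs \<subseteq> Basis \<and> length bs \<le> k}"
  have fin: "finite L" unfolding L_def by (rule finite_lists_length_le) simp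
  have nonneg: "0 \<le> (SUP x. \<bar>iter_partial bs g x\<bar>)" if "bs \<in> L" for bs
    using that iter_partial_bounded[OF g] by (intro cSUP_upper2[where x=0]) (auto simp: L_def)
  have "\<bar>g x\<bar> \<le> (SUP x. \<bar>iter_partial [] g x\<bar>)"
    using iter_partial_bounded[OF g, of "[]"] cSUP_upper[of x UNIV "\<lambda>x. \<bar>g x\<bar>"] by simp
  also have "\<dots> \<le> (\<Sum>bs\<in>L. SUP x. \<bar>iter_partial bs g x\<bar>)"
  proof (rule member_le_sum[of "[]" L "\<lambda>bs. SUP x. \<bar>iter_partial bs g x\<bar>"])
    show "[] \<in> L" by (simp add: L_def)
  qed (use fin nonneg in auto)
  finally show ?thesis by (simp add: Ck_norm_def L_def)
qed

lemma add_function_gf: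
  fixes f :: "'a::euclidean_space \<Rightarrow> real"
  assumes T: "T \<in> generalized_functions" and f: "f \<in> test_functions"
  shows "add_function T f \<in> generalized_functions"
proof -
  have int: "integrable lborel (\<lambda>x. f x * g x)" if g: "g \<in> test_functions" for g
  proof (rule integrable_continuous_compact_support)
    show "continuous_on UNIV (\<lambda>x. f x * g x)"
      using f g smooth_continuous[of f] smooth_continuous[of g]
      by (intro continuous_on_mult) (auto simp: test_functions_def)
    show "compact (supp (\<lambda>x. f x * g x))"
      using g supp_mult[of f g] by (auto simp: test_functions_def intro: compact_supp_subset)
  qed
  have add: "(\<lambda>x. g x + g' x) \<in> test_functions"
    if "g \<in> test_functions" "g' \<in> test_functions" for g g' :: "'a \<Rightarrow> real"
    using test_functions_combine[OF that, of 1 1] by simp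
  define A where "A = (LINT x|lborel. \<bar>f x\<bar>)"
  have bound: "\<bar>LINT x|lborel. f x * g x\<bar> \<le> A * Ck_norm k g" if g: "g \<in> test_functions" for g k
  proof -
    have "\<bar>LINT x|lborel. f x * g x\<bar> \<le> (LINT x|lborel. \<bar>f x * g x\<bar>)"
      by (rule integral_abs_bound)
    also have "\<dots> \<le> (LINT x|lborel. \<bar>f x\<bar> * Ck_norm k g)"
      using integrable_abs[OF int[OF g]] test_function_integrable[OF f]
      by (intro integral_mono) (auto simp: abs_mult intro!: mult_left_mono Ck_norm_bounds[OF g])
    finally show ?thesis by (simp add: A_def)
  qed
  have cont: "\<exists>C k. \<forall>g\<in>test_functions. supp g \<subseteq> K \<longrightarrow> \<bar>add_function T f g\<bar> \<le> C * Ck_norm k g"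
    if K: "compact K" for K
  proof -
    have "\<forall>K. compact K \<longrightarrow> (\<exists>C k. \<forall>g\<in>test_functions. supp g \<subseteq> K \<longrightarrow> \<bar>T g\<bar> \<le> C * Ck_norm k g)"
      using T unfolding generalized_functions_def mem_Collect_eq by (elim conjE)
    then obtain C k
      where Ck: "\<And>g. g \<in> test_functions \<Longrightarrow> supp g \<subseteq> K \<Longrightarrow> \<bar>T g\<bar> \<le> C * Ck_norm k g"
      using K by metis
    have "\<bar>add_function T f g\<bar> \<le> (C + A) * Ck_norm k g"
      if "g \<in> test_functions" "supp g \<subseteq> K" for g
      using Ck[OF that] bound[OF that(1), of k] that by (simp add: add_function_def algebra_simps)
    then show ?thesis by blast
  qed
  have plus: "add_function T f (\<lambda>x. g x + g' x) = add_function T f g + add_function T f g'"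
    if "g \<in> test_functions" "g' \<in> test_functions" for g g'
  proof -
    have "T (\<lambda>x. g x + g' x) = T g + T g'" using T that by (simp add: generalized_functions_def)
    then show ?thesis using that add[OF that] int[OF that(1)] int[OF that(2)]
      by (simp add: add_function_def distrib_left)
  qed
  have scale: "add_function T f (\<lambda>x. c * g x) = c * add_function T f g"
    if "g \<in> test_functions" for g c
  proof -
    have "T (\<lambda>x. c * g x) = c * T g" using T that by (simp add: generalized_functions_def)
    moreover have "(\<lambda>x. f x * (c * g x)) = (\<lambda>x. c * (f x * g x))" by (simp add: ac_simps)
    ultimately show ?thesis using that test_functions_scale[OF that]
      by (simp add: add_function_def distrib_left)
  qed
  show ?thesis
    unfolding generalized_functions_def mem_Collect_eq
  proof (intro conjI)
    show "add_function T f \<in> extensional test_functions" by (simp add: add_function_def)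
  qed (use plus scale cont in blast)+
qed

lemma add_function_measurable:
  assumes f: "f \<in> test_functions"
  shows "(\<lambda>T. add_function T f) \<in> gf_space \<rightarrow>\<^sub>M gf_space"
  unfolding gf_space_def
proof (rule measurable_restrict_space2)
  have "(\<lambda>T. add_function T f)
     \<in> PiM test_functions (\<lambda>_. borel) \<rightarrow>\<^sub>M PiM test_functions (\<lambda>_. borel :: real measure)"
    unfolding add_function_def by measurable
  then show "(\<lambda>T. add_function T f)
     \<in> restrict_space (PiM test_functions (\<lambda>_. borel)) generalized_functions
       \<rightarrow>\<^sub>M PiM test_functions (\<lambda>_. borel :: real measure)"
    by (rule measurable_restrict_space1)
qed (auto simp: space_restrict_space intro: add_function_gf[OF _ f])

end

theory Submission
  imports Defs
begin

text \<open>By the Cameron--Martin principle it suffices that the shift \<open>g \<mapsto> \<integral> f g\<close> is bounded by the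
  standard deviation of the pairing with \<open>g\<close>: \<open>(\<integral> f g)\<^sup>2 \<le> C V(g)\<close> for all mean-zero \<open>g\<close>.

  Instead of constructing the density in \<open>L\<^sup>2\<close>, one represents the shift on finitely many test
  functions by a Gaussian variable \<open>Z\<close> in their span; the shifted law is the law tilted by
  \<open>exp (Z - Var Z / 2)\<close>, and since \<open>Var Z \<le> C\<close>, Cauchy--Schwarz gives \<open>\<nu>(A)\<^sup>2 \<le> exp C \<cdot> \<mu>(A)\<close>
  for all cylinders \<open>A\<close>. The bound does not depend on the cylinder, so null sets of \<open>\<mu>\<close> are null
  sets of \<open>\<nu>\<close> by approximation.

  For the inequality, Frullani's integral
  \<open>log (1/r) = \<integral> (exp (-\<sigma>\<^sup>2 r\<^sup>2/2) - exp (-\<sigma>\<^sup>2/2)) d\<sigma>/\<sigma>\<close> writes the logarithmic kernel as a mixture of Gaussians,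
  hence \<open>V(g) \<ge> c \<integral> |\<xi>|^{-d} |g^(\<xi>)|\<^sup>2 d\<xi>\<close>; then Cauchy--Schwarz in Fourier space
  against \<open>\<integral> |\<xi>|^d |f^(\<xi>)|\<^sup>2 d\<xi> < \<infinity>\<close> bounds \<open>\<integral> f g\<close>.\<close>

section \<open>Uniqueness of finite-dimensional laws from characteristic functions\<close>

text \<open>The hypotheses give only one-dimensional laws: each single pairing is Gaussian. Joint
  laws become accessible because the pairings are linear in \<open>g\<close> for every \<omega>: a
  finite combination of pairings is again one pairing, so joint characteristic functions are
  explicit. A uniqueness theorem in finitely many coordinates turns this into statements about laws,
  and it also supplies the independence of uncorrelated Gaussian variables.

  The tilting variable changes with the cylinder and only the constant C is common to all of them.
  This is why the comparison of the two measures is a quadratic inequality between masses: it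
  survives approximation without any convergence of the densities.

  On the analytic side, Gaussians take the place of Fourier inversion and Plancherel's theorem.
  Frullani's formula contains only Gaussian kernels, and the pairing of f with g is a limit of
  double integrals with Gaussian kernels, so every exchange of integrals is either absolutely
  convergent or between nonnegative integrands. The mean-zero condition enters by removing the term
  exp(-\<sigma>^2/2), which Frullani's integral needs in order to converge at \<sigma> = 0.\<close>

lemma Levy_uniqueness_finite:
  fixes N1 N2 :: "real measure"
  assumes N1: "finite_measure N1" "sets N1 = sets borel" and N2: "finite_measure N2" "sets N2 = sets borel"
    and char: "\<And>t. (CLINT x|N1. cis (t * x)) = (CLINT x|N2. cis (t * x))"
  shows "N1 = N2"
proof -
  interpret N1: finite_measure N1 by fact
  interpret N2: finite_measure N2 by fact
  have sp: "space N1 = UNIV" "space N2 = UNIV"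
    using sets_eq_imp_space_eq[OF N1(2)] sets_eq_imp_space_eq[OF N2(2)] by auto
  define c where "c = measure N1 UNIV"
  \<comment> \<open>The hypothesis at t = 0 says that the total masses agree. Division by
    \<open>c\<close> reduces the claim to probability measures; for \<open>c = 0\<close> both
    measures vanish.\<close>
  have c: "measure N2 UNIV = c" "emeasure N1 UNIV = ennreal c" "emeasure N2 UNIV = ennreal c"
    using char[of 0] sp by (simp_all add: c_def N1.emeasure_eq_measure N2.emeasure_eq_measure)
  show ?thesis
  proof (cases "c = 0")
    case True
    show ?thesis
    proof (rule measure_eqI)
      fix A assume "A \<in> sets N1"
      have "emeasure N1 A \<le> emeasure N1 UNIV" "emeasure N2 A \<le> emeasure N2 UNIV"
        using N1(2) N2(2) by (auto intro!: emeasure_mono)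
      then show "emeasure N1 A = emeasure N2 A" using c True by simp
    qed (use N1 N2 in simp)
  next
    case False
    then have cpos: "c > 0" using c_def zero_less_measure_iff[of N1 UNIV] by simp
    have scaled: "real_distribution (density N (\<lambda>_. ennreal (1/c)))"
      "char (density N (\<lambda>_. ennreal (1/c))) = (\<lambda>t. (1/c) *\<^sub>R (CLINT x|N. cis (t * x)))"
      if "sets N = sets borel" "emeasure N UNIV = ennreal c" for N :: "real measure"
    proof -
      note that(1)[measurable_cong]
      have "prob_space (density N (\<lambda>_. ennreal (1/c)))"
        using that cpos sets_eq_imp_space_eq[OF that(1)]
        by (intro prob_spaceI) (simp add: emeasure_density nn_integral_cmult ennreal_mult[symmetric])
      then show "real_distribution (density N (\<lambda>_. ennreal (1/c)))"
        by (simp add: real_distribution_def real_distribution_axioms_def that)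
      show "char (density N (\<lambda>_. ennreal (1/c))) = (\<lambda>t. (1/c) *\<^sub>R (CLINT x|N. cis (t * x)))"
      proof
        fix t
        have "char (density N (\<lambda>_. ennreal (1/c))) t = (CLINT x|N. (1/c) *\<^sub>R cis (t * x))"
          unfolding char_def using cpos
          by (subst integral_density) (auto simp: cis_conv_exp)
        then show "char (density N (\<lambda>_. ennreal (1/c))) t = (1/c) *\<^sub>R (CLINT x|N. cis (t * x))"
          by simp
      qed
    qed
    have "density N1 (\<lambda>_. ennreal (1/c)) = density N2 (\<lambda>_. ennreal (1/c))"
      using scaled[OF N1(2) c(2)] scaled[OF N2(2) c(3)] char by (intro Levy_uniqueness) auto
    then have "density (density N1 (\<lambda>_. ennreal (1/c))) (\<lambda>_. ennreal c)
        = density (density N2 (\<lambda>_. ennreal (1/c))) (\<lambda>_. ennreal c)" by simp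
    then show ?thesis using cpos
      by (simp add: density_density_eq ennreal_mult[symmetric] density_1 one_ennreal_def[symmetric])
  qed
qed

lemma weighted_distr_eqI:
  fixes X :: "'a \<Rightarrow> real" and Y :: "'b \<Rightarrow> real" and u :: "'a \<Rightarrow> real" and v :: "'b \<Rightarrow> real"
  assumes [measurable]: "X \<in> borel_measurable P" "Y \<in> borel_measurable Q"
    and u: "integrable P u" "\<And>x. 0 \<le> u x" and v: "integrable Q v" "\<And>x. 0 \<le> v x"
    and char: "\<And>t. (CLINT x|P. u x * cis (t * X x)) = (CLINT x|Q. v x * cis (t * Y x))"
  shows "distr (density P u) borel X = distr (density Q v) borel Y"
proof (rule Levy_uniqueness_finite)
  have [measurable]: "u \<in> borel_measurable P" "v \<in> borel_measurable Q" using u v by auto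
  have "finite_measure (density P u)"
    using u by (intro finite_measureI) (simp add: emeasure_density nn_integral_eq_integral cong: nn_integral_cong_simp)
  then show "finite_measure (distr (density P u) borel X)"
    by (rule finite_measure.finite_measure_distr) simp
  have "finite_measure (density Q v)"
    using v by (intro finite_measureI) (simp add: emeasure_density nn_integral_eq_integral cong: nn_integral_cong_simp)
  then show "finite_measure (distr (density Q v) borel Y)"
    by (rule finite_measure.finite_measure_distr) simp
  have [measurable]: "(\<lambda>x. cis (t * x)) \<in> borel_measurable borel" for t
    by (intro borel_measurable_continuous_onI continuous_intros)
  show "(CLINT x|distr (density P u) borel X. cis (t * x)) = (CLINT x|distr (density Q v) borel Y. cis (t * x))" for t
    using char[of t] u v by (simp add: integral_distr integral_density scaleR_conv_of_real)
qed auto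

lemma borel_measurable_cis [measurable]: "cis \<in> borel_measurable borel"
  by (intro borel_measurable_continuous_onI continuous_intros)

lemma (in pair_sigma_finite) product_mult:
  fixes f :: "'a \<Rightarrow> complex" and g :: "'b \<Rightarrow> complex"
  assumes f: "integrable M1 f" and g: "integrable M2 g"
  shows integrable_product_mult: "integrable (M1 \<Otimes>\<^sub>M M2) (\<lambda>p. f (fst p) * g (snd p))"
    and integral_product_mult: "(LINT p|(M1 \<Otimes>\<^sub>M M2). f (fst p) * g (snd p)) = (LINT x|M1. f x) * (LINT y|M2. g y)"
proof -
  have [measurable]: "f \<in> borel_measurable M1" "g \<in> borel_measurable M2" using f g by auto
  show int: "integrable (M1 \<Otimes>\<^sub>M M2) (\<lambda>p. f (fst p) * g (snd p))"
    by (rule Fubini_integrable) (use f g in \<open>auto simp: norm_mult\<close>)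
  have "(LINT x|M1. LINT y|M2. f x * g y) = (LINT p|(M1 \<Otimes>\<^sub>M M2). f (fst p) * g (snd p))"
    using integral_fst'[OF int] by simp
  then show "(LINT p|(M1 \<Otimes>\<^sub>M M2). f (fst p) * g (snd p)) = (LINT x|M1. f x) * (LINT y|M2. g y)"
    by simp
qed

text \<open>Since 2 Re z = z + cnj z, a real nonnegative weight becomes a sum of characters. The
  expansion is used in two ways: with a character for \<psi> it computes the characteristic function
  of a weighted measure, and with a general \<psi> it lets the coefficients of \<alpha> and
  \<open>cnj \<alpha>\<close> be read off.\<close>

lemma integral_weight_Re_cis:
  fixes X \<theta> u :: "'a \<Rightarrow> real" and \<psi> :: "real \<Rightarrow> complex"
  assumes P: "finite_measure P"
    and [measurable]: "X \<in> borel_measurable P" "\<theta> \<in> borel_measurable P" "u \<in> borel_measurable P"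
    and u: "\<And>x. 0 \<le> u x" "\<And>x. u x \<le> 1"
    and \<psi>: "integrable P (\<lambda>x. \<psi> (X x))"
  shows "(CLINT x|P. complex_of_real (u x * (1 + Re (\<alpha> * cis (\<theta> x)))) * \<psi> (X x)) =
     (CLINT x|P. u x * \<psi> (X x)) + \<alpha> / 2 * (CLINT x|P. u x * cis (\<theta> x) * \<psi> (X x))
       + cnj \<alpha> / 2 * (CLINT x|P. u x * cis (- \<theta> x) * \<psi> (X x))"
    and "integrable P (\<lambda>x. complex_of_real (u x) * cis (c * \<theta> x) * \<psi> (X x))"
proof -
  interpret finite_measure P by fact
  have [measurable]: "(\<lambda>x. \<psi> (X x)) \<in> borel_measurable P" using \<psi> by auto
  have int: "integrable P (\<lambda>x. complex_of_real (u x) * cis (c * \<theta> x) * \<psi> (X x))" for c :: real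
    by (rule Bochner_Integration.integrable_bound[OF \<psi>])
       (use u in \<open>auto simp: norm_mult intro!: mult_left_le_one_le\<close>)
  then show "integrable P (\<lambda>x. complex_of_real (u x) * cis (c * \<theta> x) * \<psi> (X x))" .
  have eq: "complex_of_real (u x * (1 + Re (\<alpha> * cis (\<theta> x)))) * \<psi> (X x) =
     u x * cis (0 * \<theta> x) * \<psi> (X x) + (\<alpha> / 2 * (u x * cis (1 * \<theta> x) * \<psi> (X x))
       + cnj \<alpha> / 2 * (u x * cis (-1 * \<theta> x) * \<psi> (X x)))" for x
  proof -
    have "complex_of_real (Re (\<alpha> * cis (\<theta> x))) = (\<alpha> * cis (\<theta> x) + cnj \<alpha> * cis (- \<theta> x)) / 2"
      by (simp add: complex_eq_iff)
    then have "complex_of_real (u x * (1 + Re (\<alpha> * cis (\<theta> x)))) =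
        u x * (1 + (\<alpha> * cis (\<theta> x) + cnj \<alpha> * cis (- \<theta> x)) / 2)"
      by (simp only: of_real_mult of_real_add of_real_1)
    then show ?thesis by (simp only:) (simp add: field_simps)
  qed
  show "(CLINT x|P. complex_of_real (u x * (1 + Re (\<alpha> * cis (\<theta> x)))) * \<psi> (X x)) =
     (CLINT x|P. u x * \<psi> (X x)) + \<alpha> / 2 * (CLINT x|P. u x * cis (\<theta> x) * \<psi> (X x))
       + cnj \<alpha> / 2 * (CLINT x|P. u x * cis (- \<theta> x) * \<psi> (X x))"
    unfolding eq using int[of 0] int[of 1] int[of "-1"]
    by (subst Bochner_Integration.integral_add Bochner_Integration.integrable_add integral_mult_right
        | auto intro!: Bochner_Integration.integrable_add integrable_mult_right)+
qed

text \<open>\<open>cis \<theta>\<close> is a combination of the nonnegative weights \<open>1 + Re (\<alpha> cis \<theta>)\<close> with \<open>|\<alpha>| \<le> 1\<close>, and to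
  each weighted measure the one-dimensional uniqueness theorem applies. This lets one pass from
  exponentials to general functions one coordinate at a time.\<close>

lemma cis_weight_transfer:
  fixes X \<theta> u :: "'a \<Rightarrow> real" and Y \<eta> v :: "'b \<Rightarrow> real" and \<psi> :: "real \<Rightarrow> complex"
  assumes P: "finite_measure P" and Q: "finite_measure Q"
    and mP [measurable]: "X \<in> borel_measurable P" "\<theta> \<in> borel_measurable P" "u \<in> borel_measurable P"
    and mQ [measurable]: "Y \<in> borel_measurable Q" "\<eta> \<in> borel_measurable Q" "v \<in> borel_measurable Q"
    and u: "\<And>x. 0 \<le> u x" "\<And>x. u x \<le> 1" and v: "\<And>x. 0 \<le> v x" "\<And>x. v x \<le> 1"
    and char: "\<And>c s. (CLINT x|P. u x * cis (c * \<theta> x + s * X x)) = (CLINT x|Q. v x * cis (c * \<eta> x + s * Y x))"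
    and [measurable]: "\<psi> \<in> borel_measurable borel"
    and \<psi>: "integrable P (\<lambda>x. \<psi> (X x))" "integrable Q (\<lambda>x. \<psi> (Y x))"
  shows "(CLINT x|P. u x * cis (\<theta> x) * \<psi> (X x)) = (CLINT x|Q. v x * cis (\<eta> x) * \<psi> (Y x))"
proof -
  interpret P: finite_measure P by fact
  interpret Q: finite_measure Q by fact
  have wt: "(CLINT x|P. complex_of_real (u x * (1 + Re (\<alpha> * cis (\<theta> x)))) * \<psi> (X x))
     = (CLINT x|Q. complex_of_real (v x * (1 + Re (\<alpha> * cis (\<eta> x)))) * \<psi> (Y x))" if \<alpha>: "cmod \<alpha> \<le> 1" for \<alpha>
  proof -
    have bd: "\<bar>Re (\<alpha> * cis r)\<bar> \<le> 1" for r
      using abs_Re_le_cmod[of "\<alpha> * cis r"] \<alpha> by (simp add: norm_mult)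
    have pos: "0 \<le> 1 + Re (\<alpha> * cis r)" "1 + Re (\<alpha> * cis r) \<le> 2" for r
      using bd[of r] by linarith+
    let ?u = "\<lambda>x. u x * (1 + Re (\<alpha> * cis (\<theta> x)))" and ?v = "\<lambda>x. v x * (1 + Re (\<alpha> * cis (\<eta> x)))"
    have mu: "?u \<in> borel_measurable P" "?v \<in> borel_measurable Q" by measurable
    have pu: "0 \<le> ?u x" "0 \<le> ?v y" for x y using u v pos by auto
    have D: "distr (density P ?u) borel X = distr (density Q ?v) borel Y"
    proof (rule weighted_distr_eqI)
      have "?u x \<le> 1 * 2" "?v y \<le> 1 * 2" for x y using u v pos by (intro mult_mono; simp)+
      then show "integrable P ?u" "integrable Q ?v" using pu mu
        by (intro P.integrable_const_bound[where B=2] Q.integrable_const_bound[where B=2] AE_I2; simp)+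
      fix t
      have e: "(CLINT x|P. complex_of_real (?u x) * cis (t * X x)) = (CLINT x|P. u x * cis (0 * \<theta> x + t * X x)) +
          \<alpha> / 2 * (CLINT x|P. u x * cis (1 * \<theta> x + t * X x)) + cnj \<alpha> / 2 * (CLINT x|P. u x * cis (-1 * \<theta> x + t * X x))"
        by (subst integral_weight_Re_cis(1)[OF P])
           (use u in \<open>auto simp: cis_mult mult.assoc intro!: P.integrable_const_bound[where B=1]\<close>)
      have f: "(CLINT x|Q. complex_of_real (?v x) * cis (t * Y x)) = (CLINT x|Q. v x * cis (0 * \<eta> x + t * Y x)) +
          \<alpha> / 2 * (CLINT x|Q. v x * cis (1 * \<eta> x + t * Y x)) + cnj \<alpha> / 2 * (CLINT x|Q. v x * cis (-1 * \<eta> x + t * Y x))"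
        by (subst integral_weight_Re_cis(1)[OF Q])
           (use v in \<open>auto simp: cis_mult mult.assoc intro!: Q.integrable_const_bound[where B=1]\<close>)
      show "(CLINT x|P. complex_of_real (?u x) * cis (t * X x)) = (CLINT x|Q. complex_of_real (?v x) * cis (t * Y x))"
        unfolding e f char ..
    qed (use pu in auto)
    have "(CLINT x|P. ?u x *\<^sub>R \<psi> (X x)) = (CLINT x|distr (density P ?u) borel X. \<psi> x)"
      using mu pu by (simp add: integral_distr integral_density)
    also have "\<dots> = (CLINT x|Q. ?v x *\<^sub>R \<psi> (Y x))"
      unfolding D using mu pu by (simp add: integral_distr integral_density)
    finally show ?thesis by (simp add: scaleR_conv_of_real)
  qed
  note eP = integral_weight_Re_cis(1)[OF P mP u \<psi>(1)]
  note eQ = integral_weight_Re_cis(1)[OF Q mQ v \<psi>(2)]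
  define a0 a b where "a0 = (CLINT x|P. u x * \<psi> (X x))"
    and "a = (CLINT x|P. u x * cis (\<theta> x) * \<psi> (X x))" and "b = (CLINT x|P. u x * cis (- \<theta> x) * \<psi> (X x))"
  define c0 c d where "c0 = (CLINT x|Q. v x * \<psi> (Y x))"
    and "c = (CLINT x|Q. v x * cis (\<eta> x) * \<psi> (Y x))" and "d = (CLINT x|Q. v x * cis (- \<eta> x) * \<psi> (Y x))"
  have *: "a0 + \<alpha> / 2 * a + cnj \<alpha> / 2 * b = c0 + \<alpha> / 2 * c + cnj \<alpha> / 2 * d" if "cmod \<alpha> \<le> 1" for \<alpha>
    using wt[OF that] unfolding eP eQ a0_def a_def b_def c0_def c_def d_def .
  \<comment> \<open>Three values of \<alpha> separate the coefficients: \<alpha> = 0 gives the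
    constant terms, then \<alpha> = 1 and \<alpha> = \<i> give a + b = c + d and a - b = c -
    d.\<close>
  have "a0 = c0" using *[of 0] by simp
  moreover have "a0 + a / 2 + b / 2 = c0 + c / 2 + d / 2" using *[of 1] by simp
  moreover have "a0 + \<i> / 2 * a - \<i> / 2 * b = c0 + \<i> / 2 * c - \<i> / 2 * d" using *[of \<i>] by simp
  ultimately have "a = c" by (simp add: complex_eq_iff)
  then show ?thesis unfolding a_def c_def .
qed

text \<open>Induction on the set \<open>K\<close> of coordinates that already carry an indicator;
  \<open>K = J\<close> with \<open>t = 0\<close> yields the masses of rectangles. For a new
  coordinate \<open>k\<close>, the factor depending on \<open>X k\<close>, namely the indicator
  times \<open>cis (t k * X k)\<close>, plays the role of \<psi>, and the rest of the exponent is
  \<theta>. The transfer needs the characteristic function of every combination of \<theta> and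
  \<open>X k\<close>, hence the induction is over all \<open>t\<close>.\<close>

lemma char_rectangle_eq:
  fixes X :: "'i \<Rightarrow> 'a \<Rightarrow> real" and Y :: "'i \<Rightarrow> 'b \<Rightarrow> real"
  assumes P: "finite_measure P" and Q: "finite_measure Q" and J: "finite J"
    and X: "\<And>i. i \<in> J \<Longrightarrow> X i \<in> borel_measurable P" and Y: "\<And>i. i \<in> J \<Longrightarrow> Y i \<in> borel_measurable Q"
    and char: "\<And>t. (CLINT x|P. cis (\<Sum>i\<in>J. t i * X i x)) = (CLINT x|Q. cis (\<Sum>i\<in>J. t i * Y i x))"
    and K: "finite K" "K \<subseteq> J" "\<And>i. i \<in> K \<Longrightarrow> A i \<in> sets borel"
  shows "(CLINT x|P. (\<Prod>i\<in>K. indicator (A i) (X i x) :: real) * cis (\<Sum>i\<in>J. t i * X i x)) =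
    (CLINT x|Q. (\<Prod>i\<in>K. indicator (A i) (Y i x) :: real) * cis (\<Sum>i\<in>J. t i * Y i x))"
  using K
proof (induction K arbitrary: t rule: finite_induct)
  case empty
  then show ?case using char by simp
next
  case (insert k K)
  interpret P: finite_measure P by fact
  interpret Q: finite_measure Q by fact
  have k: "k \<in> J" and KJ: "K \<subseteq> J" using insert by auto
  have AK [measurable]: "\<And>i. i \<in> K \<Longrightarrow> A i \<in> sets borel" "A k \<in> sets borel" using insert by auto
  have [measurable]: "X k \<in> borel_measurable P" "Y k \<in> borel_measurable Q" using X Y k by auto
  have mX: "(\<lambda>x. \<Sum>i\<in>J. t i * X i x) \<in> borel_measurable P" for t
    using X by (intro borel_measurable_sum borel_measurable_times) auto
  have mY: "(\<lambda>x. \<Sum>i\<in>J. t i * Y i x) \<in> borel_measurable Q" for t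
    using Y by (intro borel_measurable_sum borel_measurable_times) auto
  let ?u = "\<lambda>x. \<Prod>i\<in>K. indicator (A i) (X i x) :: real"
  let ?v = "\<lambda>x. \<Prod>i\<in>K. indicator (A i) (Y i x) :: real"
  let ?\<theta> = "\<lambda>x. \<Sum>i\<in>J. (t(k:=0)) i * X i x"
  let ?\<eta> = "\<lambda>x. \<Sum>i\<in>J. (t(k:=0)) i * Y i x"
  let ?\<psi> = "\<lambda>y. indicator (A k) y *\<^sub>R cis (t k * y)"
  have mu: "?u \<in> borel_measurable P"
    using X KJ AK
    by (intro borel_measurable_prod measurable_compose[OF _ borel_measurable_indicator]) auto
  have mv: "?v \<in> borel_measurable Q"
    using Y KJ AK
    by (intro borel_measurable_prod measurable_compose[OF _ borel_measurable_indicator]) auto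
  have m\<psi>: "?\<psi> \<in> borel_measurable borel" by measurable
  \<comment> \<open>The coefficient vector of c \<theta> + s \<open>X k\<close>: coordinate
    \<open>k\<close> is deleted from \<open>t\<close>, the remainder scaled by \<open>c\<close>, and
    \<open>s\<close> put in its place.\<close>
  define tt where "tt c s = (\<lambda>i. c * (t(k:=0)) i + (if i = k then s else 0))" for c s
  have split: "(\<Sum>i\<in>J. tt c s i * Z i) = c * (\<Sum>i\<in>J. (t(k:=0)) i * Z i) + s * Z k" for c s Z
    unfolding tt_def using J k by (simp add: distrib_right sum.distrib sum_distrib_left mult.assoc if_distrib[where f="\<lambda>y. y * _"] cong: if_cong)
  have "(CLINT x|P. ?u x * cis (?\<theta> x) * ?\<psi> (X k x)) = (CLINT x|Q. ?v x * cis (?\<eta> x) * ?\<psi> (Y k x))"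
  proof (rule cis_weight_transfer[OF P Q _ mX mu _ mY mv])
    show "0 \<le> ?u x" "?u x \<le> 1" for x by (auto intro!: prod_nonneg prod_le_1 simp: indicator_def)
    show "0 \<le> ?v x" "?v x \<le> 1" for x by (auto intro!: prod_nonneg prod_le_1 simp: indicator_def)
    fix c s
    show "(CLINT x|P. ?u x * cis (c * ?\<theta> x + s * X k x)) = (CLINT x|Q. ?v x * cis (c * ?\<eta> x + s * Y k x))"
      using insert.IH[of "tt c s"] insert.prems unfolding split by simp
  next
    show "integrable P (\<lambda>x. ?\<psi> (X k x))" "integrable Q (\<lambda>x. ?\<psi> (Y k x))"
      by (intro P.integrable_const_bound[where B=1] Q.integrable_const_bound[where B=1] AE_I2;
          simp add: indicator_def)+
  qed (use m\<psi> in simp_all)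
  moreover have "(\<Sum>i\<in>J. t i * Z i) = (\<Sum>i\<in>J. (t(k:=0)) i * Z i) + t k * Z k" for Z :: "_ \<Rightarrow> real"
  proof -
    have "(\<Sum>i\<in>J. t i * Z i) = t k * Z k + (\<Sum>i\<in>J-{k}. t i * Z i)" by (rule sum.remove[OF J k])
    moreover have "(\<Sum>i\<in>J. (t(k:=0)) i * Z i) = (t(k:=0)) k * Z k + (\<Sum>i\<in>J-{k}. (t(k:=0)) i * Z i)"
      by (rule sum.remove[OF J k])
    moreover have "(\<Sum>i\<in>J-{k}. (t(k:=0)) i * Z i) = (\<Sum>i\<in>J-{k}. t i * Z i)"
      by (intro sum.cong) auto
    ultimately show ?thesis by simp
  qed
  note this[where Z="\<lambda>i. X i x" for x, simp] this[where Z="\<lambda>i. Y i x" for x, simp]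
  ultimately show ?case
    using insert.hyps by (simp add: cis_mult[symmetric] scaleR_conv_of_real mult_ac)
qed

text \<open>The factor \<open>cis\<close> of a vanishing sum equals 1. It is kept so that the
  right-hand side has the shape of \<open>char_rectangle_eq\<close> at \<open>K = J\<close>,
  \<open>t = 0\<close>.\<close>

lemma emeasure_distr_rectangle:
  fixes Z :: "'i \<Rightarrow> 'a \<Rightarrow> real"
  assumes R: "finite_measure R" and J: "finite J"
    and Z: "\<And>i. i \<in> J \<Longrightarrow> Z i \<in> borel_measurable R" and A: "\<And>i. i \<in> J \<Longrightarrow> A i \<in> sets borel"
  shows "emeasure (distr R (PiM J (\<lambda>_. borel)) (\<lambda>x. \<lambda>i\<in>J. Z i x)) (Pi\<^sub>E J A)
      = ennreal (Re (CLINT x|R. (\<Prod>i\<in>J. indicator (A i) (Z i x) :: real) * cis (\<Sum>i\<in>J. 0 * Z i x)))"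
  proof -
    interpret finite_measure R by fact
    have mZ: "(\<lambda>x. \<lambda>i\<in>J. Z i x) \<in> R \<rightarrow>\<^sub>M PiM J (\<lambda>_. borel)"
      using Z by (intro measurable_restrict) auto
    let ?E = "(\<lambda>x. \<lambda>i\<in>J. Z i x) -` (Pi\<^sub>E J A) \<inter> space R"
    have E: "?E \<in> sets R" using mZ A J by (intro measurable_sets[OF mZ] sets_PiM_I_finite)
    have "(CLINT x|R. (\<Prod>i\<in>J. indicator (A i) (Z i x) :: real) * cis (\<Sum>i\<in>J. 0 * Z i x))
      = (CLINT x|R. complex_of_real (indicator ?E x))"
      using J by (intro Bochner_Integration.integral_cong) (auto simp: indicator_def PiE_iff prod_zero_iff)
    also have "\<dots> = complex_of_real (measure R ?E)" using E by (simp add: of_real_eq_iff)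
    finally show ?thesis
      using mZ A J E by (simp add: emeasure_distr sets_PiM_I_finite emeasure_eq_measure)
  qed

theorem distr_PiM_eqI_char:
  fixes X :: "'i \<Rightarrow> 'a \<Rightarrow> real" and Y :: "'i \<Rightarrow> 'b \<Rightarrow> real"
  assumes P: "finite_measure P" and Q: "finite_measure Q" and J: "finite J"
    and X: "\<And>i. i \<in> J \<Longrightarrow> X i \<in> borel_measurable P" and Y: "\<And>i. i \<in> J \<Longrightarrow> Y i \<in> borel_measurable Q"
    and char: "\<And>t. (CLINT x|P. cis (\<Sum>i\<in>J. t i * X i x)) = (CLINT x|Q. cis (\<Sum>i\<in>J. t i * Y i x))"
  shows "distr P (PiM J (\<lambda>_. borel)) (\<lambda>x. \<lambda>i\<in>J. X i x) = distr Q (PiM J (\<lambda>_. borel)) (\<lambda>x. \<lambda>i\<in>J. Y i x)"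
proof -
  have mX: "(\<lambda>x. \<lambda>i\<in>J. X i x) \<in> P \<rightarrow>\<^sub>M PiM J (\<lambda>_. borel)"
    using X by (intro measurable_restrict) auto
  have mY: "(\<lambda>x. \<lambda>i\<in>J. Y i x) \<in> Q \<rightarrow>\<^sub>M PiM J (\<lambda>_. borel)"
    using Y by (intro measurable_restrict) auto
  show ?thesis
  proof (rule measure_eqI_PiM_finite[OF J])
    fix A :: "'i \<Rightarrow> real set" assume A: "\<And>i. i \<in> J \<Longrightarrow> A i \<in> sets borel"
    show "emeasure (distr P (PiM J (\<lambda>_. borel)) (\<lambda>x. \<lambda>i\<in>J. X i x)) (Pi\<^sub>E J A) =
      emeasure (distr Q (PiM J (\<lambda>_. borel)) (\<lambda>x. \<lambda>i\<in>J. Y i x)) (Pi\<^sub>E J A)"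
      using emeasure_distr_rectangle[OF P J X A] emeasure_distr_rectangle[OF Q J Y A]
        char_rectangle_eq[OF P Q J X Y char J subset_refl A, where t="\<lambda>_. 0"] by simp
  next
    show "range (\<lambda>_::nat. \<Pi>\<^sub>E i\<in>J. UNIV :: real set) \<subseteq> prod_algebra J (\<lambda>_. borel)"
      using J by (auto simp: prod_algebra_eq_finite)
    show "(\<Union>i::nat. \<Pi>\<^sub>E i\<in>J. UNIV) = space (PiM J (\<lambda>_. borel :: real measure))"
      by (simp add: space_PiM)
    interpret D: finite_measure "distr P (PiM J (\<lambda>_. borel)) (\<lambda>x. \<lambda>i\<in>J. X i x)"
      by (rule finite_measure.finite_measure_distr[OF P mX])
    show "emeasure (distr P (PiM J (\<lambda>_. borel)) (\<lambda>x. \<lambda>i\<in>J. X i x)) (\<Pi>\<^sub>E i\<in>J. UNIV) \<noteq> \<infinity>"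
      by simp
  qed simp_all
qed

section \<open>Shifts of linear Gaussian processes\<close>

lemma normal_density_cis:
  assumes \<sigma>: "0 < \<sigma>"
  shows "(CLINT x|lborel. normal_density \<mu> \<sigma> x *\<^sub>R cis (t * x)) = cis (t * \<mu>) * complex_of_real (exp (- (\<sigma> * t)\<^sup>2 / 2))"
    and "integrable lborel (\<lambda>x. normal_density \<mu> \<sigma> x *\<^sub>R cis (t * x))"
proof -
  show "integrable lborel (\<lambda>x. normal_density \<mu> \<sigma> x *\<^sub>R cis (t * x))"
    by (rule Bochner_Integration.integrable_bound[OF integrable_normal_density[OF \<sigma>]]) auto
  have "(CLINT x|lborel. normal_density \<mu> \<sigma> x *\<^sub>R cis (t * x))
      = \<bar>\<sigma>\<bar> *\<^sub>R (CLINT x|lborel. normal_density \<mu> \<sigma> (\<mu> + \<sigma> * x) *\<^sub>R cis (t * (\<mu> + \<sigma> * x)))"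
    using \<sigma> by (intro lborel_integral_real_affine) auto
  also have "\<dots> = (CLINT x|lborel. \<bar>\<sigma>\<bar> *\<^sub>R (normal_density \<mu> \<sigma> (\<mu> + \<sigma> * x) *\<^sub>R cis (t * (\<mu> + \<sigma> * x))))"
    by (rule integral_scaleR_right[symmetric])
  also have "\<dots> = (CLINT x|lborel. cis (t * \<mu>) * (std_normal_density x *\<^sub>R cis (\<sigma> * t * x)))"
    using \<sigma> by (intro Bochner_Integration.integral_cong)
      (simp_all add: normal_density_def power_mult_distrib real_sqrt_mult distrib_left
        cis_mult[symmetric] scaleR_conv_of_real mult_ac)
  also have "\<dots> = cis (t * \<mu>) * (CLINT x|lborel. std_normal_density x *\<^sub>R cis (\<sigma> * t * x))"
    by (rule integral_mult_right_zero)
  also have "(CLINT x|lborel. std_normal_density x *\<^sub>R cis (\<sigma> * t * x)) = char std_normal_distribution (\<sigma> * t)"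
    unfolding char_def by (subst integral_density) (auto simp: cis_conv_exp)
  finally show "(CLINT x|lborel. normal_density \<mu> \<sigma> x *\<^sub>R cis (t * x)) = cis (t * \<mu>) * complex_of_real (exp (- (\<sigma> * t)\<^sup>2 / 2))"
    by (simp add: char_std_normal_distribution exp_of_real)
qed

text \<open>Completing the square: the exponential tilt moves the mean from 0 to s \<sigma>^2. This
  is the Cameron-Martin shift in dimension one.\<close>

lemma exp_normal_density:
  assumes "0 < \<sigma>"
  shows "exp (s * x - (s * \<sigma>)\<^sup>2 / 2) * normal_density 0 \<sigma> x = normal_density (s * \<sigma>\<^sup>2) \<sigma> x"
proof -
  have "s * x - (s * \<sigma>)\<^sup>2 / 2 - x\<^sup>2 / (2 * \<sigma>\<^sup>2) = - (x - s * \<sigma>\<^sup>2)\<^sup>2 / (2 * \<sigma>\<^sup>2)"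
    using assms by (simp add: field_simps power2_eq_square)
  then show ?thesis
    by (simp add: normal_density_def exp_add[symmetric] exp_diff[symmetric] mult_ac)
qed

lemma centered_gaussian_cases:
  fixes X :: "'w \<Rightarrow> real"
  assumes "centered_gaussian M X v"
  obtains "v = 0" "distr M borel X = return borel 0"
  | \<sigma> where "0 < \<sigma>" "v = \<sigma>\<^sup>2" "distr M borel X = density lborel (normal_density 0 \<sigma>)"
proof (cases "v = 0")
  case False
  with assms show ?thesis by (intro that(2)[of "sqrt v"]) (auto simp: centered_gaussian_def)
qed (use assms that(1) in \<open>auto simp: centered_gaussian_def\<close>)

text \<open>One formula for two purposes: s = 0 gives the characteristic function, and t = 0 shows
  that the tilting density has integral 1. The degenerate case v = 0 obeys the same formula, so
  later arguments need not distinguish it.\<close>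

lemma centered_gaussian_tilted_cis:
  fixes X :: "'w \<Rightarrow> real"
  assumes X: "centered_gaussian M X v"
  shows "(CLINT \<omega>|M. complex_of_real (exp (s * X \<omega> - s\<^sup>2 * v / 2)) * cis (t * X \<omega>)) = cis (s * t * v) * complex_of_real (exp (- t\<^sup>2 * v / 2))"
    and "integrable M (\<lambda>\<omega>. complex_of_real (exp (s * X \<omega> - s\<^sup>2 * v / 2)) * cis (t * X \<omega>))"
proof -
  have [measurable]: "X \<in> borel_measurable M" using X by (simp add: centered_gaussian_def)
  let ?f = "\<lambda>x. complex_of_real (exp (s * x - s\<^sup>2 * v / 2)) * cis (t * x)"
  have "integrable (distr M borel X) ?f \<and>
    (CLINT x|distr M borel X. ?f x) = cis (s * t * v) * complex_of_real (exp (- t\<^sup>2 * v / 2))"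
    using X
  proof (cases rule: centered_gaussian_cases)
    case 1
    have "integrable (return borel (0::real)) ?f"
      by (intro integrableI_bounded) (auto simp: nn_integral_return)
    with 1 show ?thesis by (simp add: integral_return)
  next
    case (2 \<sigma>)
    have *: "normal_density 0 \<sigma> x *\<^sub>R ?f x = normal_density (s * \<sigma>\<^sup>2) \<sigma> x *\<^sub>R cis (t * x)" for x
      unfolding exp_normal_density[OF 2(1), symmetric] using 2
      by (simp add: scaleR_conv_of_real power_mult_distrib mult_ac)
    show ?thesis unfolding 2
      using normal_density_cis[OF 2(1), of "s * \<sigma>\<^sup>2" t] 2 *[unfolded 2]
      by (subst integral_density integrable_density, auto simp: power_mult_distrib mult_ac)+
  qed
  then show "(CLINT \<omega>|M. complex_of_real (exp (s * X \<omega> - s\<^sup>2 * v / 2)) * cis (t * X \<omega>)) = cis (s * t * v) * complex_of_real (exp (- t\<^sup>2 * v / 2))"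
    and "integrable M (\<lambda>\<omega>. complex_of_real (exp (s * X \<omega> - s\<^sup>2 * v / 2)) * cis (t * X \<omega>))"
    by (simp_all add: integral_distr integrable_distr_eq)
qed

lemma centered_gaussian_cis:
  fixes X :: "'w \<Rightarrow> real"
  assumes X: "centered_gaussian M X v"
  shows "(CLINT \<omega>|M. cis (t * X \<omega>)) = complex_of_real (exp (- t\<^sup>2 * v / 2))"
  using centered_gaussian_tilted_cis(1)[OF X, of 0 t] by simp

lemma centered_gaussian_exp:
  fixes X :: "'w \<Rightarrow> real"
  assumes X: "centered_gaussian M X v"
  shows "integrable M (\<lambda>\<omega>. exp (s * X \<omega> - s\<^sup>2 * v / 2))" "(LINT \<omega>|M. exp (s * X \<omega> - s\<^sup>2 * v / 2)) = 1"
proof -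
  have "integrable M (\<lambda>\<omega>. Re (complex_of_real (exp (s * X \<omega> - s\<^sup>2 * v / 2)) * cis (0 * X \<omega>)))"
    by (intro integrable_Re centered_gaussian_tilted_cis(2)[OF X])
  then show int: "integrable M (\<lambda>\<omega>. exp (s * X \<omega> - s\<^sup>2 * v / 2))" by simp
  have "(CLINT \<omega>|M. complex_of_real (exp (s * X \<omega> - s\<^sup>2 * v / 2))) = 1"
    using centered_gaussian_tilted_cis(1)[OF X, of s 0] by simp
  then show "(LINT \<omega>|M. exp (s * X \<omega> - s\<^sup>2 * v / 2)) = 1"
    unfolding integral_complex_of_real by simp
qed

lemma centered_gaussian_second_moment:
  fixes X :: "'w \<Rightarrow> real"
  assumes X: "centered_gaussian M X v"
  shows "integrable M (\<lambda>\<omega>. (X \<omega>)\<^sup>2)" "(LINT \<omega>|M. (X \<omega>)\<^sup>2) = v"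
proof -
  have [measurable]: "X \<in> borel_measurable M" using X by (simp add: centered_gaussian_def)
  have "integrable (distr M borel X) (\<lambda>x. x\<^sup>2) \<and> (LINT x|distr M borel X. x\<^sup>2) = v"
    using X
  proof (cases rule: centered_gaussian_cases)
    case 1
    have "integrable (return borel (0::real)) (\<lambda>x. x\<^sup>2)"
      by (intro integrableI_bounded) (auto simp: nn_integral_return)
    with 1 show ?thesis by (simp add: integral_return)
  next
    case (2 \<sigma>)
    show ?thesis unfolding 2
      using integrable_normal_moment[of \<sigma> 0 2] integral_normal_moment_even[of \<sigma> 0 1] 2
      by (subst integral_density integrable_density, auto simp: fact_numeral)+
  qed
  then show "integrable M (\<lambda>\<omega>. (X \<omega>)\<^sup>2)" "(LINT \<omega>|M. (X \<omega>)\<^sup>2) = v"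
    by (simp_all add: integral_distr integrable_distr_eq)
qed

section \<open>Linear Gaussian processes: covariance, representation of functionals, tilting\<close>

locale linear_gaussian_process = prob_space M for M :: "'w measure" +
  fixes G :: "('a \<Rightarrow> real) set" and X :: "('a \<Rightarrow> real) \<Rightarrow> 'w \<Rightarrow> real" and V :: "('a \<Rightarrow> real) \<Rightarrow> real"
  assumes zero_mem: "(\<lambda>_. 0) \<in> G"
    and combine_mem: "g \<in> G \<Longrightarrow> g' \<in> G \<Longrightarrow> (\<lambda>x. a * g x + c * g' x) \<in> G"
    and linear: "\<omega> \<in> space M \<Longrightarrow> g \<in> G \<Longrightarrow> g' \<in> G \<Longrightarrow> X (\<lambda>x. a * g x + c * g' x) \<omega> = a * X g \<omega> + c * X g' \<omega>"
    and gaussian: "g \<in> G \<Longrightarrow> centered_gaussian M (X g) (V g)"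
begin

definition cov :: "('a \<Rightarrow> real) \<Rightarrow> ('a \<Rightarrow> real) \<Rightarrow> real" where
  "cov g g' = (LINT \<omega>|M. X g \<omega> * X g' \<omega>)"

lemma X_measurable [measurable]: "g \<in> G \<Longrightarrow> X g \<in> borel_measurable M"
  using gaussian by (simp add: centered_gaussian_def)

lemma V_nonneg: "g \<in> G \<Longrightarrow> 0 \<le> V g"
  using gaussian by (simp add: centered_gaussian_def)

lemma integrable_X_mult:
  assumes "g \<in> G" "g' \<in> G" shows "integrable M (\<lambda>\<omega>. X g \<omega> * X g' \<omega>)"
proof (rule Bochner_Integration.integrable_bound)
  show "integrable M (\<lambda>\<omega>. (X g \<omega>)\<^sup>2 + (X g' \<omega>)\<^sup>2)"
    using assms by (intro Bochner_Integration.integrable_add centered_gaussian_second_moment(1)[OF gaussian])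
  have "\<bar>x * y\<bar> \<le> x\<^sup>2 + y\<^sup>2" for x y :: real
  proof -
    have "2 * (\<bar>x\<bar> * \<bar>y\<bar>) \<le> \<bar>x\<bar>\<^sup>2 + \<bar>y\<bar>\<^sup>2" using sum_squares_bound[of "\<bar>x\<bar>" "\<bar>y\<bar>"] by simp
    moreover have "0 \<le> \<bar>x\<bar> * \<bar>y\<bar>" by simp
    ultimately show ?thesis unfolding abs_mult power2_abs by linarith
  qed
  then show "AE \<omega> in M. norm (X g \<omega> * X g' \<omega>) \<le> norm ((X g \<omega>)\<^sup>2 + (X g' \<omega>)\<^sup>2)"
    by (auto simp: real_norm_def)
qed (use assms in measurable)

lemma cov_self: "g \<in> G \<Longrightarrow> cov g g = V g"
  using centered_gaussian_second_moment(2)[OF gaussian, of g] by (simp add: cov_def power2_eq_square)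

lemma cov_commute: "cov g g' = cov g' g"
  by (simp add: cov_def mult.commute)

lemma cov_combine_left:
  assumes "g \<in> G" "g' \<in> G" "k \<in> G"
  shows "cov (\<lambda>x. a * g x + c * g' x) k = a * cov g k + c * cov g' k"
proof -
  have "cov (\<lambda>x. a * g x + c * g' x) k = (LINT \<omega>|M. a * (X g \<omega> * X k \<omega>) + c * (X g' \<omega> * X k \<omega>))"
    unfolding cov_def using assms
    by (intro Bochner_Integration.integral_cong) (auto simp: linear algebra_simps)
  then show ?thesis using assms integrable_X_mult by (simp add: cov_def)
qed

lemma cov_combine_right:
  assumes "g \<in> G" "g' \<in> G" "k \<in> G"
  shows "cov k (\<lambda>x. a * g x + c * g' x) = a * cov k g + c * cov k g'"
  using cov_combine_left[OF assms] by (simp add: cov_commute)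

lemma V_combine:
  assumes "g \<in> G" "g' \<in> G"
  shows "V (\<lambda>x. a * g x + c * g' x) = a\<^sup>2 * V g + 2 * a * c * cov g g' + c\<^sup>2 * V g'"
  using assms cov_commute[of g g']
  by (simp add: cov_self[symmetric] combine_mem cov_combine_left cov_combine_right algebra_simps power2_eq_square)

lemma cov_Cauchy_Schwarz:
  assumes g: "g \<in> G" "g' \<in> G"
  shows "(cov g g')\<^sup>2 \<le> V g * V g'"
proof -
  have pos: "0 \<le> a\<^sup>2 * V g + 2 * a * c * cov g g' + c\<^sup>2 * V g'" for a c
    using V_nonneg[OF combine_mem[OF g]] V_combine[OF g] by simp
  show ?thesis
  proof (cases "V g' = 0")
    case True
    have "cov g g' = 0"
    proof (rule ccontr)
      assume n: "cov g g' \<noteq> 0"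
      \<comment> \<open>With \<open>V g' = 0\<close> the quadratic form at a = 1 is affine in
        \<open>c\<close>; this choice makes its value -1, against nonnegativity.\<close>
      define c where "c = (- V g - 1) / (2 * cov g g')"
      have "2 * c * cov g g' = - V g - 1" using n by (simp add: c_def)
      then show False using pos[of 1 c] True by simp
    qed
    then show ?thesis using V_nonneg g by simp
  next
    case False
    with V_nonneg[OF g(2)] have p: "0 < V g'" by simp
    have "0 \<le> (V g')\<^sup>2 * V g + 2 * V g' * (- cov g g') * cov g g' + (- cov g g')\<^sup>2 * V g'" by (rule pos)
    also have "\<dots> = V g' * (V g * V g' - (cov g g')\<^sup>2)" by (simp add: algebra_simps power2_eq_square)
    finally show ?thesis using p by (simp add: zero_le_mult_iff)
  qed
qed

definition subspace_of :: "('a \<Rightarrow> real) set \<Rightarrow> bool" where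
  "subspace_of S \<longleftrightarrow> S \<subseteq> G \<and> (\<lambda>_. 0) \<in> S \<and> (\<forall>a c. \<forall>g\<in>S. \<forall>g'\<in>S. (\<lambda>x. a * g x + c * g' x) \<in> S)"

definition linear_functional :: "(('a \<Rightarrow> real) \<Rightarrow> real) \<Rightarrow> bool" where
  "linear_functional l \<longleftrightarrow> (\<forall>a c. \<forall>g\<in>G. \<forall>g'\<in>G. l (\<lambda>x. a * g x + c * g' x) = a * l g + c * l g')"

lemma subspace_ofD:
  assumes "subspace_of S"
  shows "g \<in> S \<Longrightarrow> g \<in> G" "(\<lambda>_. 0) \<in> S" "g \<in> S \<Longrightarrow> g' \<in> S \<Longrightarrow> (\<lambda>x. a * g x + c * g' x) \<in> S"
  using assms by (auto simp: subspace_of_def)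

lemma linear_functionalD:
  "linear_functional l \<Longrightarrow> g \<in> G \<Longrightarrow> g' \<in> G \<Longrightarrow> l (\<lambda>x. a * g x + c * g' x) = a * l g + c * l g'"
  by (auto simp: linear_functional_def)

lemma linear_functional_zero: "linear_functional l \<Longrightarrow> l (\<lambda>_. 0) = 0"
  using linear_functionalD[OF _ zero_mem zero_mem, of l 0 0] by simp

lemma linear_functional_cov: "g \<in> G \<Longrightarrow> linear_functional (cov g)"
  by (simp add: linear_functional_def cov_combine_right)

text \<open>The subspaces through which span membership is exploited: functionals that agree on
  \<open>J\<close> agree at every vector lying in all subspaces that contain
  \<open>J\<close>.\<close>

lemma subspace_of_agree:
  assumes "linear_functional l" "linear_functional l'"
  shows "subspace_of {g \<in> G. l g = l' g}"
  using assms zero_mem combine_mem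
  by (auto simp: subspace_of_def linear_functionalD linear_functional_zero)

text \<open>Membership of \<open>p\<close> in every subspace containing \<open>J\<close> stands for membership in the span of \<open>J\<close>.
  The induction step is Gram--Schmidt: \<open>k\<close> is replaced by its component \<open>r\<close> orthogonal to \<open>J\<close>.\<close>

lemma riesz_finite:
  assumes "finite J" "J \<subseteq> G" "linear_functional l" "\<And>g. g \<in> G \<Longrightarrow> (l g)\<^sup>2 \<le> C * V g"
  shows "\<exists>p. (\<forall>S. subspace_of S \<longrightarrow> J \<subseteq> S \<longrightarrow> p \<in> S) \<and> (\<forall>g\<in>J. cov p g = l g)"
  using assms
proof (induction J arbitrary: l C rule: finite_induct)
  case empty
  then show ?case by (intro exI[of _ "\<lambda>_. 0"]) (auto simp: subspace_ofD)
next
  case (insert k J)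
  have k: "k \<in> G" and J: "J \<subseteq> G" using insert by auto
  have G: "subspace_of G" using zero_mem combine_mem by (auto simp: subspace_of_def)
  obtain p where p: "\<And>S. subspace_of S \<Longrightarrow> J \<subseteq> S \<Longrightarrow> p \<in> S" "\<And>g. g \<in> J \<Longrightarrow> cov p g = l g"
    using insert.IH[OF J insert.prems(2,3)] by blast
  \<comment> \<open>\<open>q\<close> is the orthogonal projection of \<open>k\<close> to the span of
    \<open>J\<close>: it represents the functional \<open>cov k\<close> there, which Cauchy-Schwarz
    bounds with the constant \<open>V k\<close>. The induction hypothesis is thus used for a second
    functional and a second constant.\<close>
  have "\<exists>q. (\<forall>S. subspace_of S \<longrightarrow> J \<subseteq> S \<longrightarrow> q \<in> S) \<and> (\<forall>g\<in>J. cov q g = cov k g)"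
    by (rule insert.IH[OF J linear_functional_cov[OF k]]) (rule cov_Cauchy_Schwarz[OF k])
  then obtain q where q: "\<And>S. subspace_of S \<Longrightarrow> J \<subseteq> S \<Longrightarrow> q \<in> S" "\<And>g. g \<in> J \<Longrightarrow> cov q g = cov k g"
    by blast
  have pG: "p \<in> G" and qG: "q \<in> G" using p(1)[OF G J] q(1)[OF G J] by auto
  define r where "r = (\<lambda>x. 1 * k x + (- 1) * q x)"
  have rG: "r \<in> G" unfolding r_def by (rule combine_mem[OF k qG])
  have ortho_J: "cov q g = cov k g" if "\<And>S. subspace_of S \<Longrightarrow> J \<subseteq> S \<Longrightarrow> g \<in> S" for g
    using that[OF subspace_of_agree[OF linear_functional_cov[OF qG] linear_functional_cov[OF k]]] q(2) J by auto
  have ortho: "cov r g = 0" if "\<And>S. subspace_of S \<Longrightarrow> J \<subseteq> S \<Longrightarrow> g \<in> S" for g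
    using ortho_J[OF that] that[OF G J] cov_combine_left[OF k qG, of g 1 "-1"] by (simp add: r_def)
  have rp: "cov r p = 0" and rq: "cov r q = 0" using ortho p(1) q(1) by auto
  have rk: "cov r k = V r"
    using cov_combine_right[OF k qG rG, of 1 "-1"] rq cov_self[OF rG] by (simp add: r_def)
  have rJ: "cov r g = 0" if "g \<in> J" for g using that by (intro ortho) auto
  define c where "c = (l k - cov p k) / V r"
  define p' where "p' = (\<lambda>x. 1 * p x + c * r x)"
  have eq: "cov p' g = cov p g + c * cov r g" if "g \<in> G" for g
    unfolding p'_def using cov_combine_left[OF pG rG that, of 1 c] by simp
  have "cov p' k = l k"
  proof (cases "V r = 0")
    case True
    \<comment> \<open>This is where boundedness of \<open>l\<close> is essential. If
      \<open>k\<close> differs from its projection only by a vector of variance zero, no multiple of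
      \<open>r\<close> could correct the value at \<open>k\<close>; the bound forces
      \<open>l r = 0\<close>, so \<open>p\<close> is already right.\<close>
    have "l r = 0" using insert.prems(3)[OF rG] True by simp
    then have "l k = l q" unfolding r_def using linear_functionalD[OF insert.prems(2) k qG, of 1 "-1"] by simp
    moreover have "cov p q = l q"
      using q(1)[OF subspace_of_agree[OF linear_functional_cov[OF pG] insert.prems(2)]] p(2) J by auto
    moreover have "cov p k = cov p q"
      using cov_combine_right[OF k qG pG, of 1 "-1"] rp[unfolded cov_commute[of r p]] by (simp add: r_def)
    ultimately show ?thesis using eq[OF k] rk True by simp
  next
    case False
    then show ?thesis using eq[OF k] rk by (simp add: c_def)
  qed
  moreover have "cov p' g = l g" if "g \<in> J" for g using eq that J rJ p(2) by auto
  moreover have "p' \<in> S" if "subspace_of S" "insert k J \<subseteq> S" for S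
    unfolding p'_def r_def using that p(1) q(1) by (intro subspace_ofD(3)) auto
  ultimately show ?case by (intro exI[of _ p']) auto
qed

text \<open>Split g into b p plus a part \<open>y\<close> uncorrelated with p. The tilt involves
  \<open>X p\<close> alone, so once \<open>X y\<close> and \<open>X p\<close> are independent, the
  integral factors into an ordinary characteristic function in \<open>X y\<close> and a
  one-dimensional tilted one in \<open>X p\<close>.\<close>

lemma tilted_cis:
  assumes p: "p \<in> G" and g: "g \<in> G"
  shows "(CLINT \<omega>|M. complex_of_real (exp (X p \<omega> - V p / 2)) * cis (X g \<omega>)) = cis (cov p g) * complex_of_real (exp (- V g / 2))"
proof -
  interpret MM: pair_prob_space M M ..
  \<comment> \<open>If \<open>V p = 0\<close> then also \<open>cov p g = 0\<close>, so \<open>b = 0\<close> is the right value.\<close>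
  define b where "b = cov p g / V p"
  have bV: "b * V p = cov p g"
  proof (cases "V p = 0")
    case True
    then show ?thesis using cov_Cauchy_Schwarz[OF p g] by (simp add: b_def)
  qed (simp add: b_def)
  define y where "y = (\<lambda>x. 1 * g x + (- b) * p x)"
  have y: "y \<in> G" unfolding y_def by (rule combine_mem[OF g p])
  have yp: "cov y p = 0"
    unfolding y_def cov_combine_left[OF g p p] using bV by (simp add: cov_self[OF p] cov_commute)
  have Vg: "V g = V y + b\<^sup>2 * V p"
    unfolding y_def V_combine[OF g p] using bV by (simp add: cov_commute[of g] power2_eq_square)
  have Xg: "X g \<omega> = X y \<omega> + b * X p \<omega>" if "\<omega> \<in> space M" for \<omega>
    unfolding y_def linear[OF that g p] by simp
  have V: "V (\<lambda>x. c * y x + s * p x) = c\<^sup>2 * V y + s\<^sup>2 * V p" for c s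
    by (simp add: V_combine[OF y p] yp)
  let ?\<psi> = "\<lambda>z. complex_of_real (exp (1 * z - 1\<^sup>2 * V p / 2)) * cis (b * z)"
  have [measurable]: "X y \<in> borel_measurable M" "X p \<in> borel_measurable M" using y p by auto
  have \<psi>: "integrable M (\<lambda>\<omega>. ?\<psi> (X p \<omega>))" by (rule centered_gaussian_tilted_cis(2)[OF gaussian[OF p]])
  have cis_int: "integrable M (\<lambda>\<omega>. cis (c * X g \<omega>))" if "g \<in> G" for c g
    using that by (intro integrable_const_bound[where B=1]) auto
  have 1: "integrable M (\<lambda>_. 1 :: complex)" by simp
  \<comment> \<open>Independence of \<open>X y\<close> and \<open>X p\<close>: the pair on
    \<open>M\<close> is compared with two independent copies on the product space. The variances of
    combinations add, so the characteristic functions agree. The exponential tilt is unbounded but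
    integrable, which is all that \<open>cis_weight_transfer\<close> asks of \<psi>.\<close>
  have "(CLINT \<omega>|M. complex_of_real 1 * cis (X y \<omega>) * ?\<psi> (X p \<omega>)) =
    (CLINT w|M \<Otimes>\<^sub>M M. complex_of_real 1 * cis (X y (fst w)) * ?\<psi> (X p (snd w)))"
  proof (rule cis_weight_transfer)
    show "finite_measure M" "finite_measure (M \<Otimes>\<^sub>M M)" by unfold_locales
    fix c s
    have "(CLINT \<omega>|M. complex_of_real 1 * cis (c * X y \<omega> + s * X p \<omega>)) =
        (CLINT \<omega>|M. cis (1 * X (\<lambda>x. c * y x + s * p x) \<omega>))"
      by (intro Bochner_Integration.integral_cong) (auto simp: linear y p)
    also have "\<dots> = complex_of_real (exp (- (c\<^sup>2 * V y + s\<^sup>2 * V p) / 2))"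
      using centered_gaussian_cis[OF gaussian[OF combine_mem[OF y p, of c s]], of 1] by (simp add: V)
    also have "\<dots> = (CLINT \<omega>|M. cis (c * X y \<omega>)) * (CLINT \<omega>|M. cis (s * X p \<omega>))"
      using centered_gaussian_cis[OF gaussian[OF y], of c] centered_gaussian_cis[OF gaussian[OF p], of s]
      by (simp add: exp_add[symmetric] add_divide_distrib of_real_mult[symmetric] del: of_real_mult)
    also have "\<dots> = (CLINT w|M \<Otimes>\<^sub>M M. cis (c * X y (fst w)) * cis (s * X p (snd w)))"
      using MM.integral_product_mult[OF cis_int[OF y] cis_int[OF p]] by simp
    finally show "(CLINT \<omega>|M. complex_of_real 1 * cis (c * X y \<omega> + s * X p \<omega>)) =
      (CLINT w|M \<Otimes>\<^sub>M M. complex_of_real 1 * cis (c * X y (fst w) + s * X p (snd w)))"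
      by (simp add: cis_mult)
  next
    show "integrable M (\<lambda>\<omega>. ?\<psi> (X p \<omega>))" by fact
    show "integrable (M \<Otimes>\<^sub>M M) (\<lambda>w. ?\<psi> (X p (snd w)))"
      using MM.integrable_product_mult[OF 1 \<psi>] by simp
  qed (simp_all, measurable)
  also have "\<dots> = (CLINT \<omega>|M. cis (1 * X y \<omega>)) * (CLINT \<omega>|M. ?\<psi> (X p \<omega>))"
    using MM.integral_product_mult[OF cis_int[OF y, of 1] \<psi>] by simp
  also have "\<dots> = complex_of_real (exp (- V y / 2)) * (cis (b * V p) * complex_of_real (exp (- b\<^sup>2 * V p / 2)))"
    unfolding centered_gaussian_cis[OF gaussian[OF y]] centered_gaussian_tilted_cis(1)[OF gaussian[OF p]] by simp
  also have "\<dots> = cis (cov p g) * complex_of_real (exp (- V g / 2))"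
    proof -
    have "exp (- V g / 2) = exp (- V y / 2) * exp (- b\<^sup>2 * V p / 2)"
      unfolding Vg exp_add[symmetric] by (simp add: field_simps)
    then show ?thesis unfolding bV by simp
  qed
  also have "(CLINT \<omega>|M. complex_of_real 1 * cis (X y \<omega>) * ?\<psi> (X p \<omega>)) =
      (CLINT \<omega>|M. complex_of_real (exp (X p \<omega> - V p / 2)) * cis (X g \<omega>))"
    by (intro Bochner_Integration.integral_cong) (auto simp: Xg cis_mult[symmetric] mult_ac)
  finally show ?thesis .
qed

lemma sum_mem:
  assumes "finite J" "J \<subseteq> G"
  shows "(\<lambda>x. \<Sum>g\<in>J. t g * g x) \<in> G"
    and "\<omega> \<in> space M \<Longrightarrow> X (\<lambda>x. \<Sum>g\<in>J. t g * g x) \<omega> = (\<Sum>g\<in>J. t g * X g \<omega>)"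
    and "linear_functional l \<Longrightarrow> l (\<lambda>x. \<Sum>g\<in>J. t g * g x) = (\<Sum>g\<in>J. t g * l g)"
proof -
  have "(\<lambda>x. \<Sum>g\<in>J. t g * g x) \<in> G \<and>
      (\<omega> \<in> space M \<longrightarrow> X (\<lambda>x. \<Sum>g\<in>J. t g * g x) \<omega> = (\<Sum>g\<in>J. t g * X g \<omega>)) \<and>
      (linear_functional l \<longrightarrow> l (\<lambda>x. \<Sum>g\<in>J. t g * g x) = (\<Sum>g\<in>J. t g * l g))"
    using assms
  proof (induction J rule: finite_induct)
    case empty
    then show ?case using zero_mem linear[OF _ zero_mem zero_mem, of \<omega> 0 0] linear_functional_zero by simp
  next
    case (insert k J)
    then have k: "k \<in> G" and S: "(\<lambda>x. \<Sum>g\<in>J. t g * g x) \<in> G" by auto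
    show ?case
      using insert combine_mem[OF k S, of "t k" 1] linear[OF _ k S, of \<omega> "t k" 1]
        linear_functionalD[OF _ k S, of l "t k" 1] by simp
  qed
  then show "(\<lambda>x. \<Sum>g\<in>J. t g * g x) \<in> G"
    and "\<omega> \<in> space M \<Longrightarrow> X (\<lambda>x. \<Sum>g\<in>J. t g * g x) \<omega> = (\<Sum>g\<in>J. t g * X g \<omega>)"
    and "linear_functional l \<Longrightarrow> l (\<lambda>x. \<Sum>g\<in>J. t g * g x) = (\<Sum>g\<in>J. t g * l g)"
    by blast+
qed

lemma cylinder_shift_bound:
  assumes J: "finite J" "J \<subseteq> G" and l: "linear_functional l" and C: "0 \<le> C" "\<And>g. g \<in> G \<Longrightarrow> (l g)\<^sup>2 \<le> C * V g"
    and A: "A \<in> sets (PiM J (\<lambda>_. borel))"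
  shows "(emeasure (distr M (PiM J (\<lambda>_. borel)) (\<lambda>\<omega>. \<lambda>g\<in>J. X g \<omega> + l g)) A)\<^sup>2
    \<le> ennreal (exp C) * emeasure (distr M (PiM J (\<lambda>_. borel)) (\<lambda>\<omega>. \<lambda>g\<in>J. X g \<omega>)) A"
proof -
  obtain p where p: "\<And>S. subspace_of S \<Longrightarrow> J \<subseteq> S \<Longrightarrow> p \<in> S" "\<And>g. g \<in> J \<Longrightarrow> cov p g = l g"
    using riesz_finite[OF J l C(2)] by blast
  have G: "subspace_of G" using zero_mem combine_mem by (auto simp: subspace_of_def)
  have pG: "p \<in> G" using p(1)[OF G J(2)] .
  have agree: "cov p g = l g" if "\<And>S. subspace_of S \<Longrightarrow> J \<subseteq> S \<Longrightarrow> g \<in> S" for g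
    using that[OF subspace_of_agree[OF linear_functional_cov[OF pG] l]] p(2) J by auto
  \<comment> \<open>\<open>p\<close> lies in the span of \<open>J\<close>, so it may itself be
    inserted into the identity cov p = l. The hypothesis at \<open>p\<close> then reads (V p)^2
    \<le> C V p, a bound on the variance that does not depend on \<open>J\<close>.\<close>
  have "V p = l p" using agree[OF p(1)] cov_self[OF pG] by simp
  then have "V p * V p \<le> C * V p" using C(2)[OF pG] by (simp add: power2_eq_square)
  then have VC: "V p \<le> C" using V_nonneg[OF pG] C(1) by (cases "V p = 0") (auto simp: mult_le_cancel_right)
  let ?D = "\<lambda>\<omega>. exp (1 * X p \<omega> - 1\<^sup>2 * V p / 2)"
  have [measurable]: "X p \<in> borel_measurable M" using pG by auto
  let ?Q = "density M (\<lambda>\<omega>. ennreal (?D \<omega>))"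
  note D = centered_gaussian_exp[OF gaussian[OF pG]]
  have finQ: "finite_measure ?Q"
    using nn_integral_eq_integral[OF D(1)[of 1]] by (intro finite_measureI) (simp add: emeasure_density cong: nn_integral_cong_simp)
  have XJ: "g \<in> J \<Longrightarrow> X g \<in> borel_measurable M" for g using J by auto
  \<comment> \<open>Both joint characteristic functions at \<open>t\<close> equal cis (l g) exp (-V
    g / 2) for the single element g = \<Sum> t g: on the left by translation, on the right by
    \<open>tilted_cis\<close> and cov p g = l g.\<close>
  have eq: "distr M (PiM J (\<lambda>_. borel)) (\<lambda>\<omega>. \<lambda>g\<in>J. X g \<omega> + l g) = distr ?Q (PiM J (\<lambda>_. borel)) (\<lambda>\<omega>. \<lambda>g\<in>J. X g \<omega>)"
  proof (rule distr_PiM_eqI_char[OF _ finQ J(1)])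
    show "finite_measure M" by unfold_locales
    fix t :: "('a \<Rightarrow> real) \<Rightarrow> real"
    define g where "g = (\<lambda>x. \<Sum>g\<in>J. t g * g x)"
    have g: "g \<in> G" "\<And>\<omega>. \<omega> \<in> space M \<Longrightarrow> X g \<omega> = (\<Sum>g\<in>J. t g * X g \<omega>)" "l g = (\<Sum>g\<in>J. t g * l g)"
      unfolding g_def using sum_mem[OF J] l by auto
    have "cov p g = l g"
      unfolding g_def sum_mem(3)[OF J l] sum_mem(3)[OF J linear_functional_cov[OF pG]] using p(2) by simp
    note g = g this
    have [measurable]: "X g \<in> borel_measurable M" using g by auto
    have "(CLINT \<omega>|M. cis (\<Sum>g\<in>J. t g * (X g \<omega> + l g))) = (CLINT \<omega>|M. cis (l g) * cis (1 * X g \<omega>))"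
      by (intro Bochner_Integration.integral_cong) (auto simp: g cis_mult distrib_left sum.distrib add.commute)
    also have "\<dots> = cis (l g) * complex_of_real (exp (- V g / 2))"
      using centered_gaussian_cis[OF gaussian[OF g(1)], of 1] by simp
    also have "\<dots> = (CLINT \<omega>|M. complex_of_real (exp (X p \<omega> - V p / 2)) * cis (X g \<omega>))"
      using tilted_cis[OF pG g(1)] g by simp
    also have "\<dots> = (CLINT \<omega>|?Q. cis (X g \<omega>))"
      by (subst integral_density) (auto simp: scaleR_conv_of_real)
    also have "\<dots> = (CLINT \<omega>|?Q. cis (\<Sum>g\<in>J. t g * X g \<omega>))"
      by (intro Bochner_Integration.integral_cong) (auto simp: g)
    finally show "(CLINT \<omega>|M. cis (\<Sum>g\<in>J. t g * (X g \<omega> + l g))) = (CLINT \<omega>|?Q. cis (\<Sum>g\<in>J. t g * X g \<omega>))" .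
  qed (use XJ in auto)
  have mX: "(\<lambda>\<omega>. \<lambda>g\<in>J. X g \<omega>) \<in> M \<rightarrow>\<^sub>M PiM J (\<lambda>_. borel)" using XJ by (intro measurable_restrict) auto
  let ?E = "(\<lambda>\<omega>. \<lambda>g\<in>J. X g \<omega>) -` A \<inter> space M"
  have E [measurable]: "?E \<in> sets M" by (rule measurable_sets[OF mX A])
  have D2: "(\<integral>\<^sup>+\<omega>. (ennreal (?D \<omega>))\<^sup>2 \<partial>M) = ennreal (exp (V p))"
  proof -
    \<comment> \<open>The square of the density is \<open>exp (V p)\<close> times the density of the
      tilt with s = 2, whose integral is 1.\<close>
    have "(?D \<omega>)\<^sup>2 = exp (V p) * exp (2 * X p \<omega> - 2\<^sup>2 * V p / 2)" for \<omega>
      by (simp add: exp_add[symmetric] power2_eq_square)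
    then have "(\<integral>\<^sup>+\<omega>. (ennreal (?D \<omega>))\<^sup>2 \<partial>M) = (\<integral>\<^sup>+\<omega>. ennreal (exp (V p) * exp (2 * X p \<omega> - 2\<^sup>2 * V p / 2)) \<partial>M)"
      by (simp add: ennreal_power)
    also have "\<dots> = ennreal (exp (V p))"
      using nn_integral_eq_integral[OF integrable_mult_right[OF D(1)[of 2], of "exp (V p)"]] D(2)[of 2] by simp
    finally show ?thesis .
  qed
  have "(emeasure (distr M (PiM J (\<lambda>_. borel)) (\<lambda>\<omega>. \<lambda>g\<in>J. X g \<omega> + l g)) A)\<^sup>2 = (\<integral>\<^sup>+\<omega>. ennreal (?D \<omega>) * indicator ?E \<omega> \<partial>M)\<^sup>2"
    unfolding eq using mX A E by (simp add: emeasure_distr emeasure_density)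
  also have "\<dots> \<le> (\<integral>\<^sup>+\<omega>. (ennreal (?D \<omega>))\<^sup>2 \<partial>M) * (\<integral>\<^sup>+\<omega>. (indicator ?E \<omega>)\<^sup>2 \<partial>M)"
    by (rule Cauchy_Schwarz_nn_integral) measurable
  also have "(\<integral>\<^sup>+\<omega>. (indicator ?E \<omega>)\<^sup>2 \<partial>M) = (\<integral>\<^sup>+\<omega>. indicator ?E \<omega> \<partial>M)"
    by (intro nn_integral_cong) (simp add: indicator_def)
  also have "\<dots> = emeasure (distr M (PiM J (\<lambda>_. borel)) (\<lambda>\<omega>. \<lambda>g\<in>J. X g \<omega>)) A"
    using E A mX by (simp add: emeasure_distr)
  also have "(\<integral>\<^sup>+\<omega>. (ennreal (?D \<omega>))\<^sup>2 \<partial>M) = ennreal (exp (V p))" by (rule D2)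
  also have "ennreal (exp (V p)) * emeasure (distr M (PiM J (\<lambda>_. borel)) (\<lambda>\<omega>. \<lambda>g\<in>J. X g \<omega>)) A
      \<le> ennreal (exp C) * emeasure (distr M (PiM J (\<lambda>_. borel)) (\<lambda>\<omega>. \<lambda>g\<in>J. X g \<omega>)) A"
    using VC by (intro mult_right_mono) (auto intro: ennreal_leI)
  finally show ?thesis .
qed

end

section \<open>From cylinder sets to the generated sigma-algebra\<close>

lemma sigma_sets_approx:
  assumes alg: "algebra \<Omega> \<G>"
    and fin: "finite_measure \<mu>" "finite_measure \<nu>"
    and sets: "sets \<mu> = sigma_sets \<Omega> \<G>" "sets \<nu> = sigma_sets \<Omega> \<G>"
    and A: "A \<in> sigma_sets \<Omega> \<G>" and e: "0 < (e::real)"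
  shows "\<exists>B\<in>\<G>. measure \<mu> (sym_diff A B) < e \<and> measure \<nu> (sym_diff A B) < e"
  using A e
proof (induction A arbitrary: e rule: sigma_sets.induct)
  case (Basic a)
  then show ?case by (intro bexI[of _ a]) auto
next
  case Empty
  interpret algebra \<Omega> \<G> by fact
  show ?case using Empty by (intro bexI[of _ "{}"]) auto
next
  case (Compl a)
  interpret algebra \<Omega> \<G> by fact
  obtain B where B: "B \<in> \<G>" "measure \<mu> (sym_diff a B) < e" "measure \<nu> (sym_diff a B) < e"
    using Compl by blast
  have "a \<subseteq> \<Omega>" "B \<subseteq> \<Omega>" using Compl(1) B(1) sigma_sets_into_sp[OF space_closed] sets_into_space by auto
  then have "sym_diff (\<Omega> - a) (\<Omega> - B) = sym_diff a B" by auto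
  with B show ?case by (intro bexI[of _ "\<Omega> - B"]) auto
next
  case (Union a)
  interpret algebra \<Omega> \<G> by fact
  define U where "U n = (\<Union>i<n. a i)" for n :: nat
  define A where "A = (\<Union>i. a i)"
  have tail: "(\<lambda>n. measure N (A - U n)) \<longlonglongrightarrow> 0"
    if N: "finite_measure N" "sets N = sigma_sets \<Omega> \<G>" for N
  proof -
    interpret N: finite_measure N by fact
    have "(\<lambda>n. measure N (A - U n)) \<longlonglongrightarrow> measure N (\<Inter>n. A - U n)"
    proof (rule N.finite_Lim_measure_decseq)
      have "a i \<in> sets N" for i using Union N by auto
      then show "range (\<lambda>n. A - U n) \<subseteq> sets N" by (auto simp: U_def A_def)
      show "decseq (\<lambda>n. A - U n)" unfolding decseq_def U_def by (auto dest: less_le_trans)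
    qed
    moreover have "(\<Inter>n. A - U n) = {}" by (auto simp: U_def A_def)
    ultimately show ?thesis by (simp only: measure_empty)
  qed
  have "\<forall>\<^sub>F n in sequentially. measure \<mu> (A - U n) < e / 2 \<and> measure \<nu> (A - U n) < e / 2"
    using order_tendstoD(2)[OF tail[OF fin(1) sets(1)], of "e/2"]
      order_tendstoD(2)[OF tail[OF fin(2) sets(2)], of "e/2"] Union.prems by (auto intro: eventually_conj)
  then obtain n where n: "measure \<mu> (A - U n) < e / 2" "measure \<nu> (A - U n) < e / 2"
    by (auto simp: eventually_sequentially)
  \<comment> \<open>Half of the error is spent on the tail of the union, the other half on n
    approximations; n + 1 in the denominator also covers n = 0.\<close>
  define e' where "e' = e / (2 * (real n + 1))"
  have e': "0 < e'" using Union.prems by (simp add: e'_def)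
  have "\<forall>i. \<exists>B\<in>\<G>. measure \<mu> (sym_diff (a i) B) < e' \<and> measure \<nu> (sym_diff (a i) B) < e'"
    using Union.IH e' by blast
  then obtain B where B: "\<And>i. B i \<in> \<G>" "\<And>i. measure \<mu> (sym_diff (a i) (B i)) < e'"
    "\<And>i. measure \<nu> (sym_diff (a i) (B i)) < e'" by metis
  define C where "C = (\<Union>i<n. B i)"
  have C: "C \<in> \<G>" unfolding C_def using B by (intro finite_UN) auto
  have bound: "measure N (sym_diff A C) < e"
    if N: "finite_measure N" "sets N = sigma_sets \<Omega> \<G>"
      and 1: "measure N (A - U n) < e / 2" and 2: "\<And>i. measure N (sym_diff (a i) (B i)) < e'" for N
  proof -
    interpret N: finite_measure N by fact
    have s: "a i \<in> sets N" "B i \<in> sets N" for i using Union B N by auto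
    have m: "A - U n \<in> sets N" "(\<Union>i<n. sym_diff (a i) (B i)) \<in> sets N"
      using s by (auto simp: A_def U_def)
    have "measure N (sym_diff A C) \<le> measure N ((A - U n) \<union> (\<Union>i<n. sym_diff (a i) (B i)))"
    proof (rule N.finite_measure_mono)
      show "sym_diff A C \<subseteq> (A - U n) \<union> (\<Union>i<n. sym_diff (a i) (B i))"
        by (auto simp: A_def U_def C_def)
    qed (use m in auto)
    also have "\<dots> \<le> measure N (A - U n) + measure N (\<Union>i<n. sym_diff (a i) (B i))"
      using m by (rule measure_Un_le)
    also have "measure N (\<Union>i<n. sym_diff (a i) (B i)) \<le> (\<Sum>i<n. measure N (sym_diff (a i) (B i)))"
      using s by (intro N.finite_measure_subadditive_finite) auto
    also have "\<dots> \<le> (\<Sum>i<n. e')" by (intro sum_mono less_imp_le 2)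
    also have "\<dots> \<le> e / 2" using Union.prems by (simp add: e'_def field_simps)
    finally show ?thesis using 1 by simp
  qed
  show ?case
    using bound[OF fin(1) sets(1) n(1) B(2)] bound[OF fin(2) sets(2) n(2) B(3)] C
    unfolding A_def by blast
qed

text \<open>\<open>sigma_sets_approx\<close> provides a single cylinder B close to A in both
  measures. If A is null for \<mu>, then B has small \<mu>-mass, hence small \<nu>-mass by the
  cylinder bound, and so A has small \<nu>-mass. The index set may be uncountable; only the algebra
  of cylinders matters.\<close>

lemma (in linear_gaussian_process) shift_null_sets:
  assumes l: "linear_functional l" and C: "0 \<le> C" "\<And>g. g \<in> G \<Longrightarrow> (l g)\<^sup>2 \<le> C * V g"
    and A: "A \<in> null_sets (distr M (PiM G (\<lambda>_. borel)) (\<lambda>\<omega>. \<lambda>g\<in>G. X g \<omega>))"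
  shows "A \<in> null_sets (distr M (PiM G (\<lambda>_. borel)) (\<lambda>\<omega>. \<lambda>g\<in>G. X g \<omega> + l g))"
proof -
  let ?P = "PiM G (\<lambda>_. borel :: real measure)"
  define F1 F2 where "F1 = (\<lambda>\<omega>. \<lambda>g\<in>G. X g \<omega>)" and "F2 = (\<lambda>\<omega>. \<lambda>g\<in>G. X g \<omega> + l g)"
  have mF: "F1 \<in> M \<rightarrow>\<^sub>M ?P" "F2 \<in> M \<rightarrow>\<^sub>M ?P"
    unfolding F1_def F2_def by (intro measurable_restrict; simp)+
  define \<mu> \<nu> where "\<mu> = distr M ?P F1" and "\<nu> = distr M ?P F2"
  interpret \<mu>: prob_space \<mu> unfolding \<mu>_def using mF by (intro prob_space_distr)
  interpret \<nu>: prob_space \<nu> unfolding \<nu>_def using mF by (intro prob_space_distr)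
  \<comment> \<open>The projective family of marginals of \<mu> is set up to have its
    \<open>generator\<close>, the algebra of cylinder sets, which generates the product
    sigma-algebra.\<close>
  have "projective_family G (\<lambda>J. distr \<mu> (PiM J (\<lambda>_. borel)) (\<lambda>x. restrict x J)) (\<lambda>_. borel)"
    unfolding projective_family_def
  proof (intro conjI allI impI)
    fix J H :: "('a \<Rightarrow> real) set" assume JH: "J \<subseteq> H" "finite H" "H \<subseteq> G"
    have 1: "(\<lambda>x. restrict x H) \<in> \<mu> \<rightarrow>\<^sub>M PiM H (\<lambda>_. borel)" if "H \<subseteq> G" for H
      using measurable_restrict_subset[OF that] by (simp add: \<mu>_def)
    show "distr \<mu> (PiM J (\<lambda>_. borel)) (\<lambda>x. restrict x J) =
      distr (distr \<mu> (PiM H (\<lambda>_. borel)) (\<lambda>x. restrict x H)) (PiM J (\<lambda>_. borel)) (\<lambda>f. restrict f J)"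
      using JH 1[OF JH(3)] measurable_restrict_subset[OF JH(1)]
      by (subst distr_distr) (auto simp: comp_def Int_absorb1 intro!: distr_cong)
  next
    fix J :: "('a \<Rightarrow> real) set" assume "finite J" "J \<subseteq> G"
    then show "prob_space (distr \<mu> (PiM J (\<lambda>_. borel)) (\<lambda>x. restrict x J))"
      by (intro \<mu>.prob_space_distr) (simp add: \<mu>_def measurable_restrict_subset)
  qed
  then interpret projective_family G "\<lambda>J. distr \<mu> (PiM J (\<lambda>_. borel)) (\<lambda>x. restrict x J)" "\<lambda>_. borel" .
  have cyl: "emeasure (distr M ?P (\<lambda>\<omega>. \<lambda>g\<in>G. Z g \<omega>)) (prod_emb G (\<lambda>_. borel) J Y) =
      emeasure (distr M (PiM J (\<lambda>_. borel)) (\<lambda>\<omega>. \<lambda>g\<in>J. Z g \<omega>)) Y"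
    if J: "finite J" "J \<subseteq> G" "Y \<in> sets (PiM J (\<lambda>_. borel))" and Z: "\<And>g. g \<in> G \<Longrightarrow> Z g \<in> borel_measurable M"
    for J Y and Z :: "('a \<Rightarrow> real) \<Rightarrow> 'w \<Rightarrow> real"
  proof -
    have m: "(\<lambda>\<omega>. \<lambda>g\<in>J. Z g \<omega>) \<in> M \<rightarrow>\<^sub>M PiM J (\<lambda>_. borel)" "(\<lambda>\<omega>. \<lambda>g\<in>G. Z g \<omega>) \<in> M \<rightarrow>\<^sub>M ?P"
      using Z J by (intro measurable_restrict; auto)+
    have "prod_emb G (\<lambda>_. borel) J Y \<in> sets ?P" using J by (intro measurable_prod_emb)
    moreover have "(\<lambda>\<omega>. \<lambda>g\<in>G. Z g \<omega>) -` prod_emb G (\<lambda>_. borel) J Y \<inter> space M = (\<lambda>\<omega>. \<lambda>g\<in>J. Z g \<omega>) -` Y \<inter> space M"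
      using J by (auto simp: prod_emb_def Int_absorb1)
    ultimately show ?thesis using m J by (simp add: emeasure_distr)
  qed
  define K where "K = exp C"
  have K: "0 < K" by (simp add: K_def)
  have gen: "(measure \<nu> B)\<^sup>2 \<le> K * measure \<mu> B" if "B \<in> generator" for B
    using that
  proof cases
    case (1 J Y)
    have "(emeasure \<nu> B)\<^sup>2 \<le> ennreal K * emeasure \<mu> B"
      unfolding \<mu>_def \<nu>_def F1_def F2_def K_def 1(1) using cylinder_shift_bound[OF 1(2,3) l C 1(4)] 1
      by (simp add: cyl)
    then show ?thesis
      using K by (simp add: \<mu>.emeasure_eq_measure \<nu>.emeasure_eq_measure ennreal_power ennreal_mult[symmetric])
  qed
  have sets: "sets \<mu> = sigma_sets (space ?P) generator" "sets \<nu> = sigma_sets (space ?P) generator"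
    by (simp_all add: \<mu>_def \<nu>_def sets_PiM_generator)
  have A\<mu>: "A \<in> sets \<mu>" "measure \<mu> A = 0"
    using A by (auto simp: \<mu>_def F1_def null_sets_def measure_def)
  have A\<nu>: "A \<in> sets \<nu>" using A\<mu> by (simp add: \<mu>_def \<nu>_def)
  have bound: "measure \<nu> A \<le> (sqrt K + 1) * d" if d: "0 < d" "d \<le> 1" for d
  proof -
    \<comment> \<open>The tolerance is d^2 because the cylinder bound costs a square root: \<mu>(B)
      \<le> d^2 gives \<nu>(B) \<le> sqrt K d.\<close>
    obtain B where B: "B \<in> generator" "measure \<mu> (sym_diff A B) < d\<^sup>2" "measure \<nu> (sym_diff A B) < d\<^sup>2"
      using sigma_sets_approx[OF algebra_generator _ _ sets, of A "d\<^sup>2"] A\<mu> d sets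
        \<mu>.finite_measure_axioms \<nu>.finite_measure_axioms by (auto simp: sets)
    have Bs: "B \<in> sets \<mu>" "B \<in> sets \<nu>" using B sets by auto
    have "measure \<mu> B \<le> measure \<mu> (A \<union> sym_diff A B)"
      using A\<mu> Bs by (intro \<mu>.finite_measure_mono) auto
    also have "\<dots> \<le> measure \<mu> A + measure \<mu> (sym_diff A B)"
      using A\<mu> Bs by (intro measure_Un_le) auto
    finally have 1: "measure \<mu> B \<le> d\<^sup>2" using B A\<mu> by simp
    have "measure \<nu> A \<le> measure \<nu> (B \<union> sym_diff A B)"
      using A\<nu> Bs by (intro \<nu>.finite_measure_mono) auto
    also have "\<dots> \<le> measure \<nu> B + measure \<nu> (sym_diff A B)"
      using A\<nu> Bs by (intro measure_Un_le) auto
    finally have 2: "measure \<nu> A \<le> measure \<nu> B + d\<^sup>2" using B by simp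
    have "(measure \<nu> B)\<^sup>2 \<le> K * d\<^sup>2" using gen[OF B(1)] 1 K by (meson mult_left_mono less_imp_le order_trans)
    then have "measure \<nu> B \<le> sqrt (K * d\<^sup>2)" by (rule real_le_rsqrt)
    then have "measure \<nu> B \<le> sqrt K * d" using d by (simp add: real_sqrt_mult)
    moreover have "d\<^sup>2 \<le> d" using d by (simp add: power2_eq_square mult_left_le)
    ultimately show ?thesis using 2 by (simp add: algebra_simps)
  qed
  have "measure \<nu> A \<le> 0"
  proof (rule field_le_epsilon)
    fix e :: real assume e: "0 < e"
    define k where "k = sqrt K + 1"
    define d where "d = min 1 (e / k)"
    have "0 < k" using K by (simp add: k_def add_pos_nonneg)
    then have "0 < d" "d \<le> 1" "k * d \<le> e" using e by (auto simp: d_def min_def field_simps)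
    then show "measure \<nu> A \<le> 0 + e" using bound[of d] by (simp add: k_def)
  qed
  then show ?thesis
    using A\<nu> by (auto simp: null_sets_def \<nu>.emeasure_eq_measure F2_def[symmetric] \<nu>_def[symmetric] measure_le_0_iff)
qed

section \<open>Gaussian representation of the logarithmic kernel\<close>

lemma product_lborel:
  fixes \<phi> :: "'a::euclidean_space \<Rightarrow> real \<Rightarrow> complex"
  assumes \<phi>: "\<And>b. b \<in> Basis \<Longrightarrow> integrable lborel (\<phi> b)"
  shows integral_product_lborel: "(LINT x|lborel. (\<Prod>b\<in>Basis. \<phi> b (x \<bullet> b))) = (\<Prod>b\<in>Basis. (LINT t|lborel. \<phi> b t))"
    and integrable_product_lborel: "integrable lborel (\<lambda>x. \<Prod>b\<in>Basis. \<phi> b (x \<bullet> b))"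
proof -
  interpret product_sigma_finite "\<lambda>_::'a. lborel :: real measure"
    by (simp add: product_sigma_finite_def sigma_finite_lborel)
  have [measurable]: "\<phi> b \<in> borel_measurable borel" if "b \<in> Basis" for b using \<phi>[OF that] by auto
  have m: "(\<lambda>f. \<Sum>b\<in>Basis. f b *\<^sub>R b) \<in> (\<Pi>\<^sub>M b\<in>Basis. lborel) \<rightarrow>\<^sub>M (borel :: 'a measure)"
    by measurable
  have m2: "(\<lambda>x. \<Prod>b\<in>Basis. \<phi> b (x \<bullet> b)) \<in> borel_measurable (borel :: 'a measure)"
    by measurable
  have inner: "(\<Sum>b\<in>Basis. f b *\<^sub>R b) \<bullet> b = f b" if "b \<in> Basis" for f :: "'a \<Rightarrow> real" and b
    using that by (simp add: inner_sum_left inner_Basis if_distrib cong: if_cong)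
  have eq: "(\<Prod>b\<in>Basis. \<phi> b ((\<Sum>b\<in>Basis. f b *\<^sub>R b) \<bullet> b)) = (\<Prod>b\<in>Basis. \<phi> b (f b))" for f
    by (intro prod.cong) (simp_all add: inner)
  show "(LINT x|lborel. (\<Prod>b\<in>Basis. \<phi> b (x \<bullet> b))) = (\<Prod>b\<in>Basis. (LINT t|lborel. \<phi> b t))"
    unfolding lborel_eq[where 'a='a] integral_distr[OF m m2] eq
    by (rule product_integral_prod) (use \<phi> in auto)
  show "integrable lborel (\<lambda>x. \<Prod>b\<in>Basis. \<phi> b (x \<bullet> b))"
    unfolding lborel_eq[where 'a='a] integrable_distr_eq[OF m m2] eq
    by (rule product_integrable_prod) (use \<phi> in auto)
qed

text \<open>The centered Gaussian density with covariance \<sigma>^2 times the identity. The product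
  form reduces its Fourier transform to dimension one; \<open>gauss_eq\<close> is the radial form
  used for estimates.\<close>

definition gauss :: "real \<Rightarrow> 'a::euclidean_space \<Rightarrow> real" where
  "gauss \<sigma> \<xi> = (\<Prod>b\<in>Basis. normal_density 0 \<sigma> (\<xi> \<bullet> b))"

lemma gauss_measurable [measurable]: "gauss \<sigma> \<in> borel_measurable (borel :: 'a::euclidean_space measure)"
  unfolding gauss_def by measurable

lemma gauss_nonneg: "0 \<le> gauss \<sigma> \<xi>"
  unfolding gauss_def by (intro prod_nonneg) auto

lemma cis_inner: "cis (\<xi> \<bullet> z) = (\<Prod>b\<in>Basis. cis ((z \<bullet> b) * (\<xi> \<bullet> b)))"
  by (subst euclidean_inner) (simp add: cis_conv_exp sum_distrib_left exp_sum mult.commute)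

lemma norm_sq_Basis: "(norm x)\<^sup>2 = (\<Sum>b\<in>Basis. (x \<bullet> b)\<^sup>2)"
  unfolding power2_norm_eq_inner by (subst euclidean_inner) (simp add: power2_eq_square)

lemma gauss_eq:
  fixes \<xi> :: "'a::euclidean_space"
  assumes "0 < \<sigma>"
  shows "gauss \<sigma> \<xi> = (1 / (sqrt (2 * pi) * \<sigma>)) ^ DIM('a) * exp (- (norm \<xi> / \<sigma>)\<^sup>2 / 2)"
proof -
  have "exp (- (norm \<xi> / \<sigma>)\<^sup>2 / 2) = (\<Prod>b\<in>Basis. exp (- (\<xi> \<bullet> b)\<^sup>2 / (2 * \<sigma>\<^sup>2)))"
    by (simp add: exp_sum[symmetric] power_divide norm_sq_Basis sum_negf sum_divide_distrib mult.commute)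
  then show ?thesis
    using assms by (simp add: gauss_def normal_density_def prod.distrib real_sqrt_mult prod_dividef power_divide)
qed

text \<open>The kernels in Frullani's formula are characteristic functions of probability densities.
  This makes the associated quadratic forms nonnegative and gives their Fourier representation with
  no inversion formula.\<close>

lemma gauss_fourier:
  fixes z :: "'a::euclidean_space"
  assumes \<sigma>: "0 < \<sigma>"
  shows "(LINT \<xi>|lborel. gauss \<sigma> \<xi> * cis (\<xi> \<bullet> z)) = complex_of_real (exp (- (\<sigma> * norm z)\<^sup>2 / 2))"
    and "integrable lborel (\<lambda>\<xi>. gauss \<sigma> \<xi> * cis (\<xi> \<bullet> z))"
proof -
  define \<phi> where "\<phi> b t = normal_density 0 \<sigma> t *\<^sub>R cis ((z \<bullet> b) * t)" for b t
  have int: "integrable lborel (\<phi> b)" for b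
    unfolding \<phi>_def by (rule normal_density_cis(2)[OF \<sigma>])
  have eq: "gauss \<sigma> \<xi> * cis (\<xi> \<bullet> z) = (\<Prod>b\<in>Basis. \<phi> b (\<xi> \<bullet> b))" for \<xi>
    unfolding gauss_def cis_inner \<phi>_def by (simp add: prod.distrib scaleR_conv_of_real)
  show "integrable lborel (\<lambda>\<xi>. gauss \<sigma> \<xi> * cis (\<xi> \<bullet> z))"
    unfolding eq by (rule integrable_product_lborel[OF int])
  have "(LINT \<xi>|lborel. gauss \<sigma> \<xi> * cis (\<xi> \<bullet> z)) = (\<Prod>b\<in>Basis. (LINT t|lborel. \<phi> b t))"
    unfolding eq by (rule integral_product_lborel[OF int])
  also have "\<dots> = (\<Prod>b\<in>Basis. complex_of_real (exp (- (\<sigma> * (z \<bullet> b))\<^sup>2 / 2)))"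
    unfolding \<phi>_def normal_density_cis(1)[OF \<sigma>] by simp
  also have "\<dots> = complex_of_real (exp (\<Sum>b\<in>Basis. - (\<sigma> * (z \<bullet> b))\<^sup>2 / 2))"
    by (simp add: exp_sum)
  also have "(\<Sum>b\<in>Basis. - (\<sigma> * (z \<bullet> b))\<^sup>2 / 2) = - (\<sigma> * norm z)\<^sup>2 / 2"
    by (simp add: power_mult_distrib norm_sq_Basis sum_distrib_left sum_negf sum_divide_distrib)
  finally show "(LINT \<xi>|lborel. gauss \<sigma> \<xi> * cis (\<xi> \<bullet> z)) = complex_of_real (exp (- (\<sigma> * norm z)\<^sup>2 / 2))" .
qed

lemma gauss_integral:
  assumes \<sigma>: "0 < \<sigma>"
  shows "integrable lborel (gauss \<sigma> :: 'a::euclidean_space \<Rightarrow> real)"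
    and "(LINT \<xi>|lborel. gauss \<sigma> (\<xi>::'a)) = 1"
proof -
  have "integrable lborel (\<lambda>\<xi>. Re (gauss \<sigma> (\<xi>::'a) * cis (\<xi> \<bullet> 0)))"
    by (intro integrable_Re gauss_fourier(2)[OF \<sigma>])
  then show "integrable lborel (gauss \<sigma> :: 'a \<Rightarrow> real)" by simp
  have "(LINT \<xi>|lborel. complex_of_real (gauss \<sigma> (\<xi>::'a))) = 1"
    using gauss_fourier(1)[OF \<sigma>, of "0::'a"] by simp
  then show "(LINT \<xi>|lborel. gauss \<sigma> (\<xi>::'a)) = 1"
    unfolding integral_complex_of_real by simp
qed

section \<open>Frullani's integral for the logarithm\<close>

lemma exp_neg_square_at_top:
  assumes "(0::real) < a"
  shows "((\<lambda>x. exp (- (x * a)\<^sup>2 / 2)) \<longlongrightarrow> 0) at_top"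
proof (rule filterlim_compose[OF exp_at_bot])
  have "filterlim (\<lambda>x. a\<^sup>2 / 2 * x\<^sup>2) at_top at_top"
    using assms by (intro filterlim_tendsto_pos_mult_at_top[OF tendsto_const] filterlim_pow_at_top filterlim_ident) auto
  then show "filterlim (\<lambda>x. - (x * a)\<^sup>2 / 2) at_bot at_top"
    by (simp add: filterlim_uminus_at_top power_mult_distrib mult.commute)
qed

text \<open>The integrand is the integral of \<sigma> \<rho> exp (-(\<sigma> \<rho>)^2 / 2) over
  \<rho> from a to b. In the other order the \<sigma>-integral is 1 / \<rho>, which integrates to
  the logarithm. The assumption a \<le> b keeps everything nonnegative, so Tonelli's theorem
  suffices.\<close>

lemma nn_integral_Frullani:
  fixes a b :: real
  assumes ab: "0 < a" "a \<le> b"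
  shows "(\<integral>\<^sup>+\<sigma>. ennreal ((exp (- (\<sigma> * a)\<^sup>2 / 2) - exp (- (\<sigma> * b)\<^sup>2 / 2)) / \<sigma>) * indicator {0..} \<sigma> \<partial>lborel) = ennreal (ln (b / a))"
proof -
  let ?f = "\<lambda>\<sigma> \<rho>::real. \<sigma> * \<rho> * exp (- (\<sigma> * \<rho>)\<^sup>2 / 2)"
  have 1: "ennreal ((exp (- (\<sigma> * a)\<^sup>2 / 2) - exp (- (\<sigma> * b)\<^sup>2 / 2)) / \<sigma>) * indicator {0..} \<sigma>
      = (\<integral>\<^sup>+\<rho>. ennreal (?f \<sigma> \<rho>) * indicator {a..b} \<rho> * indicator {0..} \<sigma> \<partial>lborel)" for \<sigma>
  proof (cases "0 < \<sigma>")
    case True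
    have "(\<integral>\<^sup>+\<rho>. ennreal (?f \<sigma> \<rho>) * indicator {a..b} \<rho> \<partial>lborel) =
      (- exp (- (\<sigma> * b)\<^sup>2 / 2) / \<sigma>) - (- exp (- (\<sigma> * a)\<^sup>2 / 2) / \<sigma>)"
      using ab True
      by (intro nn_integral_FTC_Icc)
         (auto intro!: derivative_eq_intros simp: power2_eq_square field_simps)
    then show ?thesis using True by (simp add: diff_divide_distrib)
  next
    case False
    then show ?thesis by (cases "\<sigma> = 0") auto
  qed
  have 2: "(\<integral>\<^sup>+\<sigma>. ennreal (?f \<sigma> \<rho>) * indicator {a..b} \<rho> * indicator {0..} \<sigma> \<partial>lborel)
      = ennreal (1 / \<rho>) * indicator {a..b} \<rho>" for \<rho>
  proof (cases "\<rho> \<in> {a..b}")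
    case True
    then have \<rho>: "0 < \<rho>" using ab by auto
    have "(\<integral>\<^sup>+\<sigma>. ennreal (?f \<sigma> \<rho>) * indicator {0..} \<sigma> \<partial>lborel) = 0 - (- exp (- (0 * \<rho>)\<^sup>2 / 2) / \<rho>)"
    proof (rule nn_integral_FTC_atLeast)
      show "((\<lambda>\<sigma>. - exp (- (\<sigma> * \<rho>)\<^sup>2 / 2) / \<rho>) \<longlongrightarrow> 0) at_top"
        using tendsto_mult_right[OF exp_neg_square_at_top[OF \<rho>], of "- 1 / \<rho>"] by simp
      show "((\<lambda>\<sigma>. - exp (- (\<sigma> * \<rho>)\<^sup>2 / 2) / \<rho>) has_real_derivative ?f \<sigma> \<rho>) (at \<sigma>)" for \<sigma>
        using \<rho> by (auto intro!: derivative_eq_intros simp: power2_eq_square field_simps)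
    qed (use \<rho> in auto)
    with True show ?thesis by simp
  qed auto
  have "(\<integral>\<^sup>+\<sigma>. ennreal ((exp (- (\<sigma> * a)\<^sup>2 / 2) - exp (- (\<sigma> * b)\<^sup>2 / 2)) / \<sigma>) * indicator {0..} \<sigma> \<partial>lborel)
    = (\<integral>\<^sup>+\<sigma>. (\<integral>\<^sup>+\<rho>. ennreal (?f \<sigma> \<rho>) * indicator {a..b} \<rho> * indicator {0..} \<sigma> \<partial>lborel) \<partial>lborel)"
    unfolding 1 ..
  also have "\<dots> = (\<integral>\<^sup>+\<rho>. (\<integral>\<^sup>+\<sigma>. ennreal (?f \<sigma> \<rho>) * indicator {a..b} \<rho> * indicator {0..} \<sigma> \<partial>lborel) \<partial>lborel)"
    by (rule lborel_pair.Fubini') measurable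
  also have "\<dots> = (\<integral>\<^sup>+\<rho>. ennreal (1 / \<rho>) * indicator {a..b} \<rho> \<partial>lborel)"
    unfolding 2 ..
  also have "\<dots> = ln b - ln a"
    using ab by (intro nn_integral_FTC_Icc) (auto intro!: derivative_eq_intros)
  finally show ?thesis using ab by (simp add: ln_div)
qed

definition frullani :: "real \<Rightarrow> real \<Rightarrow> real" where
  "frullani r \<sigma> = indicator {0..} \<sigma> * ((exp (- (\<sigma> * r)\<^sup>2 / 2) - exp (- \<sigma>\<^sup>2 / 2)) / \<sigma>)"

lemma frullani_measurable [measurable]:
  "(\<lambda>p. frullani (fst p) (snd p)) \<in> borel_measurable (borel \<Otimes>\<^sub>M borel)"
  unfolding frullani_def by measurable

text \<open>For r \<le> 1 this is the previous formula with (a, b) = (r, 1), for r > 1 with (1, r)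
  and the opposite sign; \<open>s\<close> records the sign. Because the sign does not change with
  \<sigma>, the integral of the absolute value is exactly |ln r|, which is what Fubini's theorem for
  the variance has to control.\<close>

lemma frullani_integral:
  assumes r: "0 < r"
  shows "integrable lborel (frullani r)" "(LINT \<sigma>|lborel. frullani r \<sigma>) = ln (1 / r)"
    "(LINT \<sigma>|lborel. \<bar>frullani r \<sigma>\<bar>) = \<bar>ln r\<bar>"
proof -
  have [measurable]: "frullani r \<in> borel_measurable borel" unfolding frullani_def by measurable
  define s :: real where "s = (if r \<le> 1 then 1 else - 1)"
  have s: "s * s = 1" "\<bar>s\<bar> = 1" by (auto simp: s_def)
  have le: "0 \<le> s * frullani r \<sigma>" for \<sigma>
  proof (cases "0 < \<sigma>")
    case True
    have "(\<sigma> * r)\<^sup>2 \<le> \<sigma>\<^sup>2 * 1" if "r \<le> 1"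
      unfolding power_mult_distrib using that r by (intro mult_left_mono) (auto simp: power_le_one)
    moreover have "\<sigma>\<^sup>2 * 1 \<le> (\<sigma> * r)\<^sup>2" if "\<not> r \<le> 1"
      unfolding power_mult_distrib using that r by (intro mult_left_mono) (auto simp: one_le_power)
    ultimately show ?thesis using True
      by (auto simp: s_def frullani_def divide_nonpos_pos mult_nonpos_nonneg)
  next
    case False
    then show ?thesis by (cases "\<sigma> = 0") (auto simp: frullani_def)
  qed
  have "(\<integral>\<^sup>+\<sigma>. ennreal (s * frullani r \<sigma>) \<partial>lborel) = ennreal \<bar>ln r\<bar>"
  proof (cases "r \<le> 1")
    case True
    have "(\<integral>\<^sup>+\<sigma>. ennreal (s * frullani r \<sigma>) \<partial>lborel) =
      (\<integral>\<^sup>+\<sigma>. ennreal ((exp (- (\<sigma> * r)\<^sup>2 / 2) - exp (- (\<sigma> * 1)\<^sup>2 / 2)) / \<sigma>) * indicator {0..} \<sigma> \<partial>lborel)"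
      using True by (intro nn_integral_cong) (auto simp: s_def frullani_def indicator_def)
    then show ?thesis using nn_integral_Frullani[OF r True] r True by (simp add: ln_div)
  next
    case False
    have "(\<integral>\<^sup>+\<sigma>. ennreal (s * frullani r \<sigma>) \<partial>lborel) =
      (\<integral>\<^sup>+\<sigma>. ennreal ((exp (- (\<sigma> * 1)\<^sup>2 / 2) - exp (- (\<sigma> * r)\<^sup>2 / 2)) / \<sigma>) * indicator {0..} \<sigma> \<partial>lborel)"
      using False by (intro nn_integral_cong) (auto simp: s_def frullani_def indicator_def diff_divide_distrib)
    then show ?thesis using nn_integral_Frullani[of 1 r] r False by simp
  qed
  then have "has_bochner_integral lborel (\<lambda>\<sigma>. s * frullani r \<sigma>) \<bar>ln r\<bar>"
    using le by (intro has_bochner_integral_nn_integral) auto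
  then have int: "integrable lborel (\<lambda>\<sigma>. s * frullani r \<sigma>)" "(LINT \<sigma>|lborel. s * frullani r \<sigma>) = \<bar>ln r\<bar>"
    by (auto simp: has_bochner_integral_iff)
  have eq: "frullani r = (\<lambda>\<sigma>. s * (s * frullani r \<sigma>))"
    by (rule ext) (simp add: mult.assoc[symmetric] s(1))
  show "integrable lborel (frullani r)"
    by (subst eq) (rule integrable_mult_right[OF int(1)])
  have "(LINT \<sigma>|lborel. frullani r \<sigma>) = s * \<bar>ln r\<bar>"
  proof -
    have "s * (LINT \<sigma>|lborel. frullani r \<sigma>) = \<bar>ln r\<bar>" using int(2) by simp
    then show ?thesis by (metis mult.assoc mult_1 s(1))
  qed
  also have "\<dots> = ln (1 / r)" using r by (auto simp: s_def ln_div)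
  finally show "(LINT \<sigma>|lborel. frullani r \<sigma>) = ln (1 / r)" .
  have "\<bar>frullani r \<sigma>\<bar> = s * frullani r \<sigma>" for \<sigma>
    using le[of \<sigma>] s(2) by (metis abs_mult abs_of_nonneg mult_1)
  then show "(LINT \<sigma>|lborel. \<bar>frullani r \<sigma>\<bar>) = \<bar>ln r\<bar>" using int(2) by simp
qed

text \<open>The singularity of the logarithm is dominated by an inverse square root, which is dominated by
  the inverse square root of a single coordinate and so integrable in every dimension.\<close>

lemma abs_ln_le:
  assumes "0 < (r::real)" shows "\<bar>ln r\<bar> \<le> r + 2 / sqrt r"
proof (cases "1 \<le> r")
  case True
  then have "\<bar>ln r\<bar> \<le> r" using ln_le_minus_one[of r] by simp
  also have "\<dots> \<le> r + 2 / sqrt r" using assms by simp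
  finally show ?thesis .
next
  case False
  have "\<bar>ln r\<bar> = 2 * ln (1 / sqrt r)" using False assms by (simp add: ln_div ln_sqrt)
  also have "ln (1 / sqrt r) \<le> 1 / sqrt r" using assms ln_le_minus_one[of "1 / sqrt r"] by simp
  finally show ?thesis using assms by simp
qed

lemma nn_integral_inverse_sqrt:
  assumes L: "0 \<le> (L::real)"
  shows "(\<integral>\<^sup>+t. inverse (ennreal (sqrt \<bar>t\<bar>)) * indicator {-L..L} t \<partial>lborel) < \<infinity>"
proof -
  let ?h = "\<lambda>t::real. ennreal (t powr (-1/2) * indicator {0..L} t)"
  have "((\<lambda>x. if x \<in> {0..L} then x powr (-1/2) else 0) has_integral (L powr (-1/2+1) / (-1/2+1))) UNIV"
    unfolding has_integral_restrict_UNIV using has_integral_powr_from_0[of "-1/2" L] L by simp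
  also have "(\<lambda>x. if x \<in> {0..L} then x powr (-1/2) else 0) = (\<lambda>x. x powr (-1/2) * indicator {0..L} x)"
    by (auto simp: indicator_def)
  finally have fin: "(\<integral>\<^sup>+t. ?h t \<partial>lborel) < \<infinity>"
    by (subst nn_integral_has_integral_lborel) auto
  have refl: "(\<integral>\<^sup>+t. ?h (0 + (-1) * t) \<partial>lborel) = (\<integral>\<^sup>+t. ?h t \<partial>lborel)"
    using nn_integral_real_affine[of ?h "-1" 0] by simp
  have "(\<integral>\<^sup>+t. inverse (ennreal (sqrt \<bar>t\<bar>)) * indicator {-L..L} t \<partial>lborel)
      \<le> (\<integral>\<^sup>+t. ?h t + ?h (0 + (-1) * t) \<partial>lborel)"
  proof (rule nn_integral_mono_AE)
    show "AE t in lborel. inverse (ennreal (sqrt \<bar>t\<bar>)) * indicator {-L..L} t \<le> ?h t + ?h (0 + (-1) * t)"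
      using AE_lborel_singleton[of 0]
    proof eventually_elim
      case (elim t)
      have eq: "inverse (ennreal (sqrt \<bar>t\<bar>)) = ennreal (\<bar>t\<bar> powr (-1/2))"
        using elim by (simp add: inverse_ennreal powr_minus powr_half_sqrt)
      show ?case using elim unfolding eq by (cases "0 < t") (auto simp: indicator_def)
    qed
  qed
  also have "\<dots> = (\<integral>\<^sup>+t. ?h t \<partial>lborel) + (\<integral>\<^sup>+t. ?h (0 + (-1) * t) \<partial>lborel)"
    by (rule nn_integral_add) measurable
  also have "\<dots> < \<infinity>" unfolding refl using fin by simp
  finally show ?thesis .
qed

lemma nn_integral_local_inverse_sqrt_norm:
  fixes R :: real
  assumes R: "0 \<le> R"
  shows "\<exists>C<\<infinity>. \<forall>z\<in>ball (0::'a::euclidean_space) R.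
    (\<integral>\<^sup>+w. inverse (ennreal (sqrt (norm (z - w)))) * indicator (ball 0 R) w \<partial>lborel) \<le> C"
proof -
  obtain b0 :: 'a where b0: "b0 \<in> Basis" using nonempty_Basis by blast
  \<comment> \<open>The difference of two points of the ball lies in the cube of half side 2 R, and
    its norm is at least its coordinate along \<open>b0\<close>. The product of these factors
    dominates the integrand, also where that coordinate vanishes since the value there is infinite.
    Reflection and translation of each coordinate make the bound independent of z.\<close>
  define F where "F b t = (if b = b0 then inverse (ennreal (sqrt \<bar>t\<bar>)) else 1) * indicator {-(2*R)..2*R} t" for b :: 'a and t :: real
  have [measurable]: "F b \<in> borel_measurable borel" for b unfolding F_def by measurable
  define C where "C = (\<Prod>b\<in>Basis. (\<integral>\<^sup>+t. F b t \<partial>lborel))"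
  have Ffin: "(\<integral>\<^sup>+t. F b t \<partial>lborel) < \<infinity>" for b
    using nn_integral_inverse_sqrt[of "2*R"] R by (cases "b = b0") (simp_all add: F_def ennreal_mult_less_top)
  have "C < \<infinity>" 
  proof -
    have "C = (\<Prod>b\<in>Basis. ennreal (enn2real (\<integral>\<^sup>+t. F b t \<partial>lborel)))"
      unfolding C_def using Ffin by simp
    then show ?thesis by (simp add: prod_ennreal)
  qed
  moreover have "(\<integral>\<^sup>+w. inverse (ennreal (sqrt (norm (z - w)))) * indicator (ball 0 R) w \<partial>lborel) \<le> C"
    if z: "z \<in> ball 0 R" for z :: 'a
  proof -
    have "(\<integral>\<^sup>+w. inverse (ennreal (sqrt (norm (z - w)))) * indicator (ball 0 R) w \<partial>lborel)
      \<le> (\<integral>\<^sup>+w. (\<Prod>b\<in>Basis. F b (z \<bullet> b + (-1) * (w \<bullet> b))) \<partial>lborel)"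
    proof (rule nn_integral_mono)
      fix w :: 'a
      show "inverse (ennreal (sqrt (norm (z - w)))) * indicator (ball 0 R) w \<le> (\<Prod>b\<in>Basis. F b (z \<bullet> b + (-1) * (w \<bullet> b)))"
      proof (cases "w \<in> ball 0 R")
        case True
        have "z \<bullet> b + (-1) * (w \<bullet> b) \<in> {-(2*R)..2*R}" if "b \<in> Basis" for b
        proof -
          have "\<bar>(z - w) \<bullet> b\<bar> \<le> 2 * R"
            using Basis_le_norm[OF that, of "z - w"] norm_triangle_ineq4[of z w] z True by simp
          then show ?thesis by (simp add: inner_diff_left abs_le_iff)
        qed
        then have "(\<Prod>b\<in>Basis. F b (z \<bullet> b + (-1) * (w \<bullet> b))) = (\<Prod>b\<in>Basis. if b = b0 then inverse (ennreal (sqrt \<bar>(z - w) \<bullet> b\<bar>)) else 1)"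
          by (intro prod.cong) (auto simp: F_def inner_diff_left)
        also have "\<dots> = inverse (ennreal (sqrt \<bar>(z - w) \<bullet> b0\<bar>))"
          using b0 by (simp add: prod.delta)
        also have "inverse (ennreal (sqrt (norm (z - w)))) \<le> \<dots>"
        proof (cases "(z - w) \<bullet> b0 = 0")
          case False
          with Basis_le_norm[OF b0, of "z - w"] have "0 < norm (z - w)" by auto
          with False Basis_le_norm[OF b0, of "z - w"] show ?thesis
            by (simp add: inverse_ennreal ennreal_leI le_imp_inverse_le)
        qed simp
        finally show ?thesis using True by simp
      qed simp
    qed
    also have "\<dots> = (\<Prod>b\<in>Basis. (\<integral>\<^sup>+t. F b (z \<bullet> b + (-1) * t) \<partial>lborel))"
      by (rule nn_integral_lborel_prod[where f="\<lambda>b t. F b (z \<bullet> b + (-1) * t)"]) auto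
    also have "\<dots> = C" unfolding C_def
    proof (intro prod.cong refl)
      fix b :: 'a
      show "(\<integral>\<^sup>+t. F b (z \<bullet> b + (-1) * t) \<partial>lborel) = (\<integral>\<^sup>+t. F b t \<partial>lborel)"
        using nn_integral_real_affine[of "F b" "-1" "z \<bullet> b"] by simp
    qed
    finally show ?thesis .
  qed
  ultimately show ?thesis by blast
qed

section \<open>Fourier transforms and Gaussian quadratic forms\<close>

definition fourier :: "('a::euclidean_space \<Rightarrow> real) \<Rightarrow> 'a \<Rightarrow> complex" where
  "fourier f \<xi> = (LINT x|lborel. complex_of_real (f x) * cis (\<xi> \<bullet> x))"

lemma fourier_measurable [measurable]:
  assumes [measurable]: "f \<in> borel_measurable borel"
  shows "fourier f \<in> borel_measurable borel"
  unfolding fourier_def by measurable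

lemma integrable_fourier:
  assumes f: "integrable lborel f"
  shows "integrable lborel (\<lambda>x. complex_of_real (f x) * cis (\<xi> \<bullet> x))"
  by (rule Bochner_Integration.integrable_bound[OF f]) (use f in \<open>auto simp: norm_mult\<close>)

lemma norm_fourier_le:
  assumes f: "integrable lborel f"
  shows "norm (fourier f \<xi>) \<le> (LINT x|lborel. \<bar>f x\<bar>)"
  unfolding fourier_def
  by (rule order_trans[OF integral_norm_bound]) (simp add: norm_mult)

lemma pair_sigma_finite_lborel2:
  "pair_sigma_finite (lborel \<Otimes>\<^sub>M lborel :: ('a::euclidean_space \<times> 'a) measure) (lborel :: 'b::euclidean_space measure)"
  unfolding lborel_prod ..

text \<open>Bilinear rather than quadratic, since it serves twice: with f = g it builds the
  variance, with different arguments it approximates the pairing of f with g.\<close>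

definition gauss_form :: "real \<Rightarrow> ('a::euclidean_space \<Rightarrow> real) \<Rightarrow> ('a \<Rightarrow> real) \<Rightarrow> real" where
  "gauss_form \<sigma> f g = (LINT p|(lborel \<Otimes>\<^sub>M lborel). f (fst p) * g (snd p) * exp (- (\<sigma> * norm (fst p - snd p))\<^sup>2 / 2))"

lemma integrable_pair_real:
  fixes f g :: "'a::euclidean_space \<Rightarrow> real"
  assumes f: "integrable lborel f" and g: "integrable lborel g"
  shows "integrable (lborel \<Otimes>\<^sub>M lborel) (\<lambda>p. f (fst p) * g (snd p))"
    "(LINT p|(lborel \<Otimes>\<^sub>M lborel). f (fst p) * g (snd p)) = (LINT x|lborel. f x) * (LINT y|lborel. g y)"
proof -
  have c: "integrable lborel (\<lambda>x. complex_of_real (f x))" "integrable lborel (\<lambda>x. complex_of_real (g x))"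
    using f g by auto
  have "integrable (lborel \<Otimes>\<^sub>M lborel) (\<lambda>p. Re (complex_of_real (f (fst p)) * complex_of_real (g (snd p))))"
    by (intro integrable_Re lborel_pair.integrable_product_mult[OF c])
  then show "integrable (lborel \<Otimes>\<^sub>M lborel) (\<lambda>p. f (fst p) * g (snd p))" by simp
  have "(LINT p|(lborel \<Otimes>\<^sub>M lborel). complex_of_real (f (fst p) * g (snd p))) = complex_of_real ((LINT x|lborel. f x) * (LINT y|lborel. g y))"
    using lborel_pair.integral_product_mult[OF c] by simp
  then show "(LINT p|(lborel \<Otimes>\<^sub>M lborel). f (fst p) * g (snd p)) = (LINT x|lborel. f x) * (LINT y|lborel. g y)"
    unfolding integral_complex_of_real of_real_eq_iff .
qed

text \<open>The kernel is replaced by its Fourier integral and the integrals are exchanged. The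
  integrable Gaussian weight makes the triple integral absolutely convergent for merely integrable f
  and g; this takes the place of Plancherel's theorem.\<close>

lemma gauss_form_fourier:
  fixes f g :: "'a::euclidean_space \<Rightarrow> real"
  assumes \<sigma>: "0 < \<sigma>" and f: "integrable lborel f" and g: "integrable lborel g"
  shows "complex_of_real (gauss_form \<sigma> f g) = (LINT \<xi>|lborel. complex_of_real (gauss \<sigma> \<xi>) * (fourier f \<xi> * cnj (fourier g \<xi>)))"
    and "integrable lborel (\<lambda>\<xi>. complex_of_real (gauss \<sigma> \<xi>) * (fourier f \<xi> * cnj (fourier g \<xi>)))"
proof -
  interpret PP: pair_sigma_finite "lborel \<Otimes>\<^sub>M lborel :: ('a \<times> 'a) measure" "lborel :: 'a measure"
    by (rule pair_sigma_finite_lborel2)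
  have [measurable]: "f \<in> borel_measurable borel" "g \<in> borel_measurable borel" using f g by auto
  have c: "integrable lborel (\<lambda>x. complex_of_real (f x))" "integrable lborel (\<lambda>x. complex_of_real (g x))"
    using f g by auto
  have cg: "integrable lborel (\<lambda>\<xi>::'a. complex_of_real (gauss \<sigma> \<xi>))" using gauss_integral(1)[OF \<sigma>] by auto
  define F where "F p \<xi> = complex_of_real (f (fst p) * g (snd p)) * (complex_of_real (gauss \<sigma> \<xi>) * cis (\<xi> \<bullet> (fst p - snd p)))"
    for p :: "'a \<times> 'a" and \<xi> :: 'a
  have "integrable ((lborel \<Otimes>\<^sub>M lborel) \<Otimes>\<^sub>M lborel)
      (\<lambda>q. complex_of_real (f (fst (fst q))) * complex_of_real (g (snd (fst q))) * complex_of_real (gauss \<sigma> (snd q :: 'a)))"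
    by (rule PP.integrable_product_mult[OF lborel_pair.integrable_product_mult[OF c] cg])
  then have int: "integrable ((lborel \<Otimes>\<^sub>M lborel) \<Otimes>\<^sub>M lborel) (\<lambda>(p, \<xi>). F p \<xi>)"
    by (rule Bochner_Integration.integrable_bound) (auto simp: F_def norm_mult split_beta')
  have 1: "(LINT \<xi>|lborel. F p \<xi>) = complex_of_real (f (fst p) * g (snd p) * exp (- (\<sigma> * norm (fst p - snd p))\<^sup>2 / 2))" for p
    unfolding F_def integral_mult_right_zero gauss_fourier(1)[OF \<sigma>] by simp
  have 2: "(LINT p|(lborel \<Otimes>\<^sub>M lborel). F p \<xi>) = complex_of_real (gauss \<sigma> \<xi>) * (fourier f \<xi> * cnj (fourier g \<xi>))" for \<xi>
  proof -
    have cnj: "cnj (fourier g \<xi>) = (LINT x|lborel. complex_of_real (g x) * cis (- (\<xi> \<bullet> x)))"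
      unfolding fourier_def by (subst Bochner_Integration.integral_cnj[symmetric]) (simp add: cis_cnj)
    have i: "integrable lborel (\<lambda>x. complex_of_real (g x) * cis (- (\<xi> \<bullet> x)))"
      using integrable_fourier[OF g, of "- \<xi>"] by simp
    have split: "cis (\<xi> \<bullet> (x - y)) = cis (\<xi> \<bullet> x) * cis (- (\<xi> \<bullet> y))" for x y
      by (simp add: inner_diff_right cis_mult)
    have "(LINT p|(lborel \<Otimes>\<^sub>M lborel). F p \<xi>) = (LINT p|(lborel \<Otimes>\<^sub>M lborel). complex_of_real (gauss \<sigma> \<xi>) *
        ((complex_of_real (f (fst p)) * cis (\<xi> \<bullet> fst p)) * (complex_of_real (g (snd p)) * cis (- (\<xi> \<bullet> snd p)))))"
      by (intro Bochner_Integration.integral_cong)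
         (simp_all add: F_def split mult_ac)
    also have "\<dots> = complex_of_real (gauss \<sigma> \<xi>) * (fourier f \<xi> * cnj (fourier g \<xi>))"
      unfolding integral_mult_right_zero lborel_pair.integral_product_mult[OF integrable_fourier[OF f] i] cnj
      by (simp add: fourier_def)
    finally show ?thesis .
  qed
  have "(LINT \<xi>|lborel. LINT p|(lborel \<Otimes>\<^sub>M lborel). F p \<xi>) = (LINT p|(lborel \<Otimes>\<^sub>M lborel). LINT \<xi>|lborel. F p \<xi>)"
    by (rule PP.Fubini_integral[OF int])
  then show "complex_of_real (gauss_form \<sigma> f g) = (LINT \<xi>|lborel. complex_of_real (gauss \<sigma> \<xi>) * (fourier f \<xi> * cnj (fourier g \<xi>)))"
    unfolding 1 2 gauss_form_def integral_complex_of_real ..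
  show "integrable lborel (\<lambda>\<xi>. complex_of_real (gauss \<sigma> \<xi>) * (fourier f \<xi> * cnj (fourier g \<xi>)))"
    using PP.integrable_snd[OF int] unfolding 2 .
qed

lemma test_functionD:
  assumes "g \<in> test_functions"
  shows "continuous_on UNIV g" "integrable lborel g" "g \<in> borel_measurable borel"
    "\<exists>B. \<forall>x. \<bar>g x\<bar> \<le> B" "\<exists>R>0. \<forall>x. x \<notin> ball 0 R \<longrightarrow> g x = 0"
proof -
  show c: "continuous_on UNIV g" using assms by (simp add: test_functions_def smooth_continuous)
  show "integrable lborel g" by (rule test_function_integrable[OF assms])
  show "g \<in> borel_measurable borel" using c by (rule borel_measurable_continuous_onI)
  show "\<exists>B. \<forall>x. \<bar>g x\<bar> \<le> B"
    using iter_partial_bounded[OF assms, of "[]"] by (auto simp: bdd_above_def)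
  have "bounded (supp g)" using assms by (auto simp: test_functions_def compact_imp_bounded)
  then obtain R where R: "0 < R" "supp g \<subseteq> ball 0 R" using bounded_subset_ballD by blast
  moreover have "g x = 0" if "x \<notin> ball 0 R" for x
  proof -
    have "x \<notin> supp g" using that R(2) by blast
    from iter_partial_outside_supp[OF this, of "[]"] show ?thesis by simp
  qed
  ultimately show "\<exists>R>0. \<forall>x. x \<notin> ball 0 R \<longrightarrow> g x = 0" by blast
qed

lemma AE_off_diagonal: "AE p in (lborel \<Otimes>\<^sub>M lborel :: ('a::euclidean_space \<times> 'a) measure). fst p \<noteq> snd p"
proof (rule lborel_pair.AE_pair_measure)
  show "{p \<in> space (lborel \<Otimes>\<^sub>M lborel). fst p \<noteq> snd p} \<in> sets (lborel \<Otimes>\<^sub>M lborel :: ('a \<times> 'a) measure)"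
    by measurable
qed (use AE_lborel_singleton in \<open>auto simp: eq_commute\<close>)

text \<open>Absolute convergence of the double integral. Together with the absolute Frullani
  integral |ln r| it justifies exchanging the \<sigma>-integral with the integral over both
  points.\<close>

lemma integrable_log_kernel:
  fixes g :: "'a::euclidean_space \<Rightarrow> real"
  assumes g: "g \<in> test_functions"
  shows "integrable (lborel \<Otimes>\<^sub>M lborel) (\<lambda>p. g (fst p) * g (snd p) * ln (norm (fst p - snd p)))"
proof -
  note [measurable] = test_functionD(3)[OF g]
  obtain B where B: "\<And>x. \<bar>g x\<bar> \<le> B" using test_functionD(4)[OF g] by blast
  then have B0: "0 \<le> B" using abs_ge_zero order_trans by blast
  obtain R where R: "0 < R" "\<And>x. x \<notin> ball 0 R \<Longrightarrow> g x = 0" using test_functionD(5)[OF g] by blast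
  obtain C where C: "C < \<infinity>" "\<And>z. z \<in> ball (0::'a) R \<Longrightarrow>
      (\<integral>\<^sup>+w. inverse (ennreal (sqrt (norm (z - w)))) * indicator (ball 0 R) w \<partial>lborel) \<le> C"
    using nn_integral_local_inverse_sqrt_norm[of R] R(1) by force
  have [measurable]: "ball (0::'a) R \<in> sets borel" by simp
  define H where "H z w = ennreal (2 * R) * indicator (ball 0 R) w
      + 2 * (inverse (ennreal (sqrt (norm (z - w)))) * indicator (ball 0 R) w)" for z w :: 'a
  have [measurable]: "H z \<in> borel_measurable borel" for z unfolding H_def by measurable
  have pt: "ennreal (norm (g z * g w * ln (norm (z - w)))) \<le> ennreal (B * B) * indicator (ball 0 R) z * H z w" for z w
  proof (cases "z \<in> ball 0 R \<and> w \<in> ball 0 R \<and> z \<noteq> w")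
    case True
    define r where "r = norm (z - w)"
    have r: "0 < r" "r \<le> 2 * R"
      using True norm_triangle_ineq4[of z w] by (auto simp: r_def)
    have "norm (g z * g w * ln r) \<le> B * B * (2 * R + 2 / sqrt r)"
      unfolding real_norm_def abs_mult using B B0 abs_ln_le[OF r(1)] r by (intro mult_mono) auto
    then have "ennreal (norm (g z * g w * ln r)) \<le> ennreal (B * B * (2 * R + 2 / sqrt r))"
      by (rule ennreal_leI)
    also have "\<dots> = ennreal (B * B) * (ennreal (2 * R) + 2 * inverse (ennreal (sqrt r)))"
      using r R B0 by (simp add: ennreal_mult inverse_ennreal divide_inverse)
    finally show ?thesis using True by (simp add: H_def r_def)
  qed (use R(2) in auto)
  have bd: "(\<integral>\<^sup>+w. H z w \<partial>lborel) \<le> ennreal (2 * R) * emeasure lborel (ball (0::'a) R) + 2 * C" if "z \<in> ball 0 R" for z :: 'a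
    unfolding H_def using C(2)[OF that]
    by (subst nn_integral_add) (auto simp: nn_integral_cmult intro!: add_left_mono mult_left_mono)
  have fin: "emeasure lborel (ball (0::'a) R) < \<infinity>" using emeasure_bounded_finite[of "ball (0::'a) R"] by simp
  show ?thesis
  proof (rule integrableI_bounded)
    have "(\<integral>\<^sup>+p. ennreal (norm (g (fst p) * g (snd p) * ln (norm (fst p - snd p)))) \<partial>(lborel \<Otimes>\<^sub>M lborel))
      = (\<integral>\<^sup>+z. \<integral>\<^sup>+w. ennreal (norm (g z * g w * ln (norm (z - w)))) \<partial>lborel \<partial>lborel)"
      by (subst lborel.nn_integral_fst[symmetric]) auto
    also have "\<dots> \<le> (\<integral>\<^sup>+z. ennreal (B * B) * (ennreal (2 * R) * emeasure lborel (ball (0::'a) R) + 2 * C) * indicator (ball (0::'a) R) z \<partial>lborel)"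
    proof (rule nn_integral_mono)
      fix z :: 'a
      have "(\<integral>\<^sup>+w. ennreal (norm (g z * g w * ln (norm (z - w)))) \<partial>lborel)
        \<le> (\<integral>\<^sup>+w. ennreal (B * B) * indicator (ball 0 R) z * H z w \<partial>lborel)"
        by (intro nn_integral_mono pt)
      also have "\<dots> = ennreal (B * B) * indicator (ball 0 R) z * (\<integral>\<^sup>+w. H z w \<partial>lborel)"
        by (rule nn_integral_cmult) measurable
      also have "\<dots> \<le> ennreal (B * B) * (ennreal (2 * R) * emeasure lborel (ball (0::'a) R) + 2 * C) * indicator (ball 0 R) z"
        using bd by (cases "z \<in> ball 0 R") (auto intro!: mult_left_mono)
      finally show "(\<integral>\<^sup>+w. ennreal (norm (g z * g w * ln (norm (z - w)))) \<partial>lborel) \<le> \<dots>" .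
    qed
    also have "\<dots> = ennreal (B * B) * (ennreal (2 * R) * emeasure lborel (ball (0::'a) R) + 2 * C) * emeasure lborel (ball (0::'a) R)"
      by (rule nn_integral_cmult_indicator) auto
    also have "\<dots> < \<infinity>" using fin C(1) by (auto simp: ennreal_mult_less_top)
    finally show "(\<integral>\<^sup>+p. ennreal (norm (g (fst p) * g (snd p) * ln (norm (fst p - snd p)))) \<partial>(lborel \<Otimes>\<^sub>M lborel)) < \<infinity>" .
  qed measurable
qed

text \<open>Frullani's formula is inserted for the logarithm off the diagonal. The subtracted exp
  (-\<sigma>^2 / 2) does not depend on the two points, so its contribution is a multiple of the
  squared integral of g, which vanishes.\<close>

lemma log_variance_gauss_form:
  fixes g :: "'a::euclidean_space \<Rightarrow> real"
  assumes g: "g \<in> mean_zero_test_functions"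
  shows "log_variance g = (LINT \<sigma>|lborel. indicator {0..} \<sigma> / \<sigma> * gauss_form \<sigma> g g)"
    and "integrable lborel (\<lambda>\<sigma>. indicator {0..} \<sigma> / \<sigma> * gauss_form \<sigma> g g)"
proof -
  interpret PP: pair_sigma_finite "lborel \<Otimes>\<^sub>M lborel :: ('a \<times> 'a) measure" "lborel :: real measure"
    by (rule pair_sigma_finite_lborel2)
  have gt: "g \<in> test_functions" and g0: "(LINT x|lborel. g x) = 0" using g by (auto simp: mean_zero_test_functions_def)
  note [measurable] = test_functionD(3)[OF gt]
  note gi = test_functionD(2)[OF gt]
  define F where "F p \<sigma> = g (fst p) * g (snd p) * frullani (norm (fst p - snd p)) \<sigma>" for p :: "'a \<times> 'a" and \<sigma>
  have fr [measurable]: "(\<lambda>q. frullani (norm (fst (fst q) - snd (fst q) :: 'a)) (snd q)) \<in> borel_measurable ((lborel \<Otimes>\<^sub>M lborel) \<Otimes>\<^sub>M lborel)"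
    by (rule measurable_compose[OF _ frullani_measurable, of "\<lambda>q. (norm (fst (fst q) - snd (fst q)), snd q)", simplified]) measurable
  have mF [measurable]: "(\<lambda>(p, \<sigma>). F p \<sigma>) \<in> borel_measurable ((lborel \<Otimes>\<^sub>M lborel) \<Otimes>\<^sub>M lborel)"
    unfolding F_def split_beta' by measurable
  have nF: "\<bar>F p \<sigma>\<bar> = \<bar>g (fst p) * g (snd p)\<bar> * \<bar>frullani (norm (fst p - snd p)) \<sigma>\<bar>" for p \<sigma>
    by (simp add: F_def abs_mult)
  have int: "integrable ((lborel \<Otimes>\<^sub>M lborel) \<Otimes>\<^sub>M lborel) (\<lambda>(p, \<sigma>). F p \<sigma>)"
  proof (rule PP.Fubini_integrable[OF mF])
    have ae: "AE p in lborel \<Otimes>\<^sub>M lborel. norm (g (fst p) * g (snd p) * ln (norm (fst p - snd p))) =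
        (LINT \<sigma>|lborel. norm (case (p, \<sigma>) of (p, \<sigma>) \<Rightarrow> F p \<sigma>))"
      using AE_off_diagonal
    proof eventually_elim
      case (elim p)
      then show ?case by (simp add: nF frullani_integral(3) abs_mult)
    qed
    have m2: "(\<lambda>p. LINT \<sigma>|lborel. norm (case (p, \<sigma>) of (p, \<sigma>) \<Rightarrow> F p \<sigma>)) \<in> borel_measurable (lborel \<Otimes>\<^sub>M lborel)"
      using mF by measurable
    show "integrable (lborel \<Otimes>\<^sub>M lborel) (\<lambda>p. LINT \<sigma>|lborel. norm (case (p, \<sigma>) of (p, \<sigma>) \<Rightarrow> F p \<sigma>))"
      by (rule integrable_cong_AE_imp[OF integrable_norm[OF integrable_log_kernel[OF gt]] m2 ae])
    show "AE p in lborel \<Otimes>\<^sub>M lborel. integrable lborel (\<lambda>\<sigma>. case (p, \<sigma>) of (p, \<sigma>) \<Rightarrow> F p \<sigma>)"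
      using AE_off_diagonal by eventually_elim (auto simp: F_def intro!: integrable_mult_right frullani_integral(1))
  qed
  have inner: "(LINT p|(lborel \<Otimes>\<^sub>M lborel). F p \<sigma>) = indicator {0..} \<sigma> / \<sigma> * gauss_form \<sigma> g g" for \<sigma>
  proof -
    have i1: "integrable (lborel \<Otimes>\<^sub>M lborel) (\<lambda>p. g (fst p) * g (snd p) * exp (- (\<sigma> * norm (fst p - snd p))\<^sup>2 / 2))"
      by (rule Bochner_Integration.integrable_bound[OF integrable_pair_real(1)[OF gi gi]]) (auto simp: abs_mult mult_left_le)
    have "(LINT p|(lborel \<Otimes>\<^sub>M lborel). F p \<sigma>) = (LINT p|(lborel \<Otimes>\<^sub>M lborel). indicator {0..} \<sigma> / \<sigma> *
        (g (fst p) * g (snd p) * exp (- (\<sigma> * norm (fst p - snd p))\<^sup>2 / 2) - exp (- \<sigma>\<^sup>2 / 2) * (g (fst p) * g (snd p))))"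
      by (intro Bochner_Integration.integral_cong) (auto simp: F_def frullani_def algebra_simps diff_divide_distrib)
    also have "\<dots> = indicator {0..} \<sigma> / \<sigma> * (gauss_form \<sigma> g g - exp (- \<sigma>\<^sup>2 / 2) * (LINT p|(lborel \<Otimes>\<^sub>M lborel). g (fst p) * g (snd p)))"
      unfolding integral_mult_right_zero gauss_form_def
      by (subst Bochner_Integration.integral_diff[OF i1 integrable_mult_right[OF integrable_pair_real(1)[OF gi gi]]]) simp
    finally show ?thesis using g0 by (simp add: integrable_pair_real(2)[OF gi gi])
  qed
  have lk: "integrable (lborel \<Otimes>\<^sub>M lborel) (\<lambda>p. g (fst p) * g (snd p) * ln (1 / norm (fst p - snd p)))"
  proof -
    have "ln (1 / norm (fst p - snd p)) = - ln (norm (fst p - snd p))" for p :: "'a \<times> 'a"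
      by (cases "fst p = snd p") (auto simp: ln_div)
    then show ?thesis using integrable_log_kernel[OF gt] by simp
  qed
  have "log_variance g = (LINT p|(lborel \<Otimes>\<^sub>M lborel). g (fst p) * g (snd p) * ln (1 / norm (fst p - snd p)))"
    using lborel_pair.integral_fst'[OF lk] by (simp add: log_variance_def)
  also have "\<dots> = (LINT p|(lborel \<Otimes>\<^sub>M lborel). LINT \<sigma>|lborel. F p \<sigma>)"
  proof (rule integral_cong_AE)
    show "AE p in lborel \<Otimes>\<^sub>M lborel. g (fst p) * g (snd p) * ln (1 / norm (fst p - snd p)) = (LINT \<sigma>|lborel. F p \<sigma>)"
      using AE_off_diagonal
    proof eventually_elim
      case (elim p)
      then show ?case by (simp add: F_def frullani_integral(2))
    qed
    show "(\<lambda>p. LINT \<sigma>|lborel. F p \<sigma>) \<in> borel_measurable (lborel \<Otimes>\<^sub>M lborel)"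
      using mF by measurable
  qed measurable
  also have "\<dots> = (LINT \<sigma>|lborel. LINT p|(lborel \<Otimes>\<^sub>M lborel). F p \<sigma>)"
    by (rule PP.Fubini_integral[OF int, symmetric])
  finally show "log_variance g = (LINT \<sigma>|lborel. indicator {0..} \<sigma> / \<sigma> * gauss_form \<sigma> g g)"
    unfolding inner .
  show "integrable lborel (\<lambda>\<sigma>. indicator {0..} \<sigma> / \<sigma> * gauss_form \<sigma> g g)"
    using PP.integrable_snd[OF int] unfolding inner .
qed

section \<open>The Gaussian approximate identity\<close>

lemma lborel_integral_affine:
  fixes F :: "'a::euclidean_space \<Rightarrow> real"
  assumes c: "0 < c" and [measurable]: "F \<in> borel_measurable borel"
  shows "(LINT x|lborel. F x) = c ^ DIM('a) * (LINT x|lborel. F (t + c *\<^sub>R x))"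
proof -
  have "(LINT x|lborel. F x) = (LINT x|density (distr lborel borel (\<lambda>x. t + c *\<^sub>R x)) (\<lambda>_. ennreal (c ^ DIM('a))). F x)"
    using c by (subst lborel_affine[of c t]) auto
  then show ?thesis using c by (simp add: integral_density integral_distr)
qed

text \<open>Takes the place of Fourier inversion: up to a factor, each term is a
  \<open>gauss_form\<close>, for which the Fourier representation is known. The substitution z = w +
  u / (m + 1) fixes the Gaussian and moves the scale into f; dominated convergence in u and then in
  w uses that f is continuous and bounded.\<close>

lemma gauss_convolution_tendsto:
  fixes f g :: "'a::euclidean_space \<Rightarrow> real"
  assumes f: "f \<in> test_functions" and g: "g \<in> test_functions"
  shows "(\<lambda>m. LINT p|(lborel \<Otimes>\<^sub>M lborel). f (fst p) * g (snd p) * gauss (1 / real (Suc m)) (fst p - snd p))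
    \<longlonglongrightarrow> (LINT x|lborel. f x * g x)"
proof -
  note [measurable] = test_functionD(3)[OF f] test_functionD(3)[OF g]
  note fi = test_functionD(2)[OF f] and gi = test_functionD(2)[OF g]
  obtain B where B: "\<And>x. \<bar>f x\<bar> \<le> B" using test_functionD(4)[OF f] by blast
  then have B0: "0 \<le> B" using abs_ge_zero order_trans by blast
  define I where "I m w = (LINT u|lborel. f (w + (1 / real (Suc m)) *\<^sub>R u) * gauss 1 u)" for m w
  have [measurable]: "I m \<in> borel_measurable borel" for m unfolding I_def by measurable
  have g1: "integrable lborel (\<lambda>u::'a. B * gauss 1 u)" "(LINT u|lborel. B * gauss 1 (u::'a)) = B"
    using gauss_integral[where 'a='a, of 1] by auto
  have bd: "norm (f x * gauss 1 (u::'a)) \<le> B * gauss 1 u" for x u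
    using B gauss_nonneg[of 1 u] by (simp add: abs_mult mult_right_mono)
  have I_int: "integrable lborel (\<lambda>u. f (w + (1 / real (Suc m)) *\<^sub>R u) * gauss 1 u)" for m w
    by (rule Bochner_Integration.integrable_bound[OF g1(1)])
       (use B B0 in \<open>auto simp: gauss_nonneg abs_mult mult_right_mono\<close>)
  have I_bd: "\<bar>I m w\<bar> \<le> B" for m w
  proof -
    have "\<bar>I m w\<bar> \<le> (LINT u|lborel. B * gauss 1 (u::'a))"
      unfolding I_def real_norm_def[symmetric]
      by (intro order_trans[OF integral_norm_bound] integral_mono integrable_norm I_int g1 bd)
    then show ?thesis unfolding g1(2) .
  qed
  have I_lim: "(\<lambda>m. I m w) \<longlonglongrightarrow> f w" for w
  proof -
    have "(\<lambda>m. I m w) \<longlonglongrightarrow> (LINT u|lborel. f w * gauss 1 (u::'a))"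
      unfolding I_def
    proof (rule integral_dominated_convergence[OF _ _ g1(1)])
      show "AE u in lborel. (\<lambda>m. f (w + (1 / real (Suc m)) *\<^sub>R u) * gauss 1 u) \<longlonglongrightarrow> f w * gauss 1 u"
      proof (intro AE_I2 tendsto_mult tendsto_const)
        fix u :: 'a
        have "(\<lambda>m. w + (1 / real (Suc m)) *\<^sub>R u) \<longlonglongrightarrow> w + 0 *\<^sub>R u"
          by (intro tendsto_intros LIMSEQ_Suc lim_1_over_n)
        then show "(\<lambda>m. f (w + (1 / real (Suc m)) *\<^sub>R u)) \<longlonglongrightarrow> f w"
          using test_functionD(1)[OF f] by (intro isCont_tendsto_compose[of _ f]) (auto simp: continuous_on_eq_continuous_at)
      qed
      show "AE u in lborel. norm (f (w + (1 / real (Suc m)) *\<^sub>R u) * gauss 1 u) \<le> B * gauss 1 u" for m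
        using bd by (intro AE_I2)
    qed measurable
    then show ?thesis using gauss_integral(2)[where 'a='a, of 1] by simp
  qed
  have eq: "(LINT p|(lborel \<Otimes>\<^sub>M lborel). f (fst p) * g (snd p) * gauss (1 / real (Suc m)) (fst p - snd p)) = (LINT w|lborel. g w * I m w)" for m
  proof -
    define s where "s = 1 / real (Suc m)"
    have s: "0 < s" by (simp add: s_def)
    define K where "K = (1 / (sqrt (2 * pi) * s)) ^ DIM('a)"
    have K: "0 \<le> K" using s by (simp add: K_def)
    have gK: "\<bar>gauss s x\<bar> \<le> K" for x :: 'a
      unfolding gauss_eq[OF s] K_def[symmetric] using K by (simp add: abs_mult mult_left_le)
    have int: "integrable (lborel \<Otimes>\<^sub>M lborel) (\<lambda>(z, w). f z * g w * gauss s (z - w))"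
    proof (rule Bochner_Integration.integrable_bound)
      show "integrable (lborel \<Otimes>\<^sub>M lborel) (\<lambda>p. K * (f (fst p) * g (snd p)))"
        by (intro integrable_mult_right integrable_pair_real(1)[OF fi gi])
      show "AE p in lborel \<Otimes>\<^sub>M lborel. norm (case p of (z, w) \<Rightarrow> f z * g w * gauss s (z - w)) \<le> norm (K * (f (fst p) * g (snd p)))"
        using gK K by (intro AE_I2) (auto simp: split_beta' abs_mult mult.commute[of K] intro!: mult_left_mono)
    qed measurable
    have "(LINT p|(lborel \<Otimes>\<^sub>M lborel). f (fst p) * g (snd p) * gauss s (fst p - snd p)) =
        (LINT w|lborel. LINT z|lborel. f z * g w * gauss s (z - w))"
      using lborel_pair.integral_snd[OF int] by (simp add: split_beta')
    also have "\<dots> = (LINT w|lborel. g w * I m w)"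
    proof (intro Bochner_Integration.integral_cong refl)
      fix w :: 'a
      have "(LINT z|lborel. f z * g w * gauss s (z - w)) = s ^ DIM('a) * (LINT u|lborel. f (w + s *\<^sub>R u) * g w * gauss s (w + s *\<^sub>R u - w))"
        by (rule lborel_integral_affine[OF s]) measurable
      also have "\<dots> = (LINT u|lborel. s ^ DIM('a) * (f (w + s *\<^sub>R u) * g w * gauss s (w + s *\<^sub>R u - w)))"
        by simp
      also have "\<dots> = (LINT u|lborel. g w * (f (w + s *\<^sub>R u) * gauss 1 u))"
      proof (intro Bochner_Integration.integral_cong refl)
        fix u :: 'a
        have "s ^ DIM('a) * gauss s (s *\<^sub>R u) = gauss 1 u"
          using s by (simp add: gauss_eq power_divide power_mult_distrib)
        then show "s ^ DIM('a) * (f (w + s *\<^sub>R u) * g w * gauss s (w + s *\<^sub>R u - w)) = g w * (f (w + s *\<^sub>R u) * gauss 1 u)"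
          by (simp add: mult_ac)
      qed
      finally show "(LINT z|lborel. f z * g w * gauss s (z - w)) = g w * I m w"
        by (simp add: I_def s_def)
    qed
    finally show ?thesis by (simp add: s_def)
  qed
  have "(\<lambda>m. LINT w|lborel. g w * I m w) \<longlonglongrightarrow> (LINT w|lborel. g w * f w)"
  proof (rule integral_dominated_convergence)
    show "integrable lborel (\<lambda>w. B * \<bar>g w\<bar>)" using gi by auto
    show "AE w in lborel. (\<lambda>m. g w * I m w) \<longlonglongrightarrow> g w * f w"
      by (intro AE_I2 tendsto_mult tendsto_const I_lim)
    show "AE w in lborel. norm (g w * I m w) \<le> B * \<bar>g w\<bar>" for m
      using I_bd by (auto simp: abs_mult mult.commute[of B] intro!: mult_left_mono)
  qed measurable
  then show ?thesis unfolding eq by (simp add: mult.commute)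
qed

section \<open>Decay of Fourier transforms of test functions\<close>

lemma iter_partial_append: "iter_partial bs (iter_partial cs g) = iter_partial (bs @ cs) g"
  by (induction bs) simp_all

lemma test_function_partial:
  assumes g: "g \<in> test_functions" and b: "b \<in> Basis"
  shows "iter_partial [b] g \<in> test_functions"
proof -
  have "smooth (iter_partial [b] g)"
    unfolding smooth_def iter_partial_append using g b by (auto simp: test_functions_def smooth_def)
  moreover have "supp (iter_partial [b] g) \<subseteq> supp g"
    unfolding supp_def[of "iter_partial [b] g"]
    by (rule closure_minimal) (use iter_partial_outside_supp[of _ g "[b]"] in \<open>auto simp: supp_def\<close>)
  ultimately show ?thesis
    using g by (auto simp: test_functions_def intro: compact_supp_subset)
qed

lemma test_function_line_derivative:
  assumes g: "g \<in> test_functions"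
  shows "((\<lambda>t. g (x + t *\<^sub>R b)) has_real_derivative iter_partial [b] g (x + t *\<^sub>R b)) (at t)"
proof -
  have "iter_partial [] g differentiable at (x + t *\<^sub>R b)"
    using g by (simp add: test_functions_def smooth_def del: iter_partial.simps)
  then have d: "(g has_derivative frechet_derivative g (at (x + t *\<^sub>R b))) (at (x + t *\<^sub>R b))"
    by (simp add: frechet_derivative_works)
  have l: "((\<lambda>t. x + t *\<^sub>R b) has_derivative (\<lambda>h. h *\<^sub>R b)) (at t)"
    by (auto intro!: derivative_eq_intros)
  have "((\<lambda>t. g (x + t *\<^sub>R b)) has_derivative (\<lambda>h. frechet_derivative g (at (x + t *\<^sub>R b)) (h *\<^sub>R b))) (at t)"
    using has_derivative_compose[OF l d] .
  moreover have "(\<lambda>h. frechet_derivative g (at (x + t *\<^sub>R b)) (h *\<^sub>R b)) = (*) (iter_partial [b] g (x + t *\<^sub>R b))"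
    using linear_scale[OF has_derivative_linear[OF d]] by (simp add: fun_eq_iff mult.commute)
  ultimately show ?thesis by (simp add: has_field_derivative_def)
qed

lemma lborel_integral_shift:
  fixes H :: "'a::euclidean_space \<Rightarrow> 'b::{banach, second_countable_topology}"
  assumes [measurable]: "H \<in> borel_measurable borel"
  shows "(LINT x|lborel. H (c + x)) = (LINT x|lborel. H x)"
proof -
  have "(LINT x|lborel. H x) = (LINT x|distr lborel borel ((+) c). H x)" by (simp add: lborel_distr_plus)
  also have "\<dots> = (LINT x|lborel. H (c + x))" by (subst integral_distr) auto
  finally show ?thesis ..
qed

lemma inverse_Suc_at_0: "filterlim (\<lambda>m. 1 / real (Suc m)) (at 0) sequentially"
  using LIMSEQ_Suc[OF lim_1_over_n[where 'a=real]] by (simp add: filterlim_at)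

text \<open>Difference quotients take the place of integration by parts. Translating g multiplies
  its transform by a character, so the transform of the quotient is explicit; its limit is a complex
  derivative of exp at 0 on one side and dominated convergence on the other.\<close>

lemma fourier_partial:
  fixes g :: "'a::euclidean_space \<Rightarrow> real"
  assumes g: "g \<in> test_functions" and b: "b \<in> Basis"
  shows "fourier (iter_partial [b] g) \<xi> = - \<i> * complex_of_real (\<xi> \<bullet> b) * fourier g \<xi>"
proof -
  let ?g' = "iter_partial [b] g"
  note g' = test_function_partial[OF g b]
  note [measurable] = test_functionD(3)[OF g] test_functionD(3)[OF g']
  note gi = test_functionD(2)[OF g]
  obtain B where B: "\<And>x. \<bar>?g' x\<bar> \<le> B" using test_functionD(4)[OF g'] by blast
  obtain R where R: "0 < R" "\<And>x. x \<notin> ball 0 R \<Longrightarrow> g x = 0" using test_functionD(5)[OF g] by blast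
  define s where "s m = 1 / real (Suc m)" for m
  have s: "0 < s m" "s m \<le> 1" for m by (auto simp: s_def)
  define D where "D m x = (g (x + s m *\<^sub>R b) - g x) / s m" for m x
  have [measurable]: "D m \<in> borel_measurable borel" for m unfolding D_def by measurable
  have D_lim: "(\<lambda>m. D m x) \<longlonglongrightarrow> ?g' x" for x
  proof -
    have "((\<lambda>h. (g (x + (0 + h) *\<^sub>R b) - g (x + 0 *\<^sub>R b)) / h) \<longlongrightarrow> ?g' (x + 0 *\<^sub>R b)) (at 0)"
      using test_function_line_derivative[OF g, of x b 0] unfolding DERIV_def .
    from filterlim_compose[OF this inverse_Suc_at_0] show ?thesis by (simp add: D_def s_def)
  qed
  \<comment> \<open>The mean value theorem bounds the quotient by the supremum of the partial
    derivative. The steps are at most 1, so all quotients vanish outside the ball enlarged by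
    1.\<close>
  have D_bd: "\<bar>D m x\<bar> \<le> B * indicator (ball 0 (R + 1)) x" for m x
  proof (cases "x \<in> ball 0 (R + 1)")
    case True
    have "\<exists>z. 0 < z \<and> z < s m \<and> g (x + s m *\<^sub>R b) - g (x + 0 *\<^sub>R b) = (s m - 0) * ?g' (x + z *\<^sub>R b)"
      by (rule MVT2[OF s(1)]) (rule test_function_line_derivative[OF g])
    then obtain z where "g (x + s m *\<^sub>R b) - g x = s m * ?g' (x + z *\<^sub>R b)" by auto
    then have "D m x = ?g' (x + z *\<^sub>R b)" using s[of m] by (simp add: D_def)
    then show ?thesis using B True by simp
  next
    case False
    have "norm x \<le> norm (x + s m *\<^sub>R b) + norm (s m *\<^sub>R b)" using norm_triangle_ineq4[of "x + s m *\<^sub>R b" "s m *\<^sub>R b"] by simp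
    then have "g x = 0" "g (x + s m *\<^sub>R b) = 0" using False s[of m] b by (auto intro!: R(2))
    then show ?thesis using False by (simp add: D_def)
  qed
  have int_ind: "integrable lborel (\<lambda>x. B * indicator (ball (0::'a) (R + 1)) x)"
    using emeasure_bounded_finite[of "ball (0::'a) (R+1)"] by (intro integrable_mult_right integrable_real_indicator) auto
  have lim1: "(\<lambda>m. LINT x|lborel. complex_of_real (D m x) * cis (\<xi> \<bullet> x)) \<longlonglongrightarrow> fourier ?g' \<xi>"
    unfolding fourier_def
  proof (rule integral_dominated_convergence[OF _ _ int_ind])
    show "AE x in lborel. (\<lambda>m. complex_of_real (D m x) * cis (\<xi> \<bullet> x)) \<longlonglongrightarrow> complex_of_real (?g' x) * cis (\<xi> \<bullet> x)"
      by (intro AE_I2 tendsto_mult tendsto_const tendsto_of_real D_lim)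
    show "AE x in lborel. norm (complex_of_real (D m x) * cis (\<xi> \<bullet> x)) \<le> B * indicator (ball 0 (R + 1)) x" for m
      using D_bd by (auto simp: norm_mult)
  qed measurable
  let ?c = "- \<i> * complex_of_real (\<xi> \<bullet> b)"
  have eq: "(LINT x|lborel. complex_of_real (D m x) * cis (\<xi> \<bullet> x)) =
      (exp (?c * (0 + complex_of_real (s m))) - exp (?c * 0)) / complex_of_real (s m) * fourier g \<xi>" for m
  proof -
    let ?H = "\<lambda>y. complex_of_real (g y) * cis (\<xi> \<bullet> (y - s m *\<^sub>R b))"
    have H: "?H y = cis (- (s m * (\<xi> \<bullet> b))) * (complex_of_real (g y) * cis (\<xi> \<bullet> y))" for y
      by (simp add: inner_diff_right cis_mult)
    have Hi: "integrable lborel ?H" unfolding H by (intro integrable_mult_right integrable_fourier gi)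
    have "(LINT x|lborel. complex_of_real (g (x + s m *\<^sub>R b)) * cis (\<xi> \<bullet> x)) = (LINT x|lborel. ?H (s m *\<^sub>R b + x))"
      by (simp add: add.commute)
    also have "\<dots> = (LINT x|lborel. ?H x)" by (rule lborel_integral_shift) measurable
    also have "\<dots> = cis (- (s m * (\<xi> \<bullet> b))) * fourier g \<xi>" unfolding H by (simp add: fourier_def)
    finally have 1: "(LINT x|lborel. complex_of_real (g (x + s m *\<^sub>R b)) * cis (\<xi> \<bullet> x)) = cis (- (s m * (\<xi> \<bullet> b))) * fourier g \<xi>" .
    have Hi': "integrable lborel (\<lambda>x. complex_of_real (g (x + s m *\<^sub>R b)) * cis (\<xi> \<bullet> x))"
    proof -
      have "integrable (distr lborel borel ((+) (s m *\<^sub>R b))) ?H" using Hi by (simp add: lborel_distr_plus)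
      then show ?thesis by (subst (asm) integrable_distr_eq) (auto simp: add.commute)
    qed
    have "(LINT x|lborel. complex_of_real (D m x) * cis (\<xi> \<bullet> x)) =
      (LINT x|lborel. (1 / complex_of_real (s m)) * (complex_of_real (g (x + s m *\<^sub>R b)) * cis (\<xi> \<bullet> x) - complex_of_real (g x) * cis (\<xi> \<bullet> x)))"
      by (intro Bochner_Integration.integral_cong) (simp_all add: D_def algebra_simps diff_divide_distrib)
    also have "\<dots> = (1 / complex_of_real (s m)) * (cis (- (s m * (\<xi> \<bullet> b))) * fourier g \<xi> - fourier g \<xi>)"
      unfolding integral_mult_right_zero
      by (subst Bochner_Integration.integral_diff[OF Hi' integrable_fourier[OF gi]]) (simp add: 1 fourier_def)
    also have "cis (- (s m * (\<xi> \<bullet> b))) = exp (?c * (0 + complex_of_real (s m)))"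
      by (simp add: cis_conv_exp mult_ac)
    finally show ?thesis by (simp add: algebra_simps diff_divide_distrib)
  qed
  have "((\<lambda>z. exp (?c * z)) has_field_derivative ?c) (at 0)"
    by (auto intro!: derivative_eq_intros)
  then have "((\<lambda>h. (exp (?c * (0 + h)) - exp (?c * 0)) / h) \<longlongrightarrow> ?c) (at 0)" unfolding DERIV_def .
  moreover have "filterlim (\<lambda>m. complex_of_real (s m)) (at 0) sequentially"
  proof -
    have "(\<lambda>m. complex_of_real (s m)) \<longlonglongrightarrow> of_real 0"
      unfolding s_def by (intro tendsto_of_real LIMSEQ_Suc[OF lim_1_over_n])
    then show ?thesis using s(1) by (simp add: filterlim_at less_imp_neq[symmetric])
  qed
  ultimately have "(\<lambda>m. (exp (?c * (0 + complex_of_real (s m))) - exp (?c * 0)) / complex_of_real (s m)) \<longlonglongrightarrow> ?c"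
    by (rule filterlim_compose)
  then have "(\<lambda>m. LINT x|lborel. complex_of_real (D m x) * cis (\<xi> \<bullet> x)) \<longlonglongrightarrow> ?c * fourier g \<xi>"
    unfolding eq by (intro tendsto_mult tendsto_const)
  with lim1 show ?thesis by (rule LIMSEQ_unique)
qed

lemma fourier_combine:
  assumes f: "integrable lborel f" and g: "integrable lborel g"
  shows "fourier (\<lambda>x. a * f x + c * g x) \<xi> = complex_of_real a * fourier f \<xi> + complex_of_real c * fourier g \<xi>"
proof -
  have "fourier (\<lambda>x. a * f x + c * g x) \<xi> = (LINT x|lborel. complex_of_real a * (complex_of_real (f x) * cis (\<xi> \<bullet> x))
      + complex_of_real c * (complex_of_real (g x) * cis (\<xi> \<bullet> x)))"
    unfolding fourier_def by (intro Bochner_Integration.integral_cong) (simp_all add: algebra_simps)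
  also have "\<dots> = complex_of_real a * fourier f \<xi> + complex_of_real c * fourier g \<xi>"
    unfolding fourier_def
    by (subst Bochner_Integration.integral_add[OF integrable_mult_right[OF integrable_fourier[OF f]] integrable_mult_right[OF integrable_fourier[OF g]]]) simp
  finally show ?thesis .
qed

text \<open>The witness is g minus its second derivative along b. Multiplication by the weight stays
  within transforms of test functions, so decay follows from the trivial bound on a
  transform.\<close>

lemma fourier_weight:
  assumes g: "g \<in> test_functions" and b: "b \<in> Basis"
  shows "\<exists>F\<in>test_functions. \<forall>\<xi>. fourier F \<xi> = complex_of_real (1 + (\<xi> \<bullet> b)\<^sup>2) * fourier g \<xi>"
proof -
  let ?g' = "iter_partial [b] g" and ?g'' = "iter_partial [b] (iter_partial [b] g)"
  have t: "?g' \<in> test_functions" "?g'' \<in> test_functions" using g b by (intro test_function_partial; simp)+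
  have "fourier (\<lambda>x. 1 * g x + (- 1) * ?g'' x) \<xi> = complex_of_real (1 + (\<xi> \<bullet> b)\<^sup>2) * fourier g \<xi>" for \<xi>
    unfolding fourier_combine[OF test_functionD(2)[OF g] test_functionD(2)[OF t(2)]]
      fourier_partial[OF t(1) b] fourier_partial[OF g b]
    by (simp add: algebra_simps power2_eq_square)
  then show ?thesis using test_functions_combine[OF g t(2), of 1 "-1"] by blast
qed

lemma fourier_weight_prod:
  fixes g :: "'a::euclidean_space \<Rightarrow> real"
  assumes g: "g \<in> test_functions" and S: "finite S" "S \<subseteq> Basis"
  shows "\<exists>F\<in>test_functions. \<forall>\<xi>. fourier F \<xi> = complex_of_real (\<Prod>b\<in>S. 1 + (\<xi> \<bullet> b)\<^sup>2) * fourier g \<xi>"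
  using S
proof (induction S rule: finite_induct)
  case empty
  then show ?case using g by auto
next
  case (insert b S)
  then obtain F where F: "F \<in> test_functions" "\<And>\<xi>. fourier F \<xi> = complex_of_real (\<Prod>b\<in>S. 1 + (\<xi> \<bullet> b)\<^sup>2) * fourier g \<xi>"
    by auto
  from fourier_weight[OF F(1), of b] insert.prems obtain F' where "F' \<in> test_functions"
    "\<And>\<xi>. fourier F' \<xi> = complex_of_real (1 + (\<xi> \<bullet> b)\<^sup>2) * fourier F \<xi>" by auto
  then show ?case using insert.hyps F(2) by (intro bexI[of _ F']) (auto simp: mult.assoc)
qed

text \<open>A product over coordinates, so that the integral of its inverse factors into
  one-dimensional integrals of 1 / (1 + t^2). The inverse of 1 + |\<xi>|^2 would be integrable only
  in dimension one.\<close>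

definition weight :: "'a::euclidean_space \<Rightarrow> real" where
  "weight \<xi> = (\<Prod>b\<in>Basis. 1 + (\<xi> \<bullet> b)\<^sup>2)"

lemma fourier_weight_power:
  assumes g: "g \<in> test_functions"
  shows "\<exists>F\<in>test_functions. \<forall>\<xi>. fourier F \<xi> = complex_of_real (weight \<xi> ^ N) * fourier g \<xi>"
proof (induction N)
  case 0
  then show ?case using g by auto
next
  case (Suc N)
  then obtain F where F: "F \<in> test_functions" "\<And>\<xi>. fourier F \<xi> = complex_of_real (weight \<xi> ^ N) * fourier g \<xi>"
    by blast
  from fourier_weight_prod[OF F(1) finite_Basis subset_refl] obtain F' where "F' \<in> test_functions"
    "\<And>\<xi>. fourier F' \<xi> = complex_of_real (weight \<xi>) * fourier F \<xi>" by (auto simp: weight_def)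
  then show ?case using F(2) by (intro bexI[of _ F']) (auto simp: mult.assoc)
qed

text \<open>Multiplying out the product leaves 1 + |\<xi>|^2 plus nonnegative terms; since the
  weight is at least 1, |\<xi>|^2 is then also at most its square.\<close>

lemma weight_ge: "1 \<le> weight \<xi>" "norm \<xi> \<le> weight \<xi>"
proof -
  have sum: "1 + (\<Sum>b\<in>S. x b) \<le> (\<Prod>b\<in>S. 1 + x b)" if "finite S" "\<And>b. 0 \<le> x b" for S and x :: "'a \<Rightarrow> real"
    using that(1)
  proof (induction S rule: finite_induct)
    case (insert b S)
    have "1 + (\<Sum>b\<in>insert b S. x b) \<le> (1 + x b) * (1 + (\<Sum>b\<in>S. x b))"
      using insert.hyps that(2) by (simp add: algebra_simps sum_nonneg)
    also have "\<dots> \<le> (1 + x b) * (\<Prod>b\<in>S. 1 + x b)"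
      using insert.IH that(2) by (intro mult_left_mono) (auto simp: add_nonneg_nonneg)
    finally show ?case using insert.hyps by simp
  qed simp
  have le: "1 + (norm \<xi>)\<^sup>2 \<le> weight \<xi>"
    unfolding norm_sq_Basis weight_def by (rule sum) auto
  show "1 \<le> weight \<xi>" using le zero_le_power2[of "norm \<xi>"] by linarith
  then have "weight \<xi> \<le> (weight \<xi>)\<^sup>2" by (simp add: power2_eq_square)
  with le have "(norm \<xi>)\<^sup>2 \<le> (weight \<xi>)\<^sup>2" by linarith
  then show "norm \<xi> \<le> weight \<xi>" using \<open>1 \<le> weight \<xi>\<close> by (auto intro: power2_le_imp_le)
qed

lemma nn_integral_inverse_weight: "(\<integral>\<^sup>+\<xi>. ennreal (1 / weight (\<xi>::'a::euclidean_space)) \<partial>lborel) < \<infinity>"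
proof -
  have "integrable lborel (\<lambda>t::real. inverse (1 + t\<^sup>2))"
    using integrable_inverse_1_plus_square by (simp add: set_integrable_def)
  then have "(\<integral>\<^sup>+t. ennreal (inverse (1 + t\<^sup>2)) \<partial>lborel) = ennreal (LINT t|lborel. inverse (1 + (t::real)\<^sup>2))"
    by (intro nn_integral_eq_integral) (auto simp: add_nonneg_nonneg)
  moreover have "(\<integral>\<^sup>+\<xi>. ennreal (1 / weight (\<xi>::'a)) \<partial>lborel) = (\<integral>\<^sup>+\<xi>. (\<Prod>b\<in>Basis. ennreal (inverse (1 + (\<xi> \<bullet> b :: real)\<^sup>2))) \<partial>(lborel :: 'a measure))"
    by (intro nn_integral_cong) (simp add: weight_def prod_ennreal add_nonneg_nonneg divide_inverse prod_inversef[symmetric] comp_def)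
  moreover have "\<dots> = (\<Prod>b\<in>(Basis::'a set). (\<integral>\<^sup>+t. ennreal (inverse (1 + t\<^sup>2)) \<partial>lborel))"
    by (rule nn_integral_lborel_prod) auto
  ultimately show ?thesis by (simp add: ennreal_power)
qed

lemma fourier_energy_finite:
  fixes f :: "'a::euclidean_space \<Rightarrow> real"
  assumes f: "f \<in> test_functions"
  shows "(\<integral>\<^sup>+\<xi>. ennreal ((norm (fourier f \<xi>))\<^sup>2 * norm \<xi> ^ DIM('a)) \<partial>lborel) < \<infinity>"
proof -
  let ?n = "DIM('a)"
  obtain F where F: "F \<in> test_functions" "\<And>\<xi>. fourier F \<xi> = complex_of_real (weight \<xi> ^ ?n) * fourier f \<xi>"
    using fourier_weight_power[OF f, of ?n] by blast
  define C where "C = (LINT x|lborel. \<bar>F x\<bar>)"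
  have bd: "(norm (fourier f \<xi>))\<^sup>2 * norm \<xi> ^ ?n \<le> C\<^sup>2 * (1 / weight \<xi>)" for \<xi> :: 'a
  proof -
    define w where "w = weight \<xi>"
    have w: "1 \<le> w" "norm \<xi> \<le> w" using weight_ge[of \<xi>] by (auto simp: w_def)
    have "w ^ ?n * norm (fourier f \<xi>) \<le> C"
      using norm_fourier_le[OF test_functionD(2)[OF F(1)], of \<xi>] w(1) by (simp add: F(2) C_def norm_mult norm_power w_def[symmetric])
    then have "(w ^ ?n * norm (fourier f \<xi>))\<^sup>2 \<le> C\<^sup>2" using w by (intro power_mono) auto
    then have 1: "(norm (fourier f \<xi>))\<^sup>2 * (w ^ ?n * w ^ ?n) \<le> C\<^sup>2" by (simp add: power_mult_distrib power2_eq_square mult_ac)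
    \<comment> \<open>Decay of order w^n for the transform gives two factors w^n after squaring. One
      absorbs |\<xi>|^n, the other a single w (as n \<ge> 1), leaving the integrable 1 / w.\<close>
    have "(norm (fourier f \<xi>))\<^sup>2 * norm \<xi> ^ ?n * w \<le> (norm (fourier f \<xi>))\<^sup>2 * w ^ ?n * w ^ ?n"
      using w by (intro mult_mono power_mono self_le_power) auto
    with 1 have "(norm (fourier f \<xi>))\<^sup>2 * norm \<xi> ^ ?n * w \<le> C\<^sup>2" by (simp add: mult.assoc)
    then show ?thesis using w by (simp add: w_def[symmetric] field_simps)
  qed
  have "(\<integral>\<^sup>+\<xi>. ennreal ((norm (fourier f \<xi>))\<^sup>2 * norm \<xi> ^ ?n) \<partial>lborel) \<le> (\<integral>\<^sup>+\<xi>. ennreal (C\<^sup>2) * ennreal (1 / weight (\<xi>::'a)) \<partial>lborel)"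
    using bd weight_ge(1) by (intro nn_integral_mono) (auto simp: ennreal_mult'[symmetric] intro!: ennreal_leI)
  also have "\<dots> = ennreal (C\<^sup>2) * (\<integral>\<^sup>+\<xi>. ennreal (1 / weight (\<xi>::'a)) \<partial>lborel)"
    by (rule nn_integral_cmult) (simp add: weight_def)
  also have "\<dots> < \<infinity>" using nn_integral_inverse_weight[where 'a='a] by (simp add: ennreal_mult_less_top)
  finally show ?thesis .
qed

section \<open>The Cameron--Martin inequality and absolute continuity\<close>

lemma of_real_mult_norm_square:
  "complex_of_real a * (z * cnj z) = complex_of_real (a * (norm z)\<^sup>2)"
  by (simp only: of_real_mult complex_norm_square)

lemma gauss_form_self:
  fixes g :: "'a::euclidean_space \<Rightarrow> real"
  assumes \<sigma>: "0 < \<sigma>" and g: "integrable lborel g"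
  shows "ennreal (gauss_form \<sigma> g g) = (\<integral>\<^sup>+\<xi>. ennreal (gauss \<sigma> \<xi> * (norm (fourier g \<xi>))\<^sup>2) \<partial>lborel)"
    and "0 \<le> gauss_form \<sigma> g g"
proof -
  note * = gauss_form_fourier[OF \<sigma> g g, unfolded of_real_mult_norm_square]
  have int: "integrable lborel (\<lambda>\<xi>::'a. gauss \<sigma> \<xi> * (norm (fourier g \<xi>))\<^sup>2)"
    using integrable_Re[OF *(2)] by simp
  have eq: "gauss_form \<sigma> g g = (LINT \<xi>|lborel. gauss \<sigma> \<xi> * (norm (fourier g \<xi>))\<^sup>2)"
    using *(1) unfolding integral_complex_of_real of_real_eq_iff .
  have nn: "0 \<le> gauss \<sigma> \<xi> * (norm (fourier g \<xi>))\<^sup>2" for \<xi> :: 'a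
    using gauss_nonneg by (intro mult_nonneg_nonneg) auto
  show "ennreal (gauss_form \<sigma> g g) = (\<integral>\<^sup>+\<xi>. ennreal (gauss \<sigma> \<xi> * (norm (fourier g \<xi>))\<^sup>2) \<partial>lborel)"
    unfolding eq by (rule nn_integral_eq_integral[symmetric, OF int]) (use nn in auto)
  show "0 \<le> gauss_form \<sigma> g g" unfolding eq by (intro integral_nonneg_AE AE_I2 nn)
qed

text \<open>The mixture of the Gaussians \<open>gauss \<sigma> \<xi>\<close> over \<open>d\<sigma>/\<sigma>\<close> is a multiple of \<open>|\<xi>|^{-n}\<close>. Only a lower bound
  is needed; this constant comes from \<open>|\<xi>| \<le> \<sigma> \<le> 2 |\<xi>|\<close>.\<close>

definition log_kernel_const :: "nat \<Rightarrow> real" where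
  "log_kernel_const n = (1 / (2 * sqrt (2 * pi))) ^ n * exp (- 1 / 2) / 2"

lemma log_kernel_const_pos: "0 < log_kernel_const n"
  by (simp add: log_kernel_const_def)

lemma nn_integral_gauss_scale:
  fixes \<xi> :: "'a::euclidean_space"
  assumes "\<xi> \<noteq> 0"
  shows "ennreal (log_kernel_const DIM('a) / norm \<xi> ^ DIM('a)) \<le> (\<integral>\<^sup>+\<sigma>. ennreal (indicator {0<..} \<sigma> / \<sigma> * gauss \<sigma> \<xi>) \<partial>lborel)"
proof -
  define r where "r = norm \<xi>"
  have r: "0 < r" using assms by (simp add: r_def)
  \<comment> \<open>A lower bound for gauss \<sigma> \<xi> / \<sigma> on r \<le> \<sigma> \<le> 2 r:
    powers of 1 / \<sigma> are smallest at 2 r, the exponential at r. The interval has length r, so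
    the integral is at least k r.\<close>
  define k where "k = (1 / (2 * r)) * ((1 / (sqrt (2 * pi) * (2 * r))) ^ DIM('a) * exp (- 1 / 2))"
  have k: "0 \<le> k" using r by (simp add: k_def)
  have "log_kernel_const DIM('a) / r ^ DIM('a) = k * r"
    using r by (simp add: k_def log_kernel_const_def power_mult_distrib power_divide)
  then have "ennreal (log_kernel_const DIM('a) / r ^ DIM('a)) = (\<integral>\<^sup>+\<sigma>. ennreal k * indicator {r..2 * r} \<sigma> \<partial>lborel)"
    using r k by (simp add: nn_integral_cmult_indicator ennreal_mult)
  also have "\<dots> \<le> (\<integral>\<^sup>+\<sigma>. ennreal (indicator {0<..} \<sigma> / \<sigma> * gauss \<sigma> \<xi>) \<partial>lborel)"
  proof (rule nn_integral_mono)
    fix \<sigma> :: real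
    show "ennreal k * indicator {r..2 * r} \<sigma> \<le> ennreal (indicator {0<..} \<sigma> / \<sigma> * gauss \<sigma> \<xi>)"
    proof (cases "\<sigma> \<in> {r..2 * r}")
      case True
      then have \<sigma>: "0 < \<sigma>" "r \<le> \<sigma>" "\<sigma> \<le> 2 * r" using r by auto
      have "(r / \<sigma>)\<^sup>2 \<le> 1" using \<sigma> r by (simp add: power_le_one)
      then have "exp (- 1 / 2) \<le> exp (- (r / \<sigma>)\<^sup>2 / 2)" by simp
      moreover have "1 / (sqrt (2 * pi) * (2 * r)) \<le> 1 / (sqrt (2 * pi) * \<sigma>)"
        using \<sigma> r by (intro divide_left_mono mult_left_mono mult_pos_pos) auto
      moreover have "1 / (2 * r) \<le> 1 / \<sigma>" using \<sigma> r by (intro divide_left_mono) auto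
      ultimately have "k \<le> 1 / \<sigma> * gauss \<sigma> \<xi>"
        unfolding k_def gauss_eq[OF \<sigma>(1)] r_def[symmetric] using \<sigma> r
        by (intro mult_mono power_mono) auto
      then show ?thesis using True \<sigma> by (simp add: ennreal_leI)
    qed simp
  qed
  finally show ?thesis by (simp add: r_def)
qed

text \<open>The variance is a mixture over \<sigma> of the integrals of gauss \<sigma> times
  |fourier g|^2. With nonnegative integrands the mixture may be taken first, for fixed \<xi>, where
  \<open>nn_integral_gauss_scale\<close> bounds it below by a multiple of |\<xi>|^(-d).\<close>

lemma fourier_energy_le_log_variance:
  fixes g :: "'a::euclidean_space \<Rightarrow> real"
  assumes g: "g \<in> mean_zero_test_functions"
  shows "(\<integral>\<^sup>+\<xi>. ennreal ((norm (fourier g \<xi>))\<^sup>2 / norm \<xi> ^ DIM('a)) \<partial>lborel)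
      \<le> ennreal (log_variance g / log_kernel_const DIM('a))"
    and "0 \<le> log_variance g"
proof -
  let ?c = "log_kernel_const DIM('a)"
  have gt: "g \<in> test_functions" using g by (simp add: mean_zero_test_functions_def)
  note gi = test_functionD(2)[OF gt]
  note [measurable] = test_functionD(3)[OF gt]
  \<comment> \<open>At \<sigma> = 0 both sides are 0 because division by zero yields 0; the Fourier
    representation holds only for \<sigma> > 0.\<close>
  have eq: "indicator {0..} \<sigma> / \<sigma> * x = indicator {0<..} \<sigma> / \<sigma> * x" for \<sigma> x :: real
    by (cases "\<sigma> = 0") (auto simp: indicator_def)
  have V: "log_variance g = (LINT \<sigma>|lborel. indicator {0<..} \<sigma> / \<sigma> * gauss_form \<sigma> g g)"
    "integrable lborel (\<lambda>\<sigma>. indicator {0<..} \<sigma> / \<sigma> * gauss_form \<sigma> g g)"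
    using log_variance_gauss_form[OF g] unfolding eq by auto
  have nn: "0 \<le> indicator {0<..} \<sigma> / \<sigma> * gauss_form \<sigma> g g" for \<sigma>
    using gauss_form_self(2)[OF _ gi, of \<sigma>] by (cases "0 < \<sigma>") auto
  show V0: "0 \<le> log_variance g" unfolding V by (intro integral_nonneg_AE AE_I2 nn)
  have "ennreal ?c * (\<integral>\<^sup>+\<xi>. ennreal ((norm (fourier g \<xi>))\<^sup>2 / norm \<xi> ^ DIM('a)) \<partial>lborel)
    = (\<integral>\<^sup>+\<xi>. ennreal ((norm (fourier g \<xi>))\<^sup>2) * ennreal (?c / norm \<xi> ^ DIM('a)) \<partial>lborel)"
    using log_kernel_const_pos[of "DIM('a)"]
    by (subst nn_integral_cmult[symmetric]) (auto simp: ennreal_mult'[symmetric] mult_ac intro!: nn_integral_cong)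
  also have "\<dots> \<le> (\<integral>\<^sup>+\<xi>. ennreal ((norm (fourier g \<xi>))\<^sup>2) * (\<integral>\<^sup>+\<sigma>. ennreal (indicator {0<..} \<sigma> / \<sigma> * gauss \<sigma> \<xi>) \<partial>lborel) \<partial>lborel)"
  proof (rule nn_integral_mono_AE)
    show "AE \<xi> in lborel. ennreal ((norm (fourier g \<xi>))\<^sup>2) * ennreal (?c / norm \<xi> ^ DIM('a))
        \<le> ennreal ((norm (fourier g \<xi>))\<^sup>2) * (\<integral>\<^sup>+\<sigma>. ennreal (indicator {0<..} \<sigma> / \<sigma> * gauss \<sigma> \<xi>) \<partial>lborel)"
      using AE_lborel_singleton[of 0] by eventually_elim (intro mult_left_mono nn_integral_gauss_scale; simp)
  qed
  also have "\<dots> = (\<integral>\<^sup>+\<xi>. \<integral>\<^sup>+\<sigma>. ennreal ((norm (fourier g \<xi>))\<^sup>2) * ennreal (indicator {0<..} \<sigma> / \<sigma> * gauss \<sigma> \<xi>) \<partial>lborel \<partial>lborel)"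
    by (intro nn_integral_cong nn_integral_cmult[symmetric]) (simp add: gauss_def normal_density_def)
  also have "\<dots> = (\<integral>\<^sup>+\<sigma>. \<integral>\<^sup>+\<xi>. ennreal ((norm (fourier g \<xi>))\<^sup>2) * ennreal (indicator {0<..} \<sigma> / \<sigma> * gauss \<sigma> \<xi>) \<partial>lborel \<partial>lborel)"
    by (rule lborel_pair.Fubini') (simp add: gauss_def normal_density_def split_beta')
  also have "\<dots> = (\<integral>\<^sup>+\<sigma>. ennreal (indicator {0<..} \<sigma> / \<sigma> * gauss_form \<sigma> g g) \<partial>lborel)"
  proof (rule nn_integral_cong)
    fix \<sigma> :: real
    show "(\<integral>\<^sup>+\<xi>. ennreal ((norm (fourier g \<xi>))\<^sup>2) * ennreal (indicator {0<..} \<sigma> / \<sigma> * gauss \<sigma> \<xi>) \<partial>lborel)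
      = ennreal (indicator {0<..} \<sigma> / \<sigma> * gauss_form \<sigma> g g)"
    proof (cases "0 < \<sigma>")
      case True
      have "(\<integral>\<^sup>+\<xi>. ennreal ((norm (fourier g \<xi>))\<^sup>2) * ennreal (indicator {0<..} \<sigma> / \<sigma> * gauss \<sigma> \<xi>) \<partial>lborel)
        = (\<integral>\<^sup>+\<xi>. ennreal (1 / \<sigma>) * ennreal (gauss \<sigma> \<xi> * (norm (fourier g \<xi>))\<^sup>2) \<partial>lborel)"
        using True gauss_nonneg[of \<sigma>] by (intro nn_integral_cong) (simp add: ennreal_mult'[symmetric] ennreal_mult''[symmetric] mult_ac)
      also have "\<dots> = ennreal (1 / \<sigma>) * ennreal (gauss_form \<sigma> g g)"
        unfolding gauss_form_self(1)[OF True gi] by (rule nn_integral_cmult) measurable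
      finally show ?thesis using True gauss_form_self(2)[OF True gi] by (simp add: ennreal_mult'[symmetric])
    qed simp
  qed
  also have "\<dots> = ennreal (log_variance g)"
    unfolding V(1) by (rule nn_integral_eq_integral[OF V(2)]) (use nn in auto)
  finally have le: "ennreal ?c * (\<integral>\<^sup>+\<xi>. ennreal ((norm (fourier g \<xi>))\<^sup>2 / norm \<xi> ^ DIM('a)) \<partial>lborel) \<le> ennreal (log_variance g)" .
  have c: "0 < ?c" by (rule log_kernel_const_pos)
  have "(\<integral>\<^sup>+\<xi>. ennreal ((norm (fourier g \<xi>))\<^sup>2 / norm \<xi> ^ DIM('a)) \<partial>lborel)
    = ennreal (1 / ?c) * (ennreal ?c * (\<integral>\<^sup>+\<xi>. ennreal ((norm (fourier g \<xi>))\<^sup>2 / norm \<xi> ^ DIM('a)) \<partial>lborel))"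
    using c by (simp add: mult.assoc[symmetric] ennreal_mult'[symmetric])
  also have "\<dots> \<le> ennreal (1 / ?c) * ennreal (log_variance g)" by (intro mult_left_mono le) simp
  also have "\<dots> = ennreal (log_variance g / ?c)" using c V0 by (simp add: ennreal_mult'[symmetric])
  finally show "(\<integral>\<^sup>+\<xi>. ennreal ((norm (fourier g \<xi>))\<^sup>2 / norm \<xi> ^ DIM('a)) \<partial>lborel)
      \<le> ennreal (log_variance g / ?c)" .
qed

text \<open>The estimate is proved with a Gaussian of width 1 / \<tau> between f and g, uniformly in
  \<tau>, and then the width tends to 0. In the constant, \<open>k\<close> is the factor (2 pi)^(-d)
  of Fourier inversion, \<open>E\<close> the weighted energy of f, and \<open>?c\<close> the lower
  bound for the logarithmic kernel in Fourier space.\<close>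

theorem pairing_le_log_variance:
  fixes f :: "'a::euclidean_space \<Rightarrow> real"
  assumes f: "f \<in> test_functions"
  shows "\<exists>C\<ge>0. \<forall>g\<in>mean_zero_test_functions. (LINT x|lborel. f x * g x)\<^sup>2 \<le> C * log_variance g"
proof -
  let ?n = "DIM('a)" and ?c = "log_kernel_const DIM('a)"
  note fi = test_functionD(2)[OF f]
  have [measurable]: "f \<in> borel_measurable borel" using test_functionD(3)[OF f] .
  define k where "k = (1 / (2 * pi)) ^ ?n"
  have k: "0 \<le> k" by (simp add: k_def)
  define E where "E = enn2real (\<integral>\<^sup>+\<xi>. ennreal ((norm (fourier f \<xi>))\<^sup>2 * norm \<xi> ^ ?n) \<partial>lborel)"
  have E: "(\<integral>\<^sup>+\<xi>. ennreal ((norm (fourier f \<xi>))\<^sup>2 * norm \<xi> ^ ?n) \<partial>lborel) = ennreal E" "0 \<le> E"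
    unfolding E_def using fourier_energy_finite[OF f] by auto
  define C where "C = k\<^sup>2 * (E / ?c)"
  have c: "0 < ?c" by (rule log_kernel_const_pos)
  have "0 \<le> C" using E c by (simp add: C_def)
  moreover have "(LINT x|lborel. f x * g x)\<^sup>2 \<le> C * log_variance g" if g: "g \<in> mean_zero_test_functions" for g
  proof -
    have gt: "g \<in> test_functions" using g by (simp add: mean_zero_test_functions_def)
    note gi = test_functionD(2)[OF gt]
    note V = fourier_energy_le_log_variance[OF g]
    have [measurable]: "g \<in> borel_measurable borel" using test_functionD(3)[OF gt] .
    let ?N = "\<integral>\<^sup>+\<xi>. ennreal (norm (fourier f \<xi>) * norm (fourier g \<xi>)) \<partial>lborel"
    have CS: "?N\<^sup>2 \<le> ennreal (E * (log_variance g / ?c))"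
    proof -
      let ?u = "\<lambda>\<xi>::'a. ennreal (norm (fourier f \<xi>) * sqrt (norm \<xi> ^ ?n))"
      let ?v = "\<lambda>\<xi>::'a. ennreal (norm (fourier g \<xi>) / sqrt (norm \<xi> ^ ?n))"
      have "?N = (\<integral>\<^sup>+\<xi>. ?u \<xi> * ?v \<xi> \<partial>lborel)"
      proof (rule nn_integral_cong_AE)
        show "AE \<xi> in lborel. ennreal (norm (fourier f \<xi>) * norm (fourier g \<xi>)) = ?u \<xi> * ?v \<xi>"
          using AE_lborel_singleton[of "0::'a"]
          by eventually_elim (simp add: ennreal_mult'[symmetric])
      qed
      also have "\<dots>\<^sup>2 \<le> (\<integral>\<^sup>+\<xi>. ?u \<xi> ^ 2 \<partial>lborel) * (\<integral>\<^sup>+\<xi>. ?v \<xi> ^ 2 \<partial>lborel)"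
        by (rule Cauchy_Schwarz_nn_integral) measurable
      also have "(\<integral>\<^sup>+\<xi>. ?u \<xi> ^ 2 \<partial>lborel) = ennreal E"
        unfolding E(1)[symmetric] by (intro nn_integral_cong) (simp add: ennreal_power power_mult_distrib)
      also have "(\<integral>\<^sup>+\<xi>. ?v \<xi> ^ 2 \<partial>lborel) = (\<integral>\<^sup>+\<xi>. ennreal ((norm (fourier g \<xi>))\<^sup>2 / norm \<xi> ^ ?n) \<partial>lborel)"
        by (intro nn_integral_cong) (simp add: ennreal_power power_divide)
      also have "ennreal E * \<dots> \<le> ennreal E * ennreal (log_variance g / ?c)"
        by (intro mult_left_mono V) simp
      also have "\<dots> = ennreal (E * (log_variance g / ?c))" using E(2) by (simp add: ennreal_mult'[symmetric])
      finally show ?thesis .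
    qed
    have approx: "(LINT p|(lborel \<Otimes>\<^sub>M lborel). f (fst p) * g (snd p) * gauss (1 / \<tau>) (fst p - snd p))\<^sup>2 \<le> C * log_variance g"
      if \<tau>: "0 < \<tau>" for \<tau>
    proof -
      define a where "a = (LINT p|(lborel \<Otimes>\<^sub>M lborel). f (fst p) * g (snd p) * gauss (1 / \<tau>) (fst p - snd p))"
      define l where "l = (\<tau> / sqrt (2 * pi)) ^ ?n"
      have l: "0 \<le> l" using \<tau> by (simp add: l_def)
      have "gauss (1 / \<tau>) x = l * exp (- (\<tau> * norm x)\<^sup>2 / 2)" for x :: 'a
        using \<tau> by (subst gauss_eq) (auto simp: l_def mult.commute)
      then have "a = (LINT p|(lborel \<Otimes>\<^sub>M lborel). l * (f (fst p) * g (snd p) * exp (- (\<tau> * norm (fst p - snd p))\<^sup>2 / 2)))"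
        unfolding a_def by (intro Bochner_Integration.integral_cong) auto
      then have a: "a = l * gauss_form \<tau> f g" by (simp add: gauss_form_def)
      \<comment> \<open>The normalization of the Gaussian of width 1 / \<tau> and the peak of its
        Fourier dual \<open>gauss \<tau>\<close> multiply to \<open>k\<close>, whatever \<tau> is;
        this gives the uniformity.\<close>
      have bd: "l * gauss \<tau> \<xi> \<le> k" for \<xi> :: 'a
      proof -
        have "l * (1 / (sqrt (2 * pi) * \<tau>)) ^ ?n = k"
          using \<tau> by (simp add: l_def k_def power_mult_distrib[symmetric])
        then have "l * gauss \<tau> \<xi> = k * exp (- (norm \<xi> / \<tau>)\<^sup>2 / 2)"
          unfolding gauss_eq[OF \<tau>] by (simp add: mult.assoc[symmetric])
        also have "\<dots> \<le> k * 1" using k by (intro mult_left_mono) auto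
        finally show ?thesis by simp
      qed
      have "ennreal \<bar>a\<bar> = ennreal l * ennreal (norm (complex_of_real (gauss_form \<tau> f g)))"
        using l by (simp add: a abs_mult ennreal_mult'[symmetric])
      also have "\<dots> \<le> ennreal l * (\<integral>\<^sup>+\<xi>. ennreal (norm (complex_of_real (gauss \<tau> \<xi>) * (fourier f \<xi> * cnj (fourier g \<xi>)))) \<partial>lborel)"
        unfolding gauss_form_fourier(1)[OF \<tau> fi gi]
        by (intro mult_left_mono integral_norm_bound_ennreal gauss_form_fourier(2)[OF \<tau> fi gi]) simp
      also have "\<dots> = (\<integral>\<^sup>+\<xi>. ennreal l * ennreal (norm (complex_of_real (gauss \<tau> \<xi>) * (fourier f \<xi> * cnj (fourier g \<xi>)))) \<partial>lborel)"
        using gauss_form_fourier(2)[OF \<tau> fi gi] by (intro nn_integral_cmult[symmetric]) simp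
      also have "\<dots> \<le> (\<integral>\<^sup>+\<xi>. ennreal k * ennreal (norm (fourier f \<xi>) * norm (fourier g \<xi>)) \<partial>lborel)"
      proof (rule nn_integral_mono)
        fix \<xi> :: 'a
        have "l * norm (complex_of_real (gauss \<tau> \<xi>) * (fourier f \<xi> * cnj (fourier g \<xi>)))
            = (l * gauss \<tau> \<xi>) * (norm (fourier f \<xi>) * norm (fourier g \<xi>))"
          using gauss_nonneg[of \<tau> \<xi>] by (simp add: norm_mult mult_ac)
        also have "\<dots> \<le> k * (norm (fourier f \<xi>) * norm (fourier g \<xi>))"
          by (intro mult_right_mono bd) simp
        finally show "ennreal l * ennreal (norm (complex_of_real (gauss \<tau> \<xi>) * (fourier f \<xi> * cnj (fourier g \<xi>))))
            \<le> ennreal k * ennreal (norm (fourier f \<xi>) * norm (fourier g \<xi>))"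
          using l k by (simp add: ennreal_mult'[symmetric] ennreal_leI del: norm_mult)
      qed
      also have "\<dots> = ennreal k * ?N" by (rule nn_integral_cmult) measurable
      finally have "(ennreal \<bar>a\<bar>)\<^sup>2 \<le> (ennreal k * ?N)\<^sup>2" by (rule power_mono) simp
      also have "\<dots> = (ennreal k)\<^sup>2 * ?N\<^sup>2" by (simp add: power_mult_distrib)
      also have "\<dots> \<le> (ennreal k)\<^sup>2 * ennreal (E * (log_variance g / ?c))" by (intro mult_left_mono CS) simp
      also have "\<dots> = ennreal (C * log_variance g)"
        using k by (simp add: C_def ennreal_power ennreal_mult'[symmetric] mult_ac)
      finally have "ennreal (\<bar>a\<bar>\<^sup>2) \<le> ennreal (C * log_variance g)" by (simp add: ennreal_power)
      then show ?thesis using \<open>0 \<le> C\<close> V(2) by (simp add: a_def)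
    qed
    show ?thesis
    proof (rule LIMSEQ_le_const2)
      show "(\<lambda>m. (LINT p|(lborel \<Otimes>\<^sub>M lborel). f (fst p) * g (snd p) * gauss (1 / real (Suc m)) (fst p - snd p))\<^sup>2)
          \<longlonglongrightarrow> (LINT x|lborel. f x * g x)\<^sup>2"
        by (intro tendsto_power gauss_convolution_tendsto f gt)
      show "\<exists>N. \<forall>m\<ge>N. (LINT p|(lborel \<Otimes>\<^sub>M lborel). f (fst p) * g (snd p) * gauss (1 / real (Suc m)) (fst p - snd p))\<^sup>2 \<le> C * log_variance g"
        by (intro exI allI impI approx) simp
    qed
  qed
  ultimately show ?thesis by blast
qed

section \<open>Absolute continuity of the laws modulo constants\<close>

theorem lemma2p6:
  fixes M :: "'w measure"
    and h :: "'w \<Rightarrow> (real ^ 'd \<Rightarrow> real) \<Rightarrow> real"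
    and f :: "real ^ 'd \<Rightarrow> real"
  assumes "CARD('d) \<ge> 2"
    and "log_correlated_gaussian_field M h"
    and "f \<in> test_functions"
  shows "absolutely_continuous (law_mod_const M h)
           (law_mod_const M (\<lambda>\<omega>. add_function (h \<omega>) f))"
proof -
  let ?G = "mean_zero_test_functions :: (real ^ 'd \<Rightarrow> real) set"
  let ?P = "PiM ?G (\<lambda>_. borel :: real measure)"
  note f = assms(3)
  have h: "prob_space M" "h \<in> M \<rightarrow>\<^sub>M gf_space"
    "\<And>g. g \<in> ?G \<Longrightarrow> centered_gaussian M (\<lambda>\<omega>. h \<omega> g) (log_variance g)"
    using assms(2) by (auto simp: log_correlated_gaussian_field_def)
  have gf: "h \<omega> \<in> generalized_functions" if "\<omega> \<in> space M" for \<omega>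
    using measurable_space[OF h(2) that] by (simp add: gf_space_def space_restrict_space)
  have G: "g \<in> test_functions" "(LINT x|lborel. g x) = 0" if "g \<in> ?G" for g
    using that by (auto simp: mean_zero_test_functions_def)
  have combine: "(\<lambda>x. a * g x + c * g' x) \<in> ?G" if "g \<in> ?G" "g' \<in> ?G" for a c g g'
    using that test_functions_combine[of g g' a c] test_function_integrable[of g] test_function_integrable[of g']
    by (simp add: mean_zero_test_functions_def)
  interpret prob_space M by fact
  \<comment> \<open>Every value of \<open>h\<close> is a generalized function, so linearity holds at
    each \<omega> and not merely almost surely.\<close>
  interpret linear_gaussian_process M ?G "\<lambda>g \<omega>. h \<omega> g" log_variance
  proof
    show "(\<lambda>_. 0) \<in> ?G"
      using test_functions_combine[OF f f, of 0 0] by (simp add: mean_zero_test_functions_def)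
  qed (use combine h(3) in \<open>auto intro!: gf_combine gf G\<close>)
  define l where "l g = (LINT x|lborel. f x * g x)" for g
  obtain B where B: "\<And>x. \<bar>f x\<bar> \<le> B" using test_functionD(4)[OF f] by blast
  have fg: "integrable lborel (\<lambda>x. f x * g x)" if "g \<in> test_functions" for g
  proof -
    have "\<bar>f x\<bar> \<le> \<bar>B\<bar>" for x using B[of x] by simp
    then show ?thesis
      using test_functionD(3)[OF f] test_functionD(3)[OF that]
      by (intro Bochner_Integration.integrable_bound[OF integrable_mult_right[OF integrable_abs[OF test_functionD(2)[OF that]], of B]])
         (auto simp: abs_mult intro!: mult_right_mono)
  qed
  have l: "linear_functional l"
    unfolding linear_functional_def
  proof (intro allI ballI)
    fix a c g g' assume g: "g \<in> ?G" "g' \<in> ?G"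
    have "l (\<lambda>x. a * g x + c * g' x) = (LINT x|lborel. a * (f x * g x) + c * (f x * g' x))"
      unfolding l_def by (intro Bochner_Integration.integral_cong) (auto simp: algebra_simps)
    then show "l (\<lambda>x. a * g x + c * g' x) = a * l g + c * l g'"
      using fg[OF G(1)[OF g(1)]] fg[OF G(1)[OF g(2)]] by (simp add: l_def)
  qed
  obtain C where C: "0 \<le> C" "\<And>g. g \<in> ?G \<Longrightarrow> (l g)\<^sup>2 \<le> C * log_variance g"
    using pairing_le_log_variance[OF f] by (auto simp: l_def)
  \<comment> \<open>Events modulo constants are traces of events A' of the full product space on the
    set of classes of generalized functions. That set is not assumed to be measurable in the
    product, but the random element always lies in it, so A and A' have the same mass and null sets
    can be compared in the product space.\<close>
  have law: "emeasure (law_mod_const M k) A = emeasure (distr M ?P (\<lambda>\<omega>. mod_const (k \<omega>))) A'"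
    if k: "k \<in> M \<rightarrow>\<^sub>M gf_space" and A: "A = mod_const ` generalized_functions \<inter> A'" "A' \<in> sets ?P"
    for k and A A'
  proof -
    have m: "(\<lambda>\<omega>. mod_const (k \<omega>)) \<in> M \<rightarrow>\<^sub>M gf_mod_const_space"
      by (rule measurable_compose[OF k mod_const_measurable])
    then have m': "(\<lambda>\<omega>. mod_const (k \<omega>)) \<in> M \<rightarrow>\<^sub>M ?P"
      unfolding gf_mod_const_space_def by (rule measurable_restrict_space2_iff[THEN iffD1, THEN conjunct1])
    have "k \<omega> \<in> generalized_functions" if "\<omega> \<in> space M" for \<omega>
      using measurable_space[OF k that] by (simp add: gf_space_def space_restrict_space)
    then have "(\<lambda>\<omega>. mod_const (k \<omega>)) -` A \<inter> space M = (\<lambda>\<omega>. mod_const (k \<omega>)) -` A' \<inter> space M"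
      by (auto simp: A(1))
    moreover have "A \<in> sets gf_mod_const_space"
      using A by (auto simp: gf_mod_const_space_def sets_restrict_space)
    ultimately show ?thesis
      using A m m' by (simp add: law_mod_const_def emeasure_distr)
  qed
  have k: "(\<lambda>\<omega>. add_function (h \<omega>) f) \<in> M \<rightarrow>\<^sub>M gf_space"
    by (rule measurable_compose[OF h(2) add_function_measurable[OF f]])
  have F: "mod_const (h \<omega>) = (\<lambda>g\<in>?G. h \<omega> g)" "mod_const (add_function (h \<omega>) f) = (\<lambda>g\<in>?G. h \<omega> g + l g)" for \<omega>
    using G(1) by (auto simp: mod_const_def add_function_def l_def restrict_def fun_eq_iff)
  show ?thesis
    unfolding absolutely_continuous_def
  proof
    fix A assume A: "A \<in> null_sets (law_mod_const M h)"
    then have As: "A \<in> sets gf_mod_const_space" by (auto simp: law_mod_const_def)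
    then obtain A' where A': "A = mod_const ` generalized_functions \<inter> A'" "A' \<in> sets ?P"
      by (auto simp: gf_mod_const_space_def sets_restrict_space)
    have "A' \<in> null_sets (distr M ?P (\<lambda>\<omega>. \<lambda>g\<in>?G. h \<omega> g))"
      using A A'(2) law[OF h(2) A'] by (auto simp: null_sets_def F)
    from shift_null_sets[OF l C this] law[OF k A'] As
    show "A \<in> null_sets (law_mod_const M (\<lambda>\<omega>. add_function (h \<omega>) f))"
      by (auto simp: null_sets_def F law_mod_const_def)
  qed
qed

end
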